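(* Let $\alpha\in(0,3)\setminus\{2\}$, let $X_{11}$ be symmetric with $\mathbb P(|X_{11}|>x)=x^{-\alpha}L(x)$, $x>0$, $L$ slowly varying at infinity, and $\mathbb E[X_{11}^2]=1$ if $\alpha>2$. Let $c_\delta\in(0,\infty)$ and assume that, as $n\to\infty$, $$p=p_n\sim c_\delta\, n^{1/2}\ \text{ if }\alpha\in(0,2),\qquad p=p_n\sim c_\delta\,\frac{n^{(\alpha-1)/2}}{L(n^{1/2})}\ \text{ if }\alpha\in(2,3).$$ Then for every integer $s\ge1$ $$\lim_{n\to\infty}\mathbb E[T_1^s]=M_s:=\sum_{v=1}^{\lfloor s/2\rfloor}c_\delta^{2v}\,\frac{2^{s-v}}{v!}\sum_{\substack{m_1,\ldots,m_v\ge2\\ m_1+\cdots+m_v=s}}\frac{s!}{m_1!\cdots m_v!}\prod_{\ell=1}^v c_{m_\ell}(\alpha)^2,$$ where the inner sum is over ordered tuples of integers (and the empty sum is $0$, so $M_1=0$).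
   Context: For each $n$, $(X_{ij})_{1\le i\le p,1\le j\le n}$ are iid copies of a non-degenerate real random variable $X_{11}$ which is symmetric and satisfies $\mathbb P(X_{11}=0)=0$. Put $Y_{ij}=X_{ij}/\sqrt{X_{i1}^2+\cdots+X_{in}^2}$ and $$T_1=\sum_{\substack{i_1,i_2=1\\ i_1\ne i_2}}^p\sum_{t=1}^n\Big(Y_{i_1t}^2-\frac1n\Big)\Big(Y_{i_2t}^2-\frac1n\Big).$$ For integers $m\ge2$, $$c_m(\alpha)=\begin{cases}\dfrac{\Gamma(m-\alpha/2)}{\Gamma(1-\alpha/2)\Gamma(m)},&\alpha\in(0,2),\\[2mm]\dfrac{\Gamma(1+\alpha/2)\Gamma(m-\alpha/2)}{\Gamma(m)},&\alpha\in[2,4).\end{cases}$$ The notation $a_n\sim b_n$ means $a_n/b_n\to1$. *)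

theory Defs
  imports "HOL-Probability.Probability" "HOL-Library.Landau_Symbols"
begin

(* L is only required to be defined, positive and measurable near infinity. *)
definition slowly_varying :: "(real \<Rightarrow> real) \<Rightarrow> bool" where
  "slowly_varying L \<longleftrightarrow>
     (\<exists>A. L \<in> borel_measurable (restrict_space borel {A..}) \<and> (\<forall>x\<ge>A. 0 < L x)) \<and>
     (\<forall>c>0. ((\<lambda>x. L (c * x) / L x) \<longlongrightarrow> 1) at_top)"

definition symmetric_rv :: "'a measure \<Rightarrow> ('a \<Rightarrow> real) \<Rightarrow> bool" where
  "symmetric_rv N Z \<longleftrightarrow> distr N borel (\<lambda>\<omega>. - Z \<omega>) = distr N borel Z"

definition nondegenerate_rv :: "'a measure \<Rightarrow> ('a \<Rightarrow> real) \<Rightarrow> bool" where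
  "nondegenerate_rv N Z \<longleftrightarrow> \<not> (\<exists>c. AE \<omega> in N. Z \<omega> = c)"

(* Matrix entries are indexed from 1: row i in {1..p}, column j in {1..n}.  The copies
   may live on a probability space M different from the space N carrying Z. *)
definition iid_copies ::
  "'a measure \<Rightarrow> nat \<Rightarrow> nat \<Rightarrow> (nat \<Rightarrow> nat \<Rightarrow> 'a \<Rightarrow> real) \<Rightarrow> 'b measure \<Rightarrow> ('b \<Rightarrow> real) \<Rightarrow> bool" where
  "iid_copies M p n X N Z \<longleftrightarrow>
     prob_space.indep_vars M (\<lambda>_. borel) (\<lambda>(i, j). X i j) ({1..p} \<times> {1..n}) \<and>
     (\<forall>i\<in>{1..p}. \<forall>j\<in>{1..n}. distr M borel (X i j) = distr N borel Z)"

definition Y :: "nat \<Rightarrow> (nat \<Rightarrow> nat \<Rightarrow> real) \<Rightarrow> nat \<Rightarrow> nat \<Rightarrow> real" where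
  "Y n x i j = x i j / sqrt (\<Sum>k=1..n. (x i k)\<^sup>2)"

definition T1 :: "nat \<Rightarrow> nat \<Rightarrow> (nat \<Rightarrow> nat \<Rightarrow> real) \<Rightarrow> real" where
  "T1 p n x =
     (\<Sum>(i1, i2) \<in> {(i1, i2). i1 \<in> {1..p} \<and> i2 \<in> {1..p} \<and> i1 \<noteq> i2}.
        \<Sum>t=1..n. ((Y n x i1 t)\<^sup>2 - 1 / real n) * ((Y n x i2 t)\<^sup>2 - 1 / real n))"

(* Only used for m \<ge> 2 and 0 < \<alpha> < 4. *)
definition c_coeff :: "nat \<Rightarrow> real \<Rightarrow> real" where
  "c_coeff m \<alpha> =
     (if \<alpha> < 2 then Gamma (real m - \<alpha> / 2) / (Gamma (1 - \<alpha> / 2) * Gamma (real m))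
      else Gamma (1 + \<alpha> / 2) * Gamma (real m - \<alpha> / 2) / Gamma (real m))"

(* Ordered tuples (m_1, ..., m_v), as functions on {1..v} (undefined elsewhere, so that
   distinct functions are distinct tuples). *)
definition tuples_ge2 :: "nat \<Rightarrow> nat \<Rightarrow> (nat \<Rightarrow> nat) set" where
  "tuples_ge2 v s = {m \<in> {1..v} \<rightarrow>\<^sub>E {2..}. (\<Sum>l=1..v. m l) = s}"

lemma finite_tuples_ge2: "finite (tuples_ge2 v s)"
proof (rule finite_subset)
  show "tuples_ge2 v s \<subseteq> {1..v} \<rightarrow>\<^sub>E {..s}"
  proof
    fix m assume m: "m \<in> tuples_ge2 v s"
    have "m l \<le> s" if "l \<in> {1..v}" for l
      using m member_le_sum[of l "{1..v}" m] that by (auto simp: tuples_ge2_def)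
    then show "m \<in> {1..v} \<rightarrow>\<^sub>E {..s}"
      using m by (auto simp: tuples_ge2_def PiE_iff)
  qed
qed (simp add: finite_PiE)

definition M_lim :: "real \<Rightarrow> real \<Rightarrow> nat \<Rightarrow> real" where
  "M_lim c\<delta> \<alpha> s =
     (\<Sum>v=1..s div 2. c\<delta> ^ (2 * v) * (2 ^ (s - v) / fact v) *
        (\<Sum>m\<in>tuples_ge2 v s. fact s / (\<Prod>l=1..v. fact (m l)) *
           (\<Prod>l=1..v. (c_coeff (m l) \<alpha>)\<^sup>2)))"

end

theory Submission
  imports Defs "HOL-Computational_Algebra.Formal_Power_Series" "HOL-Real_Asymp.Real_Asymp"
begin

text \<open>
  Put \<open>Z = Y\<^sup>2 - 1/n\<close> entrywise and \<open>a = \<alpha>/2\<close>. The squares of the normalised entries of one row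
  are shares: they are nonnegative, exchangeable and add up to one, so the \<open>Z\<close> of a row add up to
  zero. Different rows are independent.

  The statistic is twice the sum of \<open>Z\<^sub>i\<^sub>t Z\<^sub>j\<^sub>t\<close> over all slots, where a slot is an unordered
  pair of rows together with a column. Its power with exponent \<open>s\<close> is \<open>2^s\<close> times a sum over maps
  from \<open>{1..s}\<close> to slots, and the expectation of the term of a map is a product of mixed moments
  of \<open>Z\<close>, one for each row that the map touches (\<open>expectation_T1_power\<close>).

  Exchangeability and the two sum rules alone show that a mixed moment over \<open>r\<close> distinct columns
  is at most \<open>r (4/n)^(r-1) E Z\<^sup>2\<close> once \<open>n \<ge> 2r\<close> (\<open>row_moment_bound\<close>). Let \<open>q\<close> be the order of \<open>E
  Z^m\<close> for \<open>m \<ge> 2\<close>; the assumption on \<open>p\<close> says that \<open>p q sqrt n\<close> tends to \<open>c\<delta>\<close>. So each row costs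
  \<open>p^(-1) n^(-(2r-1)/2)\<close>. A map with \<open>V\<close> rows, \<open>b\<close> columns and \<open>I\<close> incidences between them has
  weight of order at most \<open>p^(-V) n^(-(2I-V)/2)\<close>, and the number of such maps is of order at most
  \<open>p^V n^b\<close>. Always \<open>I \<ge> V\<close> and \<open>I \<ge> 2b\<close>, and if both are equalities then no two of the slots in
  the image share a row. All other maps are therefore negligible, and for the maps that remain the
  weight is the product of \<open>(E Z^m)\<^sup>2\<close> over the slots, \<open>m\<close> being the multiplicity of the slot.
  Extending this product formula to all maps changes the sum only by a negligible amount
  (\<open>weight_sum_approx\<close>). The resulting sum is \<open>s!\<close> times the coefficient of \<open>x^s\<close> in the power of
  \<open>\<Sum>m. (E Z^m)\<^sup>2 x^m / m!\<close> whose exponent is the number of slots. As \<open>E Z = 0\<close>, expanding this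
  power binomially gives the sum over \<open>v\<close> and over tuples of integers at least two in the limit
  (\<open>slot_sum_limit\<close>).

  It remains to see that \<open>E Z^m / q\<close> tends to \<open>c_coeff m \<alpha>\<close>, where \<open>q = 1/n\<close> for \<open>a < 1\<close> and \<open>q =
  P(X\<^sup>2 > n)\<close> for \<open>a > 1\<close>. With \<open>G\<^sub>m(t) = E (t X\<^sup>2)^m exp(-t X\<^sup>2)\<close> and \<open>\<phi>(t) = E exp(-t X\<^sup>2)\<close>,
  writing the power of the sum of squares in the denominator as a Gamma integral gives \<open>\<Gamma>(m) E
  Y^(2m) = \<integral> t^(-1) G\<^sub>m(t) \<phi>(t)^(n-1) dt\<close> over \<open>t > 0\<close> (\<open>integral_laplace_power\<close>), and regular
  variation gives \<open>G\<^sub>m(1/x) \<sim> a \<Gamma>(m-a) P(X\<^sup>2 > x)\<close> (\<open>bump_mean_limit\<close>). For \<open>a < 1\<close> the value of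
  the integral for \<open>m = 1\<close> is known, since \<open>E Y\<^sup>2 = 1/n\<close>, and the integral concentrates near zero,
  where \<open>G\<^sub>m / G\<^sub>1\<close> is close to \<open>\<Gamma>(m-a) / \<Gamma>(1-a)\<close> (\<open>even_moment_heavy\<close>). For \<open>a > 1\<close> the
  substitution \<open>t = v/n\<close> turns \<open>\<phi>^(n-1)\<close> into \<open>exp(-v)\<close> and leaves a Gamma integral
  (\<open>even_moment_light\<close>).
\<close>

section \<open>The shares of one row\<close>

text \<open>
  The squared self-normalised entry \<open>Y\<^sup>2\<close> as a function of its row.
\<close>

definition share :: "nat \<Rightarrow> (nat \<Rightarrow> real) \<Rightarrow> nat \<Rightarrow> real" where
  "share n x j = (x j)\<^sup>2 / (\<Sum>k=1..n. (x k)\<^sup>2)"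

lemma share_bounds:
  assumes "j \<in> {1..n}"
  shows "0 \<le> share n x j" "share n x j \<le> 1"
proof -
  show "0 \<le> share n x j"
    by (simp add: share_def sum_nonneg)
  have "(x j)\<^sup>2 \<le> (\<Sum>k=1..n. (x k)\<^sup>2)"
    by (rule member_le_sum) (use assms in auto)
  then show "share n x j \<le> 1"
    unfolding share_def by (intro divide_le_eq_1[THEN iffD2]) (auto simp: sum_nonneg intro: le_neq_trans)
qed

text \<open>
  Having no atom at zero makes the sum of squares of a row positive almost surely.
\<close>

locale entry_law = prob_space \<mu> for \<mu> :: "real measure" +
  assumes sets_entry [measurable_cong, simp]: "sets \<mu> = sets borel"
    and entry_nonzero: "AE x in \<mu>. x \<noteq> 0"
begin

definition row_law :: "nat \<Rightarrow> (nat \<Rightarrow> real) measure" where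
  "row_law n = PiM {1..n} (\<lambda>_. \<mu>)"

text \<open>
  All moments of a row that occur are integrals of products of functions of single shares.
\<close>

definition share_moment :: "nat \<Rightarrow> (nat \<Rightarrow> real \<Rightarrow> real) \<Rightarrow> real" where
  "share_moment n h = (\<integral>x. (\<Prod>j=1..n. h j (share n x j)) \<partial>row_law n)"

definition row_moment :: "nat \<Rightarrow> (nat \<Rightarrow> nat) \<Rightarrow> real" where
  "row_moment n \<beta> = share_moment n (\<lambda>j u. (u - 1 / real n) ^ \<beta> j)"

definition centered_moment :: "nat \<Rightarrow> nat \<Rightarrow> real" where
  "centered_moment n m = row_moment n (\<lambda>j. if j = 1 then m else 0)"

lemma space_entry [simp]: "space \<mu> = UNIV"
  using sets_eq_imp_space_eq[OF sets_entry] by simp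

lemma prob_space_row: "prob_space (row_law n)"
  unfolding row_law_def by (intro prob_space_PiM) (rule prob_space_axioms)

lemma measurable_component_row: "j \<in> {1..n} \<Longrightarrow> (\<lambda>x. x j) \<in> borel_measurable (row_law n)"
  unfolding row_law_def by measurable

lemma measurable_share: "j \<in> {1..n} \<Longrightarrow> (\<lambda>x. share n x j) \<in> borel_measurable (row_law n)"
  unfolding share_def using measurable_component_row
  by (intro borel_measurable_divide borel_measurable_power borel_measurable_sum) auto

lemma sum_share_AE:
  assumes "n \<ge> 1"
  shows "AE x in row_law n. (\<Sum>j=1..n. share n x j) = 1"
proof -
  have "AE x in row_law n. x 1 \<noteq> 0"
    unfolding row_law_def
    by (rule AE_PiM_component) (use assms entry_nonzero prob_space_axioms in auto)
  then show ?thesis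
  proof eventually_elim
    fix x :: "nat \<Rightarrow> real" assume "x 1 \<noteq> 0"
    moreover have "(x 1)\<^sup>2 \<le> (\<Sum>k=1..n. (x k)\<^sup>2)"
      by (rule member_le_sum) (use assms in auto)
    ultimately have "(\<Sum>k=1..n. (x k)\<^sup>2) \<noteq> 0"
      by (metis less_le_not_le zero_less_power2)
    then show "(\<Sum>j=1..n. share n x j) = 1"
      by (simp add: share_def sum_divide_distrib[symmetric])
  qed
qed

lemma integrable_row_bounded:
  fixes f :: "(nat \<Rightarrow> real) \<Rightarrow> real"
  assumes "f \<in> borel_measurable (row_law n)" "\<And>x. \<bar>f x\<bar> \<le> B"
  shows "integrable (row_law n) f"
proof -
  interpret R: prob_space "row_law n" by (rule prob_space_row)
  show ?thesis
    by (rule R.integrable_const_bound[where B=B]) (use assms in auto)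
qed

lemma integrable_share_prod:
  fixes h :: "nat \<Rightarrow> real \<Rightarrow> real"
  assumes "\<And>j. continuous_on UNIV (h j)"
  shows "integrable (row_law n) (\<lambda>x. \<Prod>j=1..n. h j (share n x j))"
proof -
  have "\<exists>B. \<forall>u\<in>{0..1}. \<bar>h j u\<bar> \<le> B" for j
  proof -
    have "compact (h j ` {0..1})"
      using assms continuous_on_subset by (intro compact_continuous_image) blast+
    then show ?thesis
      using compact_imp_bounded bounded_real by (metis image_eqI)
  qed
  then obtain B where B: "\<And>j u. u \<in> {0..1} \<Longrightarrow> \<bar>h j u\<bar> \<le> B j"
    by metis
  note measurable_share [measurable]
  have [measurable]: "h j \<in> borel_measurable borel" for j
    using assms borel_measurable_continuous_onI by blast
  show ?thesis
  proof (rule integrable_row_bounded)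
    show "(\<lambda>x. \<Prod>j=1..n. h j (share n x j)) \<in> borel_measurable (row_law n)"
      by measurable
    fix x
    show "\<bar>\<Prod>j=1..n. h j (share n x j)\<bar> \<le> (\<Prod>j=1..n. B j)"
      unfolding abs_prod by (intro prod_mono) (use share_bounds B in auto)
  qed
qed

text \<open>
  Exchangeability of the shares: the product law is invariant under permutations of the columns, and
  so is the sum of squares in the denominator.
\<close>

lemma share_moment_permute:
  assumes h: "\<And>j. continuous_on UNIV (h j)" and \<pi>: "\<pi> permutes {1..n}"
  shows "share_moment n (\<lambda>j. h (\<pi> j)) = share_moment n h"
proof -
  note measurable_share [measurable]
  have [measurable]: "h j \<in> borel_measurable borel" for j
    using h borel_measurable_continuous_onI by blast
  let ?g = "\<lambda>x. \<lambda>k\<in>{1..n}. x (\<pi> k)"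
  have im: "\<pi> \<in> {1..n} \<rightarrow> {1..n}"
    using permutes_in_image[OF \<pi>] by blast
  have d: "distr (row_law n) (row_law n) ?g = row_law n"
    unfolding row_law_def
    by (rule distr_PiM_reindex[of "{1..n}" "\<lambda>_. \<mu>" \<pi> "{1..n}"])
       (use \<pi> prob_space_axioms im in \<open>auto intro: permutes_inj_on\<close>)
  have g: "?g \<in> measurable (row_law n) (row_law n)"
    unfolding row_law_def by (rule measurable_restrict, rule measurable_component_singleton)
       (use im in auto)
  have sh: "share n (?g x) j = share n x (\<pi> j)" if "j \<in> {1..n}" for x j
  proof -
    have "(\<Sum>k=1..n. (?g x k)\<^sup>2) = (\<Sum>k=1..n. (x (\<pi> k))\<^sup>2)"
      by (intro sum.cong) auto
    also have "\<dots> = (\<Sum>k=1..n. (x k)\<^sup>2)"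
      by (rule sum.permute[OF \<pi>, unfolded comp_def, symmetric])
    finally show ?thesis
      using that by (simp add: share_def)
  qed
  have "share_moment n (\<lambda>j. h (\<pi> j)) = (\<integral>x. (\<Prod>j=1..n. h (\<pi> j) (share n x j)) \<partial>distr (row_law n) (row_law n) ?g)"
    unfolding d share_moment_def ..
  also have "\<dots> = (\<integral>x. (\<Prod>j=1..n. h (\<pi> j) (share n (?g x) j)) \<partial>row_law n)"
    by (rule integral_distr[OF g]) measurable
  also have "\<dots> = (\<integral>x. (\<Prod>j=1..n. h (\<pi> j) (share n x (\<pi> j))) \<partial>row_law n)"
    by (intro Bochner_Integration.integral_cong prod.cong refl) (simp only: sh)
  also have "\<dots> = share_moment n h"
    unfolding share_moment_def
    by (intro Bochner_Integration.integral_cong refl prod.permute[OF \<pi>, unfolded comp_def, symmetric])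
  finally show ?thesis .
qed

lemma share_moment_swap:
  assumes "\<And>j. continuous_on UNIV (h j)" "a \<in> {1..n}" "b \<in> {1..n}"
    and "\<And>j. j \<in> {1..n} \<Longrightarrow> h' j = h (Transposition.transpose a b j)"
  shows "share_moment n h' = share_moment n h"
proof -
  have "share_moment n h' = share_moment n (\<lambda>j. h (Transposition.transpose a b j))"
    unfolding share_moment_def using assms(4) by (intro Bochner_Integration.integral_cong prod.cong refl) auto
  also have "\<dots> = share_moment n h"
    using assms(1-3) by (intro share_moment_permute permutes_swap_id) auto
  finally show ?thesis .
qed

text \<open>
  Adding one more column costs a factor \<open>4/n\<close>.  By exchangeability all columns not yet used give the
  same moment, there are at least \<open>n/2\<close> of them, and the sum of \<open>Y\<^sup>2 + 1/n\<close> over all columns is two.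
\<close>

lemma share_moment_decouple:
  assumes H: "continuous_on UNIV H" "\<And>u. 0 \<le> H u"
    and c: "c \<in> {1..n}" "c \<notin> B" and B: "B \<subseteq> {1..n}" "2 * card B \<le> n"
  shows "share_moment n (\<lambda>j. if j = c then H else if j \<in> B then (\<lambda>u. u + 1 / real n) else (\<lambda>_. 1))
     \<le> (4 / real n) ^ card B * share_moment n (\<lambda>j. if j = c then H else (\<lambda>_. 1))"
proof -
  define h where "h B = (\<lambda>j. if j = c then H else if j \<in> B then (\<lambda>u. u + 1 / real n) else (\<lambda>_. 1))"
    for B :: "nat set"
  have cont: "continuous_on UNIV (h B j)" for B j
    using H by (auto simp: h_def intro!: continuous_intros)
  have n: "n \<ge> 1" using c by auto
  have "finite B" using B finite_subset by blast
  then have "share_moment n (h B) \<le> (4 / real n) ^ card B * share_moment n (h {})"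
    using c(2) B
  proof (induction B rule: finite_induct)
    case (insert j0 B)
    let ?R = "{1..n} - insert c B"
    have same: "share_moment n (h (insert j B)) = share_moment n (h (insert j0 B))" if j: "j \<in> ?R" for j
      by (rule share_moment_swap[of _ j0 _ j])
         (use j insert.prems insert.hyps cont in \<open>auto simp: h_def Transposition.transpose_def\<close>)
    have step: "h (insert j B) = (h B)(j := (\<lambda>u. u + 1 / real n))" if "j \<in> ?R" for j
      using that by (auto simp: h_def)
    have prod_step: "(\<Prod>i=1..n. h (insert j B) i (share n x i))
        = (\<Prod>i=1..n. h B i (share n x i)) * (share n x j + 1 / real n)" if j: "j \<in> ?R" for j x
    proof -
      have "(\<Prod>i\<in>{1..n}-{j}. h (insert j B) i (share n x i)) = (\<Prod>i\<in>{1..n}-{j}. h B i (share n x i))"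
        using step[OF j] by (intro prod.cong) auto
      then show ?thesis
        using j by (subst (1 2) prod.remove[of _ j]) (auto simp: h_def)
    qed
    have nonneg: "0 \<le> (\<Prod>i=1..n. h B i (share n x i))" for x
      using H share_bounds by (intro prod_nonneg) (auto simp: h_def)
    have "(\<Sum>j\<in>?R. share_moment n (h (insert j B)))
        = (\<integral>x. (\<Sum>j\<in>?R. (\<Prod>i=1..n. h (insert j B) i (share n x i))) \<partial>row_law n)"
      unfolding share_moment_def
      by (rule Bochner_Integration.integral_sum[symmetric]) (intro integrable_share_prod cont)
    also have "\<dots> \<le> (\<integral>x. 2 * (\<Prod>i=1..n. h B i (share n x i)) \<partial>row_law n)"
    proof (intro integral_mono_AE Bochner_Integration.integrable_sum integrable_share_prod cont
        integrable_mult_right)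
      show "AE x in row_law n. (\<Sum>j\<in>?R. (\<Prod>i=1..n. h (insert j B) i (share n x i)))
           \<le> 2 * (\<Prod>i=1..n. h B i (share n x i))"
        using sum_share_AE[OF n]
      proof eventually_elim
        fix x assume S: "(\<Sum>j=1..n. share n x j) = 1"
        have "(\<Sum>j\<in>?R. share n x j + 1 / real n) \<le> (\<Sum>j=1..n. share n x j + 1 / real n)"
          using share_bounds by (intro sum_mono2) auto
        also have "\<dots> = 2"
          using S n by (simp add: sum.distrib)
        finally show "(\<Sum>j\<in>?R. (\<Prod>i=1..n. h (insert j B) i (share n x i)))
           \<le> 2 * (\<Prod>i=1..n. h B i (share n x i))"
          using mult_left_mono[OF _ nonneg, of _ 2 x]
          by (simp only: prod_step sum_distrib_left[symmetric] mult.commute[of 2] cong: sum.cong)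
      qed
    qed
    also have "\<dots> = 2 * share_moment n (h B)"
      by (simp add: share_moment_def)
    finally have *: "real (card ?R) * share_moment n (h (insert j0 B)) \<le> 2 * share_moment n (h B)"
      by (simp add: same)
    have "card ?R = n - Suc (card B)"
      using insert.hyps insert.prems c by (subst card_Diff_subset) auto
    then have "real n / 2 \<le> real (card ?R)"
      using insert.prems insert.hyps by auto
    moreover have "0 \<le> share_moment n (h (insert j0 B))"
      unfolding share_moment_def using H share_bounds
      by (intro Bochner_Integration.integral_nonneg prod_nonneg) (auto simp: h_def)
    ultimately have "real n / 2 * share_moment n (h (insert j0 B)) \<le> 2 * share_moment n (h B)"
      using * mult_right_mono by fastforce
    then have "share_moment n (h (insert j0 B)) \<le> 4 / real n * share_moment n (h B)"
      using n by (simp add: field_simps)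
    also have "\<dots> \<le> 4 / real n * ((4 / real n) ^ card B * share_moment n (h {}))"
      using insert.IH insert.prems insert.hyps by (intro mult_left_mono) auto
    finally show ?case
      using insert.hyps by simp
  qed (auto)
  moreover have "h {} = (\<lambda>j. if j = c then H else (\<lambda>_. 1))"
    by (auto simp: h_def)
  ultimately show ?thesis
    by (simp add: h_def)
qed

lemma row_moment_single:
  assumes "c \<in> {1..n}" "\<And>j. j \<in> {1..n} \<Longrightarrow> j \<noteq> c \<Longrightarrow> \<beta> j = 0"
  shows "row_moment n \<beta> = centered_moment n (\<beta> c)"
  unfolding centered_moment_def row_moment_def
  by (rule share_moment_swap[of _ c _ 1])
     (use assms in \<open>auto simp: Transposition.transpose_def intro!: continuous_intros\<close>)

lemma row_moment_zero:
  assumes "\<And>j. j \<in> {1..n} \<Longrightarrow> \<beta> j = 0"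
  shows "row_moment n \<beta> = 1"
proof -
  interpret R: prob_space "row_law n" by (rule prob_space_row)
  show ?thesis using assms by (simp add: row_moment_def share_moment_def R.prob_space)
qed

lemma centered_moment_2_nonneg: "0 \<le> centered_moment n 2"
  unfolding centered_moment_def row_moment_def share_moment_def
  by (intro Bochner_Integration.integral_nonneg prod_nonneg) auto

text \<open>
  The factor with exponent at least two is dominated by \<open>Z\<^sup>2\<close>, and the others by \<open>\<bar>Z\<bar> \<le> Y\<^sup>2 + 1/n\<close>; the
  latter are then removed one after the other.
\<close>

lemma row_moment_bound_power:
  assumes c: "c \<in> {1..n}" "\<beta> c \<ge> 2" and S: "S \<subseteq> {1..n}" "c \<in> S" "2 * card S \<le> n"
    and \<beta>: "\<And>j. j \<in> S \<Longrightarrow> \<beta> j \<ge> 1" "\<And>j. j \<notin> S \<Longrightarrow> \<beta> j = 0"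
  shows "\<bar>row_moment n \<beta>\<bar> \<le> (4 / real n) ^ (card S - 1) * centered_moment n 2"
proof -
  let ?B = "S - {c}"
  let ?h = "\<lambda>j. if j = c then (\<lambda>u. (u - 1 / real n)\<^sup>2) else if j \<in> ?B then (\<lambda>u. u + 1 / real n) else (\<lambda>_. 1)"
  have n: "n \<ge> 1" using c by auto
  have fS: "finite S" using S finite_subset by blast
  have "\<bar>row_moment n \<beta>\<bar> \<le> (\<integral>x. \<bar>\<Prod>j=1..n. (share n x j - 1 / real n) ^ \<beta> j\<bar> \<partial>row_law n)"
    unfolding row_moment_def share_moment_def by (rule integral_abs_bound)
  also have "\<dots> \<le> share_moment n ?h"
    unfolding share_moment_def
  proof (rule integral_mono)
    show "integrable (row_law n) (\<lambda>x. \<bar>\<Prod>j=1..n. (share n x j - 1 / real n) ^ \<beta> j\<bar>)"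
      by (intro integrable_abs integrable_share_prod[of "\<lambda>j u. (u - 1 / real n) ^ \<beta> j"] continuous_intros)
    show "integrable (row_law n) (\<lambda>x. \<Prod>j=1..n. ?h j (share n x j))"
      by (intro integrable_share_prod) (auto intro!: continuous_intros)
    fix x assume "x \<in> space (row_law n)"
    show "\<bar>\<Prod>j=1..n. (share n x j - 1 / real n) ^ \<beta> j\<bar> \<le> (\<Prod>j=1..n. ?h j (share n x j))"
      unfolding abs_prod
    proof (intro prod_mono conjI abs_ge_zero)
      fix j assume j: "j \<in> {1..n}"
      let ?z = "share n x j - 1 / real n"
      have u: "0 \<le> share n x j" "share n x j \<le> 1" using share_bounds[OF j] by auto
      have "0 \<le> 1 / real n" "1 / real n \<le> 1" using n by auto
      then have z: "\<bar>?z\<bar> \<le> 1" "\<bar>?z\<bar> \<le> share n x j + 1 / real n"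
        using u unfolding abs_le_iff by linarith+
      show "\<bar>?z ^ \<beta> j\<bar> \<le> ?h j (share n x j)"
      proof (cases "j = c")
        case True
        have "\<bar>?z\<bar> ^ \<beta> c \<le> \<bar>?z\<bar> ^ 2"
          using z c by (intro power_decreasing) auto
        then show ?thesis using True by (simp add: power_abs)
      next
        case False
        show ?thesis
        proof (cases "j \<in> S")
          case True
          have "\<bar>?z\<bar> ^ \<beta> j \<le> \<bar>?z\<bar> ^ 1"
            using z \<beta>(1)[OF True] by (intro power_decreasing) auto
          then show ?thesis using True False z by (simp add: power_abs)
        qed (use False \<beta> in auto)
      qed
    qed
  qed
  also have "\<dots> \<le> (4 / real n) ^ card ?B * share_moment n (\<lambda>j. if j = c then (\<lambda>u. (u - 1 / real n)\<^sup>2) else (\<lambda>_. 1))"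
    by (rule share_moment_decouple) (use c S fS in \<open>auto intro!: continuous_intros simp: card_Diff_singleton\<close>)
  also have "share_moment n (\<lambda>j. if j = c then (\<lambda>u. (u - 1 / real n)\<^sup>2) else (\<lambda>_. 1)) = row_moment n (\<lambda>j. if j = c then 2 else 0)"
    unfolding row_moment_def by (rule arg_cong[where f="share_moment n"]) auto
  also have "\<dots> = centered_moment n 2"
    using row_moment_single[OF c(1), of "\<lambda>j. if j = c then 2 else 0"] by simp
  finally show ?thesis
    using S fS by (simp add: card_Diff_singleton)
qed

lemma row_moment_sum_zero:
  assumes "n \<ge> 1"
  shows "(\<Sum>j=1..n. row_moment n (\<beta>(j := Suc (\<beta> j)))) = 0"
proof -
  note measurable_share [measurable]
  let ?z = "\<lambda>x j. share n x j - 1 / real n"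
  have "(\<Sum>j=1..n. row_moment n (\<beta>(j := Suc (\<beta> j))))
      = (\<integral>x. (\<Sum>j=1..n. \<Prod>i=1..n. ?z x i ^ (\<beta>(j := Suc (\<beta> j))) i) \<partial>row_law n)"
    unfolding row_moment_def share_moment_def
    by (rule Bochner_Integration.integral_sum[symmetric])
       (intro integrable_share_prod[of "\<lambda>i u. (u - 1 / real n) ^ (_ i)"] continuous_intros)
  also have "\<dots> = (\<integral>x. 0 \<partial>row_law n)"
  proof (rule integral_cong_AE)
    show "AE x in row_law n. (\<Sum>j=1..n. \<Prod>i=1..n. ?z x i ^ (\<beta>(j := Suc (\<beta> j))) i) = 0"
      using sum_share_AE[OF assms]
    proof eventually_elim
      fix x assume S: "(\<Sum>j=1..n. share n x j) = 1"
      have "(\<Prod>i=1..n. ?z x i ^ (\<beta>(j := Suc (\<beta> j))) i) = ?z x j * (\<Prod>i=1..n. ?z x i ^ \<beta> i)"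
        if j: "j \<in> {1..n}" for j
      proof -
        have "(\<Prod>i\<in>{1..n}-{j}. ?z x i ^ (\<beta>(j := Suc (\<beta> j))) i) = (\<Prod>i\<in>{1..n}-{j}. ?z x i ^ \<beta> i)"
          by (intro prod.cong) auto
        then show ?thesis
          using j by (subst (1 2) prod.remove[of _ j]) auto
      qed
      then have "(\<Sum>j=1..n. \<Prod>i=1..n. ?z x i ^ (\<beta>(j := Suc (\<beta> j))) i)
          = (\<Sum>j=1..n. ?z x j) * (\<Prod>i=1..n. ?z x i ^ \<beta> i)"
        by (simp add: sum_distrib_right)
      also have "(\<Sum>j=1..n. ?z x j) = 0"
        using S assms by (simp add: sum_subtractf)
      finally show "(\<Sum>j=1..n. \<Prod>i=1..n. ?z x i ^ (\<beta>(j := Suc (\<beta> j))) i) = 0" by simp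
    qed
  qed measurable
  finally show ?thesis by simp
qed

text \<open>
  When all exponents are one, the factor \<open>Z\<close> of one column is traded against the others, because the
  \<open>Z\<close> of a row add up to zero: of the possible positions of this factor, those outside the other
  columns (at least \<open>n/2\<close> of them) all give the moment in question, while those inside
  produce an exponent two and one column less.
\<close>

lemma row_moment_bound:
  assumes S: "S \<subseteq> {1..n}" "S \<noteq> {}" "2 * card S \<le> n"
    and \<beta>: "\<And>j. j \<in> S \<Longrightarrow> \<beta> j \<ge> 1" "\<And>j. j \<notin> S \<Longrightarrow> \<beta> j = 0"
  shows "\<bar>row_moment n \<beta>\<bar> \<le> card S * (4 / real n) ^ (card S - 1) * centered_moment n 2"
proof (cases "\<exists>c\<in>S. \<beta> c \<ge> 2")
  case True
  then obtain c where c: "c \<in> S" "\<beta> c \<ge> 2" by auto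
  have fS: "finite S" using S finite_subset by blast
  have "\<bar>row_moment n \<beta>\<bar> \<le> 1 * ((4 / real n) ^ (card S - 1) * centered_moment n 2)"
    using row_moment_bound_power[of c n \<beta> S] c S \<beta> by auto
  also have "\<dots> \<le> card S * ((4 / real n) ^ (card S - 1) * centered_moment n 2)"
    using S fS centered_moment_2_nonneg by (intro mult_right_mono) (auto simp: Suc_le_eq card_gt_0_iff)
  finally show ?thesis by (simp add: mult.assoc)
next
  case False
  then have one: "\<beta> j = 1" if "j \<in> S" for j
    using \<beta>(1)[OF that] that by force
  have fS: "finite S" using S finite_subset by blast
  obtain c where c: "c \<in> S" using S by auto
  have n: "n \<ge> 1" using c S by auto
  let ?T = "S - {c}"
  let ?b = "\<beta>(c := 0)"
  let ?v = "(4 / real n) ^ (card S - 2) * centered_moment n 2"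
  \<comment> \<open>the factor of column \<open>c\<close> may be moved to any position outside the other columns, including back to \<open>c\<close>\<close>
  have same: "row_moment n (?b(j := Suc (?b j))) = row_moment n \<beta>" if "j \<in> {1..n} - ?T" for j
  proof -
    have "j \<in> {1..n}" "c \<in> {1..n}" "\<beta> c = 1" "j \<noteq> c \<Longrightarrow> \<beta> j = 0"
      using that c S one[OF c] \<beta>(2)[of j] by auto
    then show ?thesis
      unfolding row_moment_def
      by (intro share_moment_swap[of _ c _ j]) (auto simp: Transposition.transpose_def intro!: continuous_intros)
  qed
  have bd: "\<bar>row_moment n (?b(j := Suc (?b j)))\<bar> \<le> ?v" if j: "j \<in> ?T" for j
  proof -
    have "card ?T = card S - 1" using c fS by simp
    moreover have "\<bar>row_moment n (?b(j := Suc (?b j)))\<bar> \<le> (4 / real n) ^ (card ?T - 1) * centered_moment n 2"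
    proof (rule row_moment_bound_power[of j])
      show "j \<in> {1..n}" "?T \<subseteq> {1..n}" "j \<in> ?T" using j S by auto
      show "2 \<le> (?b(j := Suc (?b j))) j" using j one[of j] by simp
      show "2 * card ?T \<le> n" using S fS c by (simp add: card_Diff_singleton)
      show "1 \<le> (?b(j := Suc (?b j))) i" if "i \<in> ?T" for i
        using that \<beta>(1)[of i] by auto
      show "(?b(j := Suc (?b j))) i = 0" if "i \<notin> ?T" for i
        using that \<beta>(2)[of i] j by auto
    qed
    ultimately show ?thesis by (simp add: numeral_2_eq_2)
  qed
  have "0 = (\<Sum>j=1..n. row_moment n (?b(j := Suc (?b j))))"
    by (rule row_moment_sum_zero[OF n, symmetric])
  also have "\<dots> = (\<Sum>j\<in>{1..n} - ?T. row_moment n (?b(j := Suc (?b j)))) + (\<Sum>j\<in>?T. row_moment n (?b(j := Suc (?b j))))"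
    using S by (intro sum.subset_diff) auto
  also have "(\<Sum>j\<in>{1..n} - ?T. row_moment n (?b(j := Suc (?b j)))) = card ({1..n} - ?T) * row_moment n \<beta>"
    by (subst sum.cong[OF refl same]) auto
  finally have eq: "card ({1..n} - ?T) * row_moment n \<beta> = - (\<Sum>j\<in>?T. row_moment n (?b(j := Suc (?b j))))"
    by linarith
  have "card ?T = card S - 1" using c fS by simp
  then have "card ({1..n} - ?T) = n - (card S - 1)"
    using S fS by (subst card_Diff_subset) auto
  then have "real n / 2 \<le> card ({1..n} - ?T)"
    using S by auto
  then have "real n / 2 * \<bar>row_moment n \<beta>\<bar> \<le> card ({1..n} - ?T) * \<bar>row_moment n \<beta>\<bar>"
    by (intro mult_right_mono) auto
  also have "\<dots> = \<bar>\<Sum>j\<in>?T. row_moment n (?b(j := Suc (?b j)))\<bar>"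
    using eq by (metis abs_minus abs_mult abs_of_nat)
  also have "\<dots> \<le> (\<Sum>j\<in>?T. ?v)"
    using bd by (intro order_trans[OF sum_abs] sum_mono) auto
  also have "\<dots> = (card S - 1) * ?v"
    using \<open>card ?T = card S - 1\<close> by simp
  finally have *: "real n / 2 * \<bar>row_moment n \<beta>\<bar> \<le> (card S - 1) * ?v" .
  show ?thesis
  proof (cases "card S = 1")
    case True
    with * n have "\<bar>row_moment n \<beta>\<bar> = 0"
      by (auto simp: mult_le_0_iff)
    then show ?thesis using centered_moment_2_nonneg by simp
  next
    case False
    then have "card S \<ge> 2" using S fS by (metis card_0_eq less_2_cases not_less One_nat_def)
    then obtain k where k: "card S = Suc (Suc k)" by (metis Suc_le_D numeral_2_eq_2 Suc_le_mono)
    from * n have "\<bar>row_moment n \<beta>\<bar> \<le> 2 / real n * ((card S - 1) * ?v)"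
      by (simp add: field_simps)
    also have "\<dots> \<le> 4 / real n * (card S * ?v)"
      using centered_moment_2_nonneg by (intro mult_mono mult_nonneg_nonneg) (auto simp: divide_right_mono)
    finally show ?thesis by (simp add: k mult_ac)
  qed
qed

lemma centered_moment_0: "centered_moment n 0 = 1"
  unfolding centered_moment_def by (rule row_moment_zero) auto

lemma centered_moment_1:
  assumes "n \<ge> 1"
  shows "centered_moment n 1 = 0"
proof -
  have "row_moment n ((\<lambda>_. 0)(j := Suc 0)) = centered_moment n 1" if "j \<in> {1..n}" for j
    using row_moment_single[OF that, of "(\<lambda>_. 0)(j := Suc 0)"] by simp
  then have "real n * centered_moment n 1 = 0"
    using row_moment_sum_zero[OF assms, of "\<lambda>_. 0"] by simp
  then show ?thesis using assms by simp
qed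

end

section \<open>Regularly varying tails and their Laplace-type means\<close>

lemma ex_pow2_bracket:
  fixes v :: real
  assumes "v \<ge> 1"
  shows "\<exists>k. 2 ^ k \<le> v \<and> v \<le> 2 * 2 ^ k"
proof -
  define k where "k = nat \<lfloor>log 2 v\<rfloor>"
  have "0 \<le> log 2 v" using assms by simp
  then have k: "real k \<le> log 2 v" "log 2 v \<le> real k + 1"
    by (simp_all add: k_def)
  have "2 ^ k = 2 powr real k" "2 * 2 ^ k = (2::real) powr (real k + 1)"
    by (simp_all add: powr_realpow powr_add)
  then show ?thesis
    using k assms by (intro exI[of _ k]) (auto simp: le_log_iff log_le_iff)
qed

text \<open>
  A Potter bound for a monotone function.  The limit along doubling bounds \<open>F (2 * x) / F x\<close> between
  \<open>2 powr (- a - \<epsilon>)\<close> and \<open>2 powr (- a + \<epsilon>)\<close> for large \<open>x\<close>; iteration yields the estimate for dyadic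
  \<open>u\<close>, and monotonicity fills the gaps.  When \<open>x * u\<close> is too small for the iteration, the bound one
  for \<open>F (x * u)\<close> and the lower bound for \<open>F x\<close> obtained by starting from \<open>x0\<close> suffice, so that the
  estimate holds for all positive \<open>u\<close>.
\<close>

lemma potter_bound:
  fixes F :: "real \<Rightarrow> real"
  assumes mono: "antimono F" and nonneg: "\<And>x. 0 \<le> F x" and le1: "\<And>x. F x \<le> 1"
    and pos: "eventually (\<lambda>x. 0 < F x) at_top"
    and lim: "((\<lambda>x. F (2 * x) / F x) \<longlongrightarrow> 2 powr (- a)) at_top"
    and \<epsilon>: "0 < \<epsilon>" "\<epsilon> < a"
  obtains C x0 where "C > 0" "x0 \<ge> 1" "\<And>x. x \<ge> x0 \<Longrightarrow> 0 < F x"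
    "\<And>x u. x \<ge> x0 \<Longrightarrow> u > 0 \<Longrightarrow> F (x * u) \<le> C * F x * (u powr (- a - \<epsilon>) + u powr (- a + \<epsilon>))"
proof -
  have "eventually (\<lambda>x. F (2 * x) / F x > 2 powr (- a - \<epsilon>)) at_top"
    "eventually (\<lambda>x. F (2 * x) / F x < 2 powr (- a + \<epsilon>)) at_top"
    by (intro order_tendstoD[OF lim], use \<epsilon> in simp)+
  with pos eventually_ge_at_top[of 1] have "eventually (\<lambda>x. 1 \<le> x \<and> 0 < F x \<and>
      F (2 * x) / F x > 2 powr (- a - \<epsilon>) \<and> F (2 * x) / F x < 2 powr (- a + \<epsilon>)) at_top"
    by eventually_elim auto
  then obtain x0 where x0: "\<And>x. x \<ge> x0 \<Longrightarrow> 1 \<le> x \<and> 0 < F x \<and>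
      F (2 * x) / F x > 2 powr (- a - \<epsilon>) \<and> F (2 * x) / F x < 2 powr (- a + \<epsilon>)"
    unfolding eventually_at_top_linorder by metis
  have x0_1: "x0 \<ge> 1" using x0[of x0] by simp
  have up: "F (2 ^ k * x) \<le> (2 powr (- a + \<epsilon>)) ^ k * F x" if "x \<ge> x0" for x k
  proof (induction k)
    case (Suc k)
    have "x * 1 \<le> x * 2 ^ k" using that x0_1 by (intro mult_left_mono) auto
    then have "x0 \<le> 2 ^ k * x" using that by (simp add: mult.commute)
    from x0[OF this] have "F (2 * (2 ^ k * x)) \<le> 2 powr (- a + \<epsilon>) * F (2 ^ k * x)"
      using less_imp_le pos_divide_less_eq by blast
    also have "\<dots> \<le> 2 powr (- a + \<epsilon>) * ((2 powr (- a + \<epsilon>)) ^ k * F x)"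
      using Suc by (intro mult_left_mono) auto
    finally show ?case by (simp add: mult_ac)
  qed simp
  have dn: "F x \<le> (2 powr (a + \<epsilon>)) ^ k * F (2 ^ k * x)" if "x \<ge> x0" for x k
  proof (induction k)
    case (Suc k)
    have "x * 1 \<le> x * 2 ^ k" using that x0_1 by (intro mult_left_mono) auto
    then have "x0 \<le> 2 ^ k * x" using that by (simp add: mult.commute)
    from x0[OF this] have "2 powr (- a - \<epsilon>) * F (2 ^ k * x) \<le> F (2 * (2 ^ k * x))"
      using less_imp_le pos_less_divide_eq by blast
    then have "2 powr (a + \<epsilon>) * (2 powr (- a - \<epsilon>) * F (2 ^ k * x)) \<le> 2 powr (a + \<epsilon>) * F (2 * (2 ^ k * x))"
      by (intro mult_left_mono) auto
    also have "2 powr (a + \<epsilon>) * (2 powr (- a - \<epsilon>) * F (2 ^ k * x)) = F (2 ^ k * x)"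
      by (simp add: mult.assoc[symmetric] powr_add[symmetric])
    finally have "(2 powr (a + \<epsilon>)) ^ k * F (2 ^ k * x)
        \<le> (2 powr (a + \<epsilon>)) ^ k * (2 powr (a + \<epsilon>) * F (2 * (2 ^ k * x)))"
      by (intro mult_left_mono) auto
    with Suc have "F x \<le> (2 powr (a + \<epsilon>)) ^ k * (2 powr (a + \<epsilon>) * F (2 * (2 ^ k * x)))"
      by linarith
    then show ?case by (simp add: mult_ac)
  qed simp
  have pw: "(2 powr s) ^ k = (2 ^ k) powr s" for s :: real and k
    by (simp add: powr_realpow[symmetric] powr_powr powr_power mult.commute)
  have far: "F y \<le> (2 * v) powr (a + \<epsilon>) * F x" if y: "x0 \<le> y" and xy: "x \<le> v * y" and v: "v \<ge> 1" for x y v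
  proof -
    obtain j where "2 ^ j \<le> v" "v \<le> 2 * 2 ^ j"
      using ex_pow2_bracket[of v] \<open>v \<ge> 1\<close> by auto
    then have k: "2 ^ Suc j \<le> 2 * v" "v \<le> 2 ^ Suc j" by auto
    have "F y \<le> (2 ^ Suc j) powr (a + \<epsilon>) * F (2 ^ Suc j * y)"
      using dn[OF y, of "Suc j"] by (simp only: pw)
    also have "\<dots> \<le> (2 * v) powr (a + \<epsilon>) * F x"
    proof (intro mult_mono powr_mono2)
      have "v * y \<le> 2 ^ Suc j * y" using k y x0_1 by (intro mult_right_mono) auto
      then show "F (2 ^ Suc j * y) \<le> F x" using xy by (intro antimonoD[OF mono]) auto
    qed (use k \<epsilon> nonneg in auto)
    finally show ?thesis .
  qed
  let ?A = "2 powr (a - \<epsilon>)" and ?B = "2 powr (a + \<epsilon>)"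
  \<comment> \<open>one summand for each of the three ranges of \<open>u\<close> below\<close>
  define C where "C = ?A + ?B + ?B / F x0"
  have Fx0: "F x0 > 0" using x0[of x0] by simp
  have C: "?A \<le> C" "?B \<le> C" "?B / F x0 \<le> C" "C > 0"
    using Fx0 by (auto simp: C_def intro!: add_pos_pos)
  show thesis
  proof (rule that[of C x0])
    fix x u assume x: "x \<ge> x0" and u: "(u::real) > 0"
    have Fx: "F x > 0" using x0[OF x] by simp
    let ?R = "u powr (- a - \<epsilon>) + u powr (- a + \<epsilon>)"
    have *: "F (x * u) \<le> C * F x * ?R"
      if "F (x * u) \<le> c * F x * w" "c \<le> C" "0 \<le> w" "w \<le> ?R" for c w
    proof -
      have "c * F x * w \<le> C * F x * ?R"
        using that Fx C by (intro mult_mono) auto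
      then show ?thesis using that by simp
    qed
    show "F (x * u) \<le> C * F x * ?R"
    proof (cases "u \<ge> 1")
      case True
      obtain k where k: "2 ^ k \<le> u" "u \<le> 2 * 2 ^ k" using ex_pow2_bracket[OF True] by auto
      have "F (x * u) \<le> F (2 ^ k * x)"
        using k x x0_1 by (intro antimonoD[OF mono]) (auto simp: mult.commute intro: mult_right_mono)
      also have "\<dots> \<le> (2 ^ k) powr (- a + \<epsilon>) * F x" using up[OF x, of k] by (simp add: pw)
      also have "\<dots> \<le> (u / 2) powr (- a + \<epsilon>) * F x"
        using k u \<epsilon> Fx by (intro mult_right_mono powr_mono2') auto
      also have "(u / 2) powr (- a + \<epsilon>) = ?A * u powr (- a + \<epsilon>)"
        using u by (simp add: powr_divide powr_diff powr_add powr_minus field_simps)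
      finally show ?thesis by (intro *[of ?A "u powr (- a + \<epsilon>)"]) (use C in \<open>auto simp: mult_ac\<close>)
    next
      case False
      have conv: "(2 * (1 / u)) powr (a + \<epsilon>) = ?B * u powr (- a - \<epsilon>)"
        using u by (simp add: powr_mult powr_divide powr_diff powr_add powr_minus field_simps)
      show ?thesis
      proof (cases "x0 \<le> x * u")
        case True
        have "F (x * u) \<le> (2 * (1 / u)) powr (a + \<epsilon>) * F x"
          by (rule far) (use True False u in auto)
        then show ?thesis unfolding conv
          by (intro *[of ?B "u powr (- a - \<epsilon>)"]) (use C in \<open>auto simp: mult_ac\<close>)
      next
        case f: False
        have "x \<le> 1 / u * x0" using f u by (simp add: field_simps)
        then have "F x0 \<le> (2 * (1 / u)) powr (a + \<epsilon>) * F x"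
          by (intro far) (use False u in auto)
        then have "1 \<le> ?B / F x0 * F x * u powr (- a - \<epsilon>)"
          unfolding conv using Fx0 by (simp add: field_simps)
        then have "F (x * u) \<le> ?B / F x0 * F x * u powr (- a - \<epsilon>)" using le1[of "x * u"] by linarith
        then show ?thesis
          by (intro *[of "?B / F x0" "u powr (- a - \<epsilon>)"]) (use C in auto)
      qed
    qed
  qed (use C x0_1 x0 in auto)
qed

lemma has_bochner_integral_Gamma:
  assumes "s > (0::real)"
  shows "has_bochner_integral lborel (\<lambda>u. indicator {0<..} u * (u powr (s - 1) * exp (- u))) (Gamma s)"
proof (rule has_bochner_integral_nn_integral)
  have "(\<integral>\<^sup>+u. ennreal (indicator {0<..} u * (u powr (s - 1) * exp (- u))) \<partial>lborel)
      = (\<integral>\<^sup>+u. ennreal (indicator {0..} u * u powr (s - 1) / exp u) \<partial>lborel)"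
    using AE_lborel_singleton[of 0]
    by (intro nn_integral_cong_AE) (auto simp: exp_minus field_simps indicator_def elim!: eventually_mono)
  also have "\<dots> = ennreal (Gamma s)"
    using Gamma_conv_nn_integral_real[OF assms] by simp
  finally show "(\<integral>\<^sup>+u. ennreal (indicator {0<..} u * (u powr (s - 1) * exp (- u))) \<partial>lborel) = ennreal (Gamma s)" .
qed (use assms in \<open>auto simp: Gamma_real_pos less_imp_le\<close>)

text \<open>
  Its mean at \<open>t X\<^sup>2\<close> is \<open>(-t)^m\<close> times the \<open>m\<close>-th derivative of the Laplace transform of \<open>X\<^sup>2\<close> at \<open>t\<close>.
\<close>

definition bump :: "nat \<Rightarrow> real \<Rightarrow> real" where
  "bump m u = u ^ m * exp (- u)"

definition bump' :: "nat \<Rightarrow> real \<Rightarrow> real" where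
  "bump' m u = (real m * u ^ (m - 1) - u ^ m) * exp (- u)"

lemma bump_nonneg: "u \<ge> 0 \<Longrightarrow> 0 \<le> bump m u"
  by (simp add: bump_def)

lemma measurable_bump [measurable]: "bump m \<in> borel_measurable borel" "bump' m \<in> borel_measurable borel"
  unfolding bump_def[abs_def] bump'_def[abs_def] by measurable

lemma DERIV_bump: "(bump m has_real_derivative bump' m u) (at u)"
  unfolding bump_def[abs_def] bump'_def
  by (rule derivative_eq_intros refl | simp add: algebra_simps)+

lemma continuous_bump': "continuous_on A (bump' m)"
  unfolding bump'_def[abs_def] by (intro continuous_intros)

lemma bump_eq_integral:
  assumes "y \<ge> 0" "m \<ge> 1"
  shows "bump m y = (\<integral>u. indicator {0<..<y} u * bump' m u \<partial>lborel)"
proof -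
  have "(\<integral>u. indicator {0..y} u *\<^sub>R bump' m u \<partial>lborel) = bump m y - bump m 0"
    using assms DERIV_bump continuous_bump'
    by (intro integral_FTC_Icc) (auto simp: has_real_derivative_iff_has_vector_derivative intro: has_vector_derivative_at_within)
  moreover have "(\<integral>u. indicator {0..y} u *\<^sub>R bump' m u \<partial>lborel) = (\<integral>u. indicator {0<..<y} u * bump' m u \<partial>lborel)"
    using AE_lborel_singleton[of 0] AE_lborel_singleton[of y]
    by (intro integral_cong_AE) (auto simp: indicator_def elim!: eventually_elim2)
  moreover have "bump m 0 = 0" using assms by (simp add: bump_def)
  ultimately show ?thesis by simp
qed

lemma bump'_powr:
  assumes "u > 0" "m \<ge> 1"
  shows "bump' m u * u powr r = real m * (u powr (real m + r - 1) * exp (- u)) - u powr (real m + r + 1 - 1) * exp (- u)"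
proof -
  have "u ^ (m - 1) = u powr (real m - 1)" "u ^ m = u powr real m"
    using assms by (simp_all add: powr_realpow[symmetric] of_nat_diff)
  moreover have "u powr (real m - 1) * u powr r = u powr (real m + r - 1)"
    "u powr real m * u powr r = u powr (real m + r + 1 - 1)"
    by (simp_all add: powr_add[symmetric] algebra_simps)
  ultimately show ?thesis
    by (simp add: bump'_def algebra_simps)
qed

text \<open>
  For \<open>r = - a\<close> this is the derivative of the bump integrated against the limiting tail, with value
  \<open>a \<Gamma>(m-a)\<close>.
\<close>

lemma has_bochner_integral_bump':
  assumes "m \<ge> 1" "real m + r > 0"
  shows "has_bochner_integral lborel (\<lambda>u. indicator {0<..} u * (bump' m u * u powr r)) (- r * Gamma (real m + r))"
proof -
  have "has_bochner_integral lborel (\<lambda>u. real m * (indicator {0<..} u * (u powr (real m + r - 1) * exp (- u)))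
      - indicator {0<..} u * (u powr (real m + r + 1 - 1) * exp (- u))) (real m * Gamma (real m + r) - Gamma (real m + r + 1))"
    by (intro has_bochner_integral_diff has_bochner_integral_mult_right has_bochner_integral_Gamma) (use assms in auto)
  also have "real m * Gamma (real m + r) - Gamma (real m + r + 1) = - r * Gamma (real m + r)"
    using assms Gamma_plus1[of "real m + r"] by (auto simp: nonpos_Ints_def algebra_simps) 
  also have "(\<lambda>u. real m * (indicator {0<..} u * (u powr (real m + r - 1) * exp (- u)))
      - indicator {0<..} u * (u powr (real m + r + 1 - 1) * exp (- u))) = (\<lambda>u. indicator {0<..} u * (bump' m u * u powr r))"
    using assms by (auto simp: bump'_powr indicator_def fun_eq_iff)
  finally show ?thesis .
qed

lemma integrable_abs_bump':
  assumes "m \<ge> 1" "real m + r > 0"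
  shows "integrable lborel (\<lambda>u. indicator {0<..} u * (\<bar>bump' m u\<bar> * u powr r))"
proof -
  have "integrable lborel (\<lambda>u. \<bar>indicator {0<..} u * (bump' m u * u powr r)\<bar>)"
    using has_bochner_integral_bump'[OF assms] by (intro integrable_abs) (rule integrable.intros)
  moreover have "\<bar>indicator {0<..} u * (bump' m u * u powr r)\<bar> = indicator {0<..} u * (\<bar>bump' m u\<bar> * u powr r)" for u :: real
    by (auto simp: indicator_def abs_mult)
  ultimately show ?thesis by simp
qed

context entry_law
begin

definition tail :: "real \<Rightarrow> real" where
  "tail x = measure \<mu> {y. x < y\<^sup>2}"

definition bump_mean :: "nat \<Rightarrow> real \<Rightarrow> real" where
  "bump_mean m t = (\<integral>x. bump m (t * x\<^sup>2) \<partial>\<mu>)"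

lemma tail_bounds: "0 \<le> tail x" "tail x \<le> 1"
  by (simp_all add: tail_def)

lemma antimono_tail: "antimono tail"
  unfolding tail_def by (intro antimonoI finite_measure_mono) auto

lemma measurable_tail [measurable]: "tail \<in> borel_measurable borel"
proof -
  have "mono (\<lambda>x. - tail x)" using antimono_tail by (auto simp: mono_def antimono_def)
  then have "(\<lambda>x. - (- tail x)) \<in> borel_measurable borel"
    by (intro borel_measurable_uminus borel_measurable_mono)
  then show ?thesis by simp
qed

text \<open>
  A layer-cake formula: write the bump as the integral of its derivative and exchange the integrals.
\<close>

lemma bump_mean_eq_integral_tail:
  assumes "t > 0" "m \<ge> 1"
  shows "bump_mean m t = (\<integral>u. indicator {0<..} u * (bump' m u * tail (u / t)) \<partial>lborel)"
proof -
  interpret P: pair_sigma_finite \<mu> "lborel :: real measure" ..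
  let ?f = "\<lambda>(x::real) (u::real). indicator {0<..<t * x\<^sup>2} u * bump' m u"
  let ?g = "\<lambda>u. indicator {0<..} u * (\<bar>bump' m u\<bar> * u powr 0)"
  have g: "integrable lborel ?g" using assms by (intro integrable_abs_bump') auto
  have meas: "case_prod ?f \<in> borel_measurable (\<mu> \<Otimes>\<^sub>M lborel)"
  proof -
    have eq: "case_prod ?f = (\<lambda>p. (if 0 < snd p \<and> snd p < t * (fst p)\<^sup>2 then bump' m (snd p) else 0))"
      by (auto simp: fun_eq_iff indicator_def)
    show ?thesis unfolding eq by measurable
  qed
  have bd: "norm (?f x u) \<le> ?g u" for x u
    by (auto simp: indicator_def)
  have fint: "integrable lborel (?f x)" for x
    by (rule Bochner_Integration.integrable_bound[OF g]) (use bd in \<open>auto intro!: AE_I2\<close>)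
  have int: "integrable (\<mu> \<Otimes>\<^sub>M lborel) (case_prod ?f)"
  proof (rule P.Fubini_integrable[OF meas])
    show "integrable \<mu> (\<lambda>x. \<integral>u. norm (case_prod ?f (x, u)) \<partial>lborel)"
    proof (rule integrable_const_bound[where B="\<integral>u. ?g u \<partial>lborel"])
      show "AE x in \<mu>. norm (\<integral>u. norm (case_prod ?f (x, u)) \<partial>lborel) \<le> (\<integral>u. ?g u \<partial>lborel)"
      proof (rule AE_I2)
        fix x
        have "(\<integral>u. norm (?f x u) \<partial>lborel) \<le> (\<integral>u. ?g u \<partial>lborel)"
          by (intro integral_mono integrable_norm fint g bd)
        then show "norm (\<integral>u. norm (case_prod ?f (x, u)) \<partial>lborel) \<le> (\<integral>u. ?g u \<partial>lborel)" by simp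
      qed
      show "(\<lambda>x. \<integral>u. norm (case_prod ?f (x, u)) \<partial>lborel) \<in> borel_measurable \<mu>"
        using meas by measurable
    qed
    show "AE x in \<mu>. integrable lborel (\<lambda>u. case_prod ?f (x, u))"
      using fint by simp
  qed
  have "bump_mean m t = (\<integral>x. (\<integral>u. ?f x u \<partial>lborel) \<partial>\<mu>)"
    unfolding bump_mean_def using assms by (intro Bochner_Integration.integral_cong refl bump_eq_integral) auto
  also have "\<dots> = (\<integral>u. (\<integral>x. ?f x u \<partial>\<mu>) \<partial>lborel)"
    by (rule P.Fubini_integral[OF int, symmetric])
  also have "\<dots> = (\<integral>u. indicator {0<..} u * (bump' m u * tail (u / t)) \<partial>lborel)"
  proof (intro Bochner_Integration.integral_cong refl)
    fix u :: real
    have "?f x u = (indicator {0<..} u * bump' m u) * indicator {y. u / t < y\<^sup>2} x" for x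
      using assms by (auto simp: indicator_def field_simps)
    then have "(\<integral>x. ?f x u \<partial>\<mu>) = (\<integral>x. (indicator {0<..} u * bump' m u) * indicator {y. u / t < y\<^sup>2} x \<partial>\<mu>)"
      by (intro Bochner_Integration.integral_cong refl)
    also have "\<dots> = (indicator {0<..} u * bump' m u) * (\<integral>x. indicator {y. u / t < y\<^sup>2} x \<partial>\<mu>)"
      by (rule integral_mult_right_zero)
    also have "(\<integral>x. indicator {y. u / t < y\<^sup>2} x \<partial>\<mu>) = tail (u / t)"
      by (simp add: tail_def)
    finally show "(\<integral>x. ?f x u \<partial>\<mu>) = indicator {0<..} u * (bump' m u * tail (u / t))"
      by (simp add: mult_ac)
  qed
  finally show ?thesis .
qed

end

text \<open>
  The tail of the squared entry is regularly varying with index \<open>- a\<close>.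
\<close>

locale regular_entry_law = entry_law +
  fixes a :: real
  assumes a_pos: "0 < a"
    and tail_pos: "eventually (\<lambda>x. 0 < tail x) at_top"
    and tail_rv: "\<And>c. c > 0 \<Longrightarrow> ((\<lambda>x. tail (c * x) / tail x) \<longlongrightarrow> c powr (- a)) at_top"
begin

lemma tail_potter:
  assumes "0 < \<epsilon>" "\<epsilon> < a"
  obtains C x0 where "C > 0" "x0 \<ge> 1" "\<And>x. x \<ge> x0 \<Longrightarrow> 0 < tail x"
    "\<And>x u v. x \<ge> x0 \<Longrightarrow> u > 0 \<Longrightarrow> v > 0 \<Longrightarrow> tail (x * (u / v)) \<le>
      C * tail x * (v powr (a + \<epsilon>) * u powr (- a - \<epsilon>) + v powr (a - \<epsilon>) * u powr (- a + \<epsilon>))"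
proof -
  obtain C x0 where C: "C > 0" "x0 \<ge> 1" "\<And>x. x \<ge> x0 \<Longrightarrow> 0 < tail x"
    "\<And>x u. x \<ge> x0 \<Longrightarrow> u > 0 \<Longrightarrow> tail (x * u) \<le> C * tail x * (u powr (- a - \<epsilon>) + u powr (- a + \<epsilon>))"
    using potter_bound[OF antimono_tail tail_bounds tail_pos tail_rv assms] by (metis zero_less_numeral)
  show thesis
  proof (rule that[OF C(1-3)])
    fix x u v :: real assume x: "x \<ge> x0" and uv: "u > 0" "v > 0"
    have "(u / v) powr (- a - \<epsilon>) = v powr (a + \<epsilon>) * u powr (- a - \<epsilon>)"
      "(u / v) powr (- a + \<epsilon>) = v powr (a - \<epsilon>) * u powr (- a + \<epsilon>)"
      using uv by (simp_all add: powr_divide powr_diff powr_add powr_minus field_simps)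
    then show "tail (x * (u / v)) \<le>
      C * tail x * (v powr (a + \<epsilon>) * u powr (- a - \<epsilon>) + v powr (a - \<epsilon>) * u powr (- a + \<epsilon>))"
      using C(4)[OF x, of "u / v"] uv by simp
  qed
qed

text \<open>
  A bound uniform in \<open>v\<close>, used for dominated convergence near zero and near infinity; the two
  exponents come from the two sides of the Potter bound.
\<close>

lemma bump_mean_upper:
  assumes \<epsilon>: "0 < \<epsilon>" "\<epsilon> < a" and m: "m \<ge> 1" "a + \<epsilon> < real m"
  obtains D x0 where "D > 0" "x0 \<ge> 1" "\<And>x. x \<ge> x0 \<Longrightarrow> 0 < tail x"
    "\<And>x v. x \<ge> x0 \<Longrightarrow> v > 0 \<Longrightarrow> bump_mean m (v / x) \<le> D * tail x * (v powr (a + \<epsilon>) + v powr (a - \<epsilon>))"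
proof -
  obtain C x0 where C: "C > 0" "x0 \<ge> 1" "\<And>x. x \<ge> x0 \<Longrightarrow> 0 < tail x"
    "\<And>x u v. x \<ge> x0 \<Longrightarrow> u > 0 \<Longrightarrow> v > 0 \<Longrightarrow> tail (x * (u / v)) \<le>
      C * tail x * (v powr (a + \<epsilon>) * u powr (- a - \<epsilon>) + v powr (a - \<epsilon>) * u powr (- a + \<epsilon>))"
    using tail_potter[OF \<epsilon>] by metis
  let ?I = "\<lambda>r. \<lambda>u. indicator {0<..} u * (\<bar>bump' m u\<bar> * u powr r)"
  have I: "integrable lborel (?I (- a - \<epsilon>))" "integrable lborel (?I (- a + \<epsilon>))"
    using m \<epsilon> by (auto intro!: integrable_abs_bump')
  define D where "D = C * (integral\<^sup>L lborel (?I (- a - \<epsilon>)) + integral\<^sup>L lborel (?I (- a + \<epsilon>))) + 1"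
  have I0: "0 \<le> integral\<^sup>L lborel (?I r)" for r
    by (intro Bochner_Integration.integral_nonneg) auto
  have D: "D > 0" unfolding D_def using I0 C by (intro add_nonneg_pos mult_nonneg_nonneg add_nonneg_nonneg) auto
  show thesis
  proof (rule that[OF D C(2,3)])
    fix x v :: real assume x: "x \<ge> x0" and v: "v > 0"
    have xp: "x > 0" using x C by simp
    have Fx: "tail x > 0" using C x by blast
    let ?w = "\<lambda>u. C * tail x * (v powr (a + \<epsilon>) * ?I (- a - \<epsilon>) u + v powr (a - \<epsilon>) * ?I (- a + \<epsilon>) u)"
    have w: "integrable lborel ?w" using I by auto
    have "bump_mean m (v / x) = (\<integral>u. indicator {0<..} u * (bump' m u * tail (u / (v / x))) \<partial>lborel)"
      using v xp m by (intro bump_mean_eq_integral_tail) auto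
    also have "\<dots> \<le> (\<integral>u. ?w u \<partial>lborel)"
    proof (rule integral_mono_AE')
      show "AE u in lborel. indicator {0<..} u * (bump' m u * tail (u / (v / x))) \<le> ?w u"
      proof (rule AE_I2)
        fix u :: real
        show "indicator {0<..} u * (bump' m u * tail (u / (v / x))) \<le> ?w u"
        proof (cases "u > 0")
          case True
          have "bump' m u * tail (u / (v / x)) \<le> \<bar>bump' m u\<bar> * tail (x * (u / v))"
            using tail_bounds by (auto intro!: mult_right_mono simp: field_simps)
          also have "\<dots> \<le> \<bar>bump' m u\<bar> * (C * tail x * (v powr (a + \<epsilon>) * u powr (- a - \<epsilon>) + v powr (a - \<epsilon>) * u powr (- a + \<epsilon>)))"
            using C(4)[OF x True v] by (intro mult_left_mono) auto
          finally show ?thesis using True by (simp add: algebra_simps)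
        qed simp
      qed
      show "AE u in lborel. 0 \<le> ?w u"
        using C Fx by (intro AE_I2 mult_nonneg_nonneg add_nonneg_nonneg) auto
    qed (rule w)
    also have "\<dots> = C * tail x * (v powr (a + \<epsilon>) * integral\<^sup>L lborel (?I (- a - \<epsilon>)) + v powr (a - \<epsilon>) * integral\<^sup>L lborel (?I (- a + \<epsilon>)))"
      using I by simp
    also have "\<dots> \<le> C * tail x * ((v powr (a + \<epsilon>) + v powr (a - \<epsilon>)) * (integral\<^sup>L lborel (?I (- a - \<epsilon>)) + integral\<^sup>L lborel (?I (- a + \<epsilon>))))"
      using C Fx I0 by (intro mult_left_mono) (auto simp: algebra_simps)
    also have "\<dots> \<le> D * tail x * (v powr (a + \<epsilon>) + v powr (a - \<epsilon>))"
      using Fx unfolding D_def by (simp add: algebra_simps)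
    finally show "bump_mean m (v / x) \<le> D * tail x * (v powr (a + \<epsilon>) + v powr (a - \<epsilon>))" .
  qed
qed

text \<open>
  In the layer-cake formula the quotient of tails converges pointwise to \<open>(u / v) powr (- a)\<close>, dominated
  by the Potter bound; the condition \<open>a < m\<close> makes the integral converge at zero.
\<close>

lemma bump_mean_limit:
  assumes m: "m \<ge> 1" "a < real m" and v: "v > 0"
  shows "((\<lambda>x. bump_mean m (v / x) / tail x) \<longlongrightarrow> v powr a * (a * Gamma (real m - a))) at_top"
proof -
  define \<epsilon> where "\<epsilon> = min a (real m - a) / 2"
  have \<epsilon>: "0 < \<epsilon>" "\<epsilon> < a" "a + \<epsilon> < real m"
    using a_pos m by (auto simp: \<epsilon>_def min_def field_simps)
  obtain C x0 where C: "C > 0" "x0 \<ge> 1" "\<And>x. x \<ge> x0 \<Longrightarrow> 0 < tail x"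
    "\<And>x u v. x \<ge> x0 \<Longrightarrow> u > 0 \<Longrightarrow> v > 0 \<Longrightarrow> tail (x * (u / v)) \<le>
      C * tail x * (v powr (a + \<epsilon>) * u powr (- a - \<epsilon>) + v powr (a - \<epsilon>) * u powr (- a + \<epsilon>))"
    using tail_potter[OF \<epsilon>(1,2)] by metis
  let ?I = "\<lambda>r. \<lambda>u. indicator {0<..} u * (\<bar>bump' m u\<bar> * u powr r)"
  have I: "integrable lborel (?I (- a - \<epsilon>))" "integrable lborel (?I (- a + \<epsilon>))"
    using m \<epsilon> by (auto intro!: integrable_abs_bump')
  let ?s = "\<lambda>x u. indicator {0<..} u * (bump' m u * tail (u / (v / x))) / tail x"
  let ?f = "\<lambda>u. indicator {0<..} u * (bump' m u * u powr (- a)) * v powr a"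
  let ?w = "\<lambda>u. C * (v powr (a + \<epsilon>) * ?I (- a - \<epsilon>) u + v powr (a - \<epsilon>) * ?I (- a + \<epsilon>) u)"
  have "((\<lambda>x. \<integral>u. ?s x u \<partial>lborel) \<longlongrightarrow> (\<integral>u. ?f u \<partial>lborel)) at_top"
  proof (rule integral_dominated_convergence_at_top)
    show "integrable lborel ?w" using I by auto
    show "\<forall>\<^sub>F x in at_top. AE u in lborel. norm (?s x u) \<le> ?w u"
      using eventually_ge_at_top[of x0]
    proof eventually_elim
      fix x assume x: "x \<ge> x0"
      then have xp: "x > 0" and Fx: "tail x > 0" using C by auto
      show "AE u in lborel. norm (?s x u) \<le> ?w u"
      proof (rule AE_I2)
        fix u :: real
        show "norm (?s x u) \<le> ?w u"
        proof (cases "u > 0")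
          case True
          have "norm (?s x u) = \<bar>bump' m u\<bar> * (tail (x * (u / v)) / tail x)"
            using True Fx tail_bounds by (simp add: abs_mult mult_ac)
          also have "\<dots> \<le> \<bar>bump' m u\<bar> * (C * (v powr (a + \<epsilon>) * u powr (- a - \<epsilon>) + v powr (a - \<epsilon>) * u powr (- a + \<epsilon>)))"
            using C(4)[OF x True v] Fx by (intro mult_left_mono) (auto simp: field_simps)
          finally show ?thesis using True by (simp add: algebra_simps)
        qed simp
      qed
    qed
    show "AE u in lborel. ((\<lambda>x. ?s x u) \<longlongrightarrow> ?f u) at_top"
    proof (rule AE_I2)
      fix u :: real
      show "((\<lambda>x. ?s x u) \<longlongrightarrow> ?f u) at_top"
      proof (cases "u > 0")
        case True
        have "((\<lambda>x. bump' m u * (tail ((u / v) * x) / tail x)) \<longlongrightarrow> bump' m u * (u / v) powr (- a)) at_top"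
          using True v by (intro tendsto_mult_left tail_rv) auto
        moreover have "(u / v) powr (- a) = u powr (- a) * v powr a"
          using True v by (simp add: powr_divide powr_minus field_simps)
        ultimately show ?thesis using True by (simp add: mult_ac)
      qed simp
    qed
  qed measurable
  also have "(\<integral>u. ?f u \<partial>lborel) = v powr a * (a * Gamma (real m - a))"
    using has_bochner_integral_integral_eq[OF has_bochner_integral_bump'[of m "- a"]] m by simp
  finally show ?thesis
  proof (rule Lim_transform_eventually)
    show "\<forall>\<^sub>F x in at_top. (\<integral>u. ?s x u \<partial>lborel) = bump_mean m (v / x) / tail x"
      using eventually_gt_at_top[of 0]
      by eventually_elim (use v m in \<open>simp add: bump_mean_eq_integral_tail\<close>)
  qed
qed

text \<open>
  The tail decays at most polynomially, so exponentially small terms are negligible against it.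
\<close>

lemma tail_lower:
  assumes "0 < \<epsilon>" "\<epsilon> < a"
  obtains c x0 where "c > 0" "x0 \<ge> 1" "\<And>x. x \<ge> x0 \<Longrightarrow> c * x powr (- a - \<epsilon>) \<le> tail x"
proof -
  obtain C x0 where C: "C > 0" "x0 \<ge> 1" "\<And>x. x \<ge> x0 \<Longrightarrow> 0 < tail x"
    "\<And>x u v. x \<ge> x0 \<Longrightarrow> u > 0 \<Longrightarrow> v > 0 \<Longrightarrow> tail (x * (u / v)) \<le>
      C * tail x * (v powr (a + \<epsilon>) * u powr (- a - \<epsilon>) + v powr (a - \<epsilon>) * u powr (- a + \<epsilon>))"
    using tail_potter[OF assms] by metis
  define c where "c = tail x0 / (2 * C * x0 powr (- a - \<epsilon>))"
  show thesis
  proof (rule that[of c x0])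
    show "c > 0" using C by (auto simp: c_def)
    fix x assume x: "x \<ge> x0"
    then have xp: "x > 0" "tail x > 0" using C by auto
    have "tail x0 \<le> C * tail x * (x powr (a + \<epsilon>) * x0 powr (- a - \<epsilon>) + x powr (a - \<epsilon>) * x0 powr (- a + \<epsilon>))"
      using C(4)[OF x _ xp(1), of x0] C(2) xp by simp
    also have "x powr (a - \<epsilon>) * x0 powr (- a + \<epsilon>) \<le> x powr (a + \<epsilon>) * x0 powr (- a - \<epsilon>)"
    proof -
      have "(x0 / x) powr (- a + \<epsilon>) \<le> (x0 / x) powr (- a - \<epsilon>)"
        using C x xp assms by (intro powr_mono') auto
      then show ?thesis
        using xp C by (simp add: powr_divide powr_minus powr_diff powr_add field_simps)
    qed
    finally have "tail x0 \<le> C * tail x * (2 * (x powr (a + \<epsilon>) * x0 powr (- a - \<epsilon>)))"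
      using C xp by (simp add: mult_left_mono)
    then show "c * x powr (- a - \<epsilon>) \<le> tail x"
      using xp C by (simp add: c_def powr_minus powr_diff powr_add field_simps)
  qed (rule C)
qed

end

section \<open>A Laplace formula for the moments of a share\<close>

context entry_law
begin

definition laplace :: "real \<Rightarrow> real" where
  "laplace t = (\<integral>x. exp (- (t * x\<^sup>2)) \<partial>\<mu>)"

text \<open>
  The moment of order \<open>2 m\<close> of a self-normalised entry.
\<close>

definition even_moment :: "nat \<Rightarrow> nat \<Rightarrow> real" where
  "even_moment n m = share_moment n (\<lambda>j u. if j = 1 then u ^ m else 1)"

lemma measurable_bump_mean [measurable]: "bump_mean m \<in> borel_measurable borel"
  unfolding bump_mean_def[abs_def] by measurable

lemma measurable_laplace [measurable]: "laplace \<in> borel_measurable borel"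
  unfolding laplace_def[abs_def] by measurable

lemma integrable_exp: "t \<ge> 0 \<Longrightarrow> integrable \<mu> (\<lambda>x. exp (- (t * x\<^sup>2)))"
  by (rule integrable_const_bound[where B=1]) auto

lemma bump_le:
  assumes "y \<ge> 0"
  shows "bump m y \<le> fact m"
proof -
  have "(\<Sum>k\<in>{m}. y ^ k /\<^sub>R fact k) \<le> exp y"
    unfolding exp_def using assms by (intro sum_le_suminf summable_exp_generic) auto
  then show ?thesis
    by (simp add: bump_def exp_minus field_simps)
qed

lemma bump_mean_nonneg: "t \<ge> 0 \<Longrightarrow> 0 \<le> bump_mean m t"
  unfolding bump_mean_def by (intro Bochner_Integration.integral_nonneg bump_nonneg) auto

lemma laplace_nonneg: "0 \<le> laplace t"
  unfolding laplace_def by (intro Bochner_Integration.integral_nonneg) auto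

lemma laplace_antimono: "0 \<le> s \<Longrightarrow> s \<le> t \<Longrightarrow> laplace t \<le> laplace s"
  unfolding laplace_def by (intro integral_mono integrable_exp) (auto intro: mult_right_mono)

text \<open>
  Strict because the entry is almost surely nonzero; this makes powers of the Laplace transform
  away from zero exponentially small.
\<close>

lemma laplace_less_1:
  assumes "t > 0"
  shows "laplace t < 1"
proof -
  have "0 < (\<integral>x. 1 - exp (- (t * x\<^sup>2)) \<partial>\<mu>)"
  proof -
    have i: "integrable \<mu> (\<lambda>x. 1 - exp (- (t * x\<^sup>2)))"
      using assms by (intro Bochner_Integration.integrable_diff integrable_exp) auto
    have nn: "AE x in \<mu>. 0 \<le> 1 - exp (- (t * x\<^sup>2))"
      using assms by auto
    have "(\<integral>x. 1 - exp (- (t * x\<^sup>2)) \<partial>\<mu>) \<noteq> 0"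
    proof
      assume "(\<integral>x. 1 - exp (- (t * x\<^sup>2)) \<partial>\<mu>) = 0"
      then have "AE x in \<mu>. 1 - exp (- (t * x\<^sup>2)) = 0"
        using integral_nonneg_eq_0_iff_AE[OF i nn] by simp
      with entry_nonzero have "AE x in \<mu>. False"
        by eventually_elim (use assms in auto)
      then show False using AE_False by (simp add: emeasure_space_1)
    qed
    moreover have "0 \<le> (\<integral>x. 1 - exp (- (t * x\<^sup>2)) \<partial>\<mu>)"
      using nn by (rule integral_nonneg_AE)
    ultimately show ?thesis by simp
  qed
  also have "(\<integral>x. 1 - exp (- (t * x\<^sup>2)) \<partial>\<mu>) = 1 - laplace t"
    using assms integrable_exp[of t] prob_space by (simp add: laplace_def)
  finally show ?thesis by simp
qed

lemma even_moment_eq: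
  assumes "n \<ge> 1"
  shows "even_moment n m = (\<integral>x. share n x 1 ^ m \<partial>row_law n)"
proof -
  have "(\<Prod>j=1..n. if j = 1 then share n x j ^ m else 1) = share n x 1 ^ m" for x
    using assms by (subst prod.delta) auto
  then show ?thesis
    unfolding even_moment_def share_moment_def
    by (auto intro!: Bochner_Integration.integral_cong simp: if_distrib cong: if_cong)
qed

text \<open>
  The power of the sum of squares in the denominator is written as a Gamma integral, in the form that an Erlang density has
  mass one.  For fixed \<open>t\<close> the remaining integrand is a product over the columns, so its expectation
  factorises.
\<close>

lemma integral_laplace_power:
  assumes n: "n \<ge> 1" and m: "m \<ge> 1"
  shows "has_bochner_integral lborel
    (\<lambda>t. indicator {0<..} t * (bump_mean m t / t * laplace t ^ (n - 1))) (fact (m - 1) * even_moment n m)"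
proof (rule has_bochner_integral_nn_integral)
  let ?I = "\<lambda>t. indicator {0<..} t * (bump_mean m t / t * laplace t ^ (n - 1))"
  let ?P = "\<lambda>x. fact (m - 1) * share n x 1 ^ m"
  let ?Q = "\<lambda>j t. if j = (1::nat) then bump_mean m t else laplace t"
  interpret R: prob_space "row_law n" by (rule prob_space_row)
  interpret P: pair_sigma_finite "row_law n" "lborel :: real measure" ..
  interpret PS: product_sigma_finite "\<lambda>_::nat. \<mu>" ..
  show "(\<lambda>t. ?I t) \<in> borel_measurable lborel"
    by measurable
  show "AE t in lborel. 0 \<le> ?I t"
    using bump_mean_nonneg laplace_nonneg by (intro AE_I2) (auto simp: indicator_def)
  note em = even_moment_eq[OF n]
  show "0 \<le> fact (m - 1) * even_moment n m"
    unfolding em using share_bounds[of 1 n] n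
    by (intro mult_nonneg_nonneg Bochner_Integration.integral_nonneg) auto
  let ?G = "\<lambda>t j (y::real). if j = 1 then bump m (t * y\<^sup>2) else exp (- (t * y\<^sup>2))"
  let ?K = "\<lambda>(x::nat\<Rightarrow>real) (t::real). ennreal (indicator {0<..} t / t * (\<Prod>j=1..n. ?G t j (x j)))"
  have meas: "case_prod ?K \<in> borel_measurable (row_law n \<Otimes>\<^sub>M lborel)"
  proof -
    have "(\<lambda>p. (\<Prod>j=1..n. ?G (snd p) j (fst p j))) \<in> borel_measurable (row_law n \<Otimes>\<^sub>M lborel)"
    proof (rule borel_measurable_prod)
      fix j assume j: "j \<in> {1..n}"
      then have [measurable]: "(\<lambda>p. fst p j) \<in> borel_measurable (row_law n \<Otimes>\<^sub>M lborel)"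
        using measurable_compose[OF measurable_fst measurable_component_row[OF j]] by simp
      show "(\<lambda>p. ?G (snd p) j (fst p j)) \<in> borel_measurable (row_law n \<Otimes>\<^sub>M lborel)"
        by measurable
    qed
    then have "(\<lambda>p. indicator {0<..} (snd p) / snd p * (\<Prod>j=1..n. ?G (snd p) j (fst p j)))
        \<in> borel_measurable (row_law n \<Otimes>\<^sub>M (lborel :: real measure))"
      by measurable
    then have "(\<lambda>p. ennreal (indicator {0<..} (snd p) / snd p * (\<Prod>j=1..n. ?G (snd p) j (fst p j))))
        \<in> borel_measurable (row_law n \<Otimes>\<^sub>M (lborel :: real measure))"
      by measurable
    then show ?thesis by (simp add: case_prod_unfold)
  qed
  have Gnn: "0 \<le> ?G t j y" if "t \<ge> 0" for t j y
    using that by (auto intro: bump_nonneg)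
  have "ennreal (fact (m - 1) * even_moment n m) = ennreal (\<integral>x. ?P x \<partial>row_law n)"
    by (simp add: em)
  also have "\<dots> = (\<integral>\<^sup>+x. ennreal (?P x) \<partial>row_law n)"
  proof (rule nn_integral_eq_integral[symmetric])
    have "share n x 1 ^ m \<le> 1" "0 \<le> share n x 1 ^ m" for x
      using share_bounds[of 1 n x] n by (auto intro: power_le_one)
    then show "integrable (row_law n) (\<lambda>x. ?P x)"
      using n by (intro integrable_mult_right integrable_row_bounded[where B=1] borel_measurable_power measurable_share) auto
    show "AE x in row_law n. 0 \<le> ?P x"
      using share_bounds[of 1 n] n by auto
  qed
  also have "\<dots> = (\<integral>\<^sup>+x. (\<integral>\<^sup>+t. ?K x t \<partial>lborel) \<partial>row_law n)"
  proof (rule nn_integral_cong_AE)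
    have "AE x in row_law n. x 1 \<noteq> 0"
      unfolding row_law_def
      by (rule AE_PiM_component) (use n entry_nonzero prob_space_axioms in auto)
    then show "AE x in row_law n. ennreal (?P x) = (\<integral>\<^sup>+t. ?K x t \<partial>lborel)"
    proof eventually_elim
      fix x :: "nat \<Rightarrow> real" assume x: "x 1 \<noteq> 0"
      \<comment> \<open>the rate of the Erlang law is the sum of squares of the row\<close>
      define S where "S = (\<Sum>k=1..n. (x k)\<^sup>2)"
      have "(x 1)\<^sup>2 \<le> S" unfolding S_def by (rule member_le_sum) (use n in auto)
      then have S: "S > 0" using x by (metis less_le_trans zero_less_power2)
      interpret E: prob_space "density lborel (erlang_density (m - 1) S)"
        using S by (rule prob_space_erlang_density)
      have one: "(\<integral>\<^sup>+t. ennreal (erlang_density (m - 1) S t) \<partial>lborel) = 1"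
        using E.emeasure_space_1 by (simp add: emeasure_density)
      have "ennreal (?P x) = ennreal (?P x) * (\<integral>\<^sup>+t. ennreal (erlang_density (m - 1) S t) \<partial>lborel)"
        by (simp only: one mult_1_right)
      also have "\<dots> = (\<integral>\<^sup>+t. ennreal (?P x) * ennreal (erlang_density (m - 1) S t) \<partial>lborel)"
        by (rule nn_integral_cmult[symmetric]) measurable
      also have "\<dots> = (\<integral>\<^sup>+t. ?K x t \<partial>lborel)"
      proof (rule nn_integral_cong_AE)
        show "AE t in lborel. ennreal (?P x) * ennreal (erlang_density (m - 1) S t) = ?K x t"
          using AE_lborel_singleton[of 0]
        proof eventually_elim
          fix t :: real assume t0: "t \<noteq> 0"
          show "ennreal (?P x) * ennreal (erlang_density (m - 1) S t) = ?K x t"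
          proof (cases "t > 0")
            case t: True
            have "(\<Prod>j=1..n. ?G t j (x j)) = (\<Prod>j=1..n. (if j = 1 then (t * (x 1)\<^sup>2) ^ m else 1) * exp (- (t * (x j)\<^sup>2)))"
              by (intro prod.cong) (auto simp: bump_def)
            also have "\<dots> = (t * (x 1)\<^sup>2) ^ m * (\<Prod>j=1..n. exp (- (t * (x j)\<^sup>2)))"
              using n by (simp add: prod.distrib prod.delta)
            also have "(\<Prod>j=1..n. exp (- (t * (x j)\<^sup>2))) = exp (- (t * S))"
              by (simp add: exp_sum[symmetric] S_def sum_distrib_left sum_negf)
            finally have P: "(\<Prod>j=1..n. ?G t j (x j)) = (t * (x 1)\<^sup>2) ^ m * exp (- (t * S))" .
            obtain k where k: "m = Suc k" using m by (cases m) auto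
            have sh: "share n x 1 = (x 1)\<^sup>2 / S" by (simp add: share_def S_def)
            have "?P x * erlang_density (m - 1) S t
                = indicator {0<..} t / t * (\<Prod>j=1..n. ?G t j (x j))"
              unfolding P sh using t S
              by (simp add: erlang_density_def k power_divide power_mult_distrib field_simps)
            then show ?thesis
              using S share_bounds[of 1 n x] n by (subst ennreal_mult'[symmetric]) (auto intro!: erlang_density_nonneg)
          qed (use t0 in \<open>auto simp: erlang_density_def indicator_def\<close>)
        qed
      qed
      finally show "ennreal (?P x) = (\<integral>\<^sup>+t. ?K x t \<partial>lborel)" .
    qed
  qed
  also have "\<dots> = (\<integral>\<^sup>+t. (\<integral>\<^sup>+x. ?K x t \<partial>row_law n) \<partial>lborel)"
    by (rule P.Fubini'[OF meas, symmetric])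
  also have "\<dots> = (\<integral>\<^sup>+t. ennreal (?I t) \<partial>lborel)"
  proof (intro nn_integral_cong)
    fix t :: real
    show "(\<integral>\<^sup>+x. ?K x t \<partial>row_law n) = ennreal (?I t)"
    proof (cases "t > 0")
      case t: True
      have Gint: "(\<integral>\<^sup>+y. ennreal (?G t j y) \<partial>\<mu>) = ennreal (?Q j t)" for j
      proof (cases "j = 1")
        case True
        have "integrable \<mu> (\<lambda>y. bump m (t * y\<^sup>2))"
          using t bump_le bump_nonneg by (intro integrable_const_bound[where B="fact m"]) auto
        then show ?thesis using t True bump_nonneg
          by (simp add: bump_mean_def nn_integral_eq_integral)
      next
        case False
        then show ?thesis using t integrable_exp[of t] by (simp add: laplace_def nn_integral_eq_integral)
      qed
      have "(\<integral>\<^sup>+x. ?K x t \<partial>row_law n) = (\<integral>\<^sup>+x. ennreal (1 / t) * (\<Prod>j=1..n. ennreal (?G t j (x j))) \<partial>row_law n)"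
      proof (rule nn_integral_cong)
        fix x :: "nat \<Rightarrow> real"
        have "(\<Prod>j=1..n. ennreal (?G t j (x j))) = ennreal (\<Prod>j=1..n. ?G t j (x j))"
          by (rule prod_ennreal, rule Gnn) (use t in simp)
        moreover have "?K x t = ennreal (1 / t * (\<Prod>j=1..n. ?G t j (x j)))"
          using t by simp
        moreover have "\<dots> = ennreal (1 / t) * ennreal (\<Prod>j=1..n. ?G t j (x j))"
          using t by (intro ennreal_mult') simp
        ultimately show "?K x t = ennreal (1 / t) * (\<Prod>j=1..n. ennreal (?G t j (x j)))"
          by simp
      qed
      also have "\<dots> = ennreal (1 / t) * (\<integral>\<^sup>+x. (\<Prod>j=1..n. ennreal (?G t j (x j))) \<partial>row_law n)"
      proof (intro nn_integral_cmult borel_measurable_prod_ennreal)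
        fix j assume j: "j \<in> {1..n}"
        show "(\<lambda>x. ennreal (?G t j (x j))) \<in> borel_measurable (row_law n)"
          by (rule measurable_compose[OF measurable_component_row[OF j]]) (cases "j = 1"; simp)
      qed
      also have "(\<integral>\<^sup>+x. (\<Prod>j=1..n. ennreal (?G t j (x j))) \<partial>row_law n) = (\<Prod>j=1..n. \<integral>\<^sup>+y. ennreal (?G t j y) \<partial>\<mu>)"
        unfolding row_law_def by (rule PS.product_nn_integral_prod) auto
      also have "\<dots> = (\<Prod>j=1..n. ennreal (?Q j t))"
        by (simp only: Gint)
      also have "\<dots> = ennreal (\<Prod>j=1..n. ?Q j t)"
        using t bump_mean_nonneg laplace_nonneg by (intro prod_ennreal) auto
      also have "(\<Prod>j=1..n. ?Q j t) = bump_mean m t * laplace t ^ (n - 1)"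
      proof -
        have "(\<Prod>j\<in>{1..n}-{1}. ?Q j t) = (\<Prod>j\<in>{1..n}-{1}. laplace t)"
          by (intro prod.cong) auto
        then show ?thesis using n by (subst prod.remove[of _ 1]) auto
      qed
      finally show ?thesis using t by (simp add: ennreal_mult'[symmetric])
    qed simp
  qed
  finally show "(\<integral>\<^sup>+t. ennreal (?I t) \<partial>lborel)
      = ennreal (fact (m - 1) * even_moment n m)" ..
qed

lemma even_moment_1_n: "even_moment 1 m = 1"
proof -
  interpret R: prob_space "row_law 1" by (rule prob_space_row)
  have "AE x in row_law 1. share 1 x 1 ^ m = 1"
    using sum_share_AE[OF order_refl] by eventually_elim simp
  then have "(\<integral>x. share 1 x 1 ^ m \<partial>row_law 1) = (\<integral>x. 1 \<partial>row_law 1)"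
    by (intro integral_cong_AE) (auto intro!: borel_measurable_power measurable_share)
  then show ?thesis
    using R.prob_space by (simp add: even_moment_def share_moment_def)
qed

text \<open>
  The shares are exchangeable and their sum is one.
\<close>

lemma even_moment_1:
  assumes n: "n \<ge> 1"
  shows "even_moment n 1 = 1 / real n"
proof -
  interpret R: prob_space "row_law n" by (rule prob_space_row)
  let ?h = "\<lambda>i j. if j = i then (\<lambda>u::real. u) else (\<lambda>_. 1)"
  have same: "share_moment n (?h i) = share_moment n (?h 1)" if "i \<in> {1..n}" for i
    by (rule share_moment_swap[of _ i _ 1])
       (use that n in \<open>auto simp: Transposition.transpose_def intro!: continuous_intros\<close>)
  have h: "(\<Prod>j=1..n. ?h i j (share n x j)) = share n x i" if "i \<in> {1..n}" for i x
  proof -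
    have "(\<Prod>j=1..n. ?h i j (share n x j)) = (\<Prod>j=1..n. if j = i then share n x j else 1)"
      by (intro prod.cong) auto
    then show ?thesis using that by (simp add: prod.delta)
  qed
  have "real n * share_moment n (?h 1) = (\<Sum>i=1..n. share_moment n (?h i))"
    by (subst sum.cong[OF refl same]) auto
  also have "\<dots> = (\<Sum>i=1..n. \<integral>x. share n x i \<partial>row_law n)"
    unfolding share_moment_def by (intro sum.cong Bochner_Integration.integral_cong refl h)
  also have "\<dots> = (\<integral>x. (\<Sum>i=1..n. share n x i) \<partial>row_law n)"
    using share_bounds by (intro Bochner_Integration.integral_sum[symmetric] integrable_row_bounded[where B=1] measurable_share) auto
  also have "\<dots> = (\<integral>x. 1 \<partial>row_law n)"
    using sum_share_AE[OF n] by (intro integral_cong_AE) (auto intro!: borel_measurable_sum measurable_share)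
  also have "\<dots> = 1" by (simp add: R.prob_space)
  finally have "share_moment n (?h 1) = 1 / real n" using n by (simp add: field_simps)
  moreover have "even_moment n 1 = share_moment n (?h 1)"
    unfolding even_moment_def by (rule arg_cong[where f="share_moment n"]) (auto simp: fun_eq_iff)
  ultimately show ?thesis by simp
qed

end

section \<open>Infinite variance\<close>

lemma tendsto_mult_geometric:
  fixes r :: real
  assumes "0 \<le> r" "r < 1"
  shows "(\<lambda>n. real n powr b * r ^ (n - 1)) \<longlonglongrightarrow> 0"
proof (rule tendsto_sandwich[OF _ _ tendsto_const])
  define s where "s = max r (1 / 2)"
  have s: "0 < s" "s < 1" "r \<le> s" using assms by (auto simp: s_def)
  show "(\<lambda>n. real n powr b * s ^ (n - 1)) \<longlonglongrightarrow> 0"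
    using s by real_asymp
  show "\<forall>\<^sub>F n in sequentially. real n powr b * r ^ (n - 1) \<le> real n powr b * s ^ (n - 1)"
    using s assms by (intro always_eventually allI mult_left_mono power_mono) auto
qed (use assms in auto)

context entry_law
begin

text \<open>
  The Laplace formula for a row of length one, whose only share is one.  It controls the
  contribution of large \<open>t\<close> uniformly in the row length.
\<close>

lemma integral_bump_mean:
  "m \<ge> 1 \<Longrightarrow> has_bochner_integral lborel (\<lambda>t. indicator {0<..} t * (bump_mean m t / t)) (fact (m - 1))"
  using integral_laplace_power[of 1 m] even_moment_1_n[of m] by simp

lemma laplace_power_le:
  "0 \<le> s \<Longrightarrow> s \<le> t \<Longrightarrow> laplace t ^ k \<le> laplace s ^ k"
  using laplace_antimono laplace_nonneg by (intro power_mono) auto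

end

context regular_entry_law
begin

text \<open>
  The integral for the \<open>m\<close>-th moment is compared with that for the first moment, which is exactly
  \<open>1/n\<close>.  Below \<open>\<delta>\<close> the two integrands have a quotient close to \<open>r\<close>; above \<open>\<delta>\<close> the power of the Laplace
  transform is at most its value at \<open>\<delta>\<close>, which is exponentially small in \<open>n\<close>.
\<close>

lemma even_moment_heavy:
  assumes a1: "a < 1" and m: "m \<ge> 1"
  shows "(\<lambda>n. real n * even_moment n m) \<longlonglongrightarrow> Gamma (real m - a) / (Gamma (1 - a) * fact (m - 1))"
proof -
  let ?G = "\<lambda>x. bump_mean m (1 / x)"
  let ?H = "\<lambda>x. bump_mean 1 (1 / x)"
  let ?E = "\<lambda>n. fact (m - 1) * even_moment n m"
  define r where "r = Gamma (real m - a) / Gamma (1 - a)"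
  have G: "Gamma (1 - a) > 0" "Gamma (real m - a) > 0" "real m - a > 0"
    using a1 m by (auto intro!: Gamma_real_pos)
  have r: "r > 0" using G by (simp add: r_def)
  have "((\<lambda>x. (?G x / tail x) / (?H x / tail x)) \<longlongrightarrow>
      (1 powr a * (a * Gamma (real m - a))) / (1 powr a * (a * Gamma (real 1 - a)))) at_top"
    using a1 m a_pos G(3) less_imp_neq[OF G(1)] by (intro tendsto_divide bump_mean_limit) auto
  then have "((\<lambda>x. (?G x / tail x) / (?H x / tail x)) \<longlongrightarrow> r) at_top"
    using a_pos by (simp add: r_def)
  then have lim: "((\<lambda>x. ?G x / ?H x) \<longlongrightarrow> r) at_top"
  proof (rule Lim_transform_eventually)
    show "\<forall>\<^sub>F x in at_top. (?G x / tail x) / (?H x / tail x) = ?G x / ?H x"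
      using tail_pos by eventually_elim simp
  qed
  have pos1: "\<forall>\<^sub>F x in at_top. ?H x > 0"
  proof -
    have "\<forall>\<^sub>F x in at_top. ?H x / tail x > 0"
      by (rule order_tendstoD(1)[OF bump_mean_limit[of 1 1]]) (use a1 a_pos G in auto)
    then show ?thesis using tail_pos
      by eventually_elim (simp add: zero_less_divide_iff)
  qed
  have "(\<lambda>n. real n * (?E n)) \<longlonglongrightarrow> r"
  proof (rule LIMSEQ_I)
    fix e :: real assume e: "e > 0"
    have "\<forall>\<^sub>F x in at_top. dist (?G x / ?H x) r < e / 2"
      using lim e by (intro tendstoD) auto
    with pos1 eventually_ge_at_top[of 1]
    have "\<forall>\<^sub>F x in at_top. 1 \<le> x \<and> \<bar>?G x - r * ?H x\<bar> \<le> e / 2 * ?H x"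
    proof eventually_elim
      case (elim x)
      then have "\<bar>?G x / ?H x - r\<bar> * ?H x \<le> e / 2 * ?H x"
        by (intro mult_right_mono) (auto simp: dist_real_def)
      also have "\<bar>?G x / ?H x - r\<bar> * ?H x
          = \<bar>(?G x / ?H x - r) * ?H x\<bar>"
        using elim by (simp add: abs_mult)
      also have "\<dots> = \<bar>?G x - r * ?H x\<bar>"
        using elim by (simp add: algebra_simps)
      finally show ?case using elim by simp
    qed
    then obtain x1 where x1: "\<And>x. x \<ge> x1 \<Longrightarrow> 1 \<le> x \<and> \<bar>?G x - r * ?H x\<bar> \<le> e / 2 * ?H x"
      unfolding eventually_at_top_linorder by metis
    define \<delta> where "\<delta> = 1 / x1"
    have x1p: "x1 \<ge> 1" using x1[of x1] by simp
    then have \<delta>: "\<delta> > 0" by (simp add: \<delta>_def)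
    have near: "\<bar>bump_mean m t - r * bump_mean 1 t\<bar> \<le> e / 2 * bump_mean 1 t" if "0 < t" "t \<le> \<delta>" for t
    proof -
      have "x1 \<le> 1 / t" using that x1p by (simp add: \<delta>_def field_simps)
      then show ?thesis using x1[of "1 / t"] that by simp
    qed
    define K where "K = fact (m - 1) + r"
    have K: "K > 0" using r by (simp add: K_def add_pos_pos)
    let ?B = "\<lambda>m t. indicator {0<..} t * (bump_mean m t / t)"
    have bound: "\<bar>real n * (?E n) - r\<bar> \<le> e / 2 + K * (real n * laplace \<delta> ^ (n - 1))" if n: "n \<ge> 1" for n
    proof -
      let ?I = "\<lambda>m t. indicator {0<..} t * (bump_mean m t / t * laplace t ^ (n - 1))"
      have Im: "has_bochner_integral lborel (?I m) (?E n)"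
        using integral_laplace_power n m by blast
      have I1: "has_bochner_integral lborel (?I 1) (1 / real n)"
        using integral_laplace_power[of n 1] n even_moment_1[OF n] by simp
      have D: "has_bochner_integral lborel (\<lambda>t. ?I m t - r * ?I 1 t) (?E n - r * (1 / real n))"
        by (intro has_bochner_integral_diff has_bochner_integral_mult_right Im I1)
      have W: "has_bochner_integral lborel (\<lambda>t. e / 2 * ?I 1 t + laplace \<delta> ^ (n - 1) * (?B m t + r * ?B 1 t))
          (e / 2 * (1 / real n) + laplace \<delta> ^ (n - 1) * (fact (m - 1) + r * fact (1 - 1)))"
        by (intro has_bochner_integral_add has_bochner_integral_mult_right I1 integral_bump_mean m order_refl)
      have "\<bar>?E n - r * (1 / real n)\<bar> = \<bar>\<integral>t. ?I m t - r * ?I 1 t \<partial>lborel\<bar>"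
        using has_bochner_integral_integral_eq[OF D] by simp
      also have "\<dots> \<le> (\<integral>t. \<bar>?I m t - r * ?I 1 t\<bar> \<partial>lborel)"
        by (rule integral_abs_bound)
      also have "\<dots> \<le> (\<integral>t. e / 2 * ?I 1 t + laplace \<delta> ^ (n - 1) * (?B m t + r * ?B 1 t) \<partial>lborel)"
      proof (rule integral_mono)
        show "integrable lborel (\<lambda>t. \<bar>?I m t - r * ?I 1 t\<bar>)"
          using D by (intro integrable_abs) (rule integrable.intros)
        show "integrable lborel (\<lambda>t. e / 2 * ?I 1 t + laplace \<delta> ^ (n - 1) * (?B m t + r * ?B 1 t))"
          using W by (rule integrable.intros)
        fix t :: real
        show "\<bar>?I m t - r * ?I 1 t\<bar> \<le> e / 2 * ?I 1 t + laplace \<delta> ^ (n - 1) * (?B m t + r * ?B 1 t)"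
        proof (cases "t > 0")
          case t: True
          let ?p = "laplace t ^ (n - 1)"
          have p: "0 \<le> ?p" using laplace_nonneg by simp
          have b: "0 \<le> bump_mean m t" "0 \<le> bump_mean 1 t" using t bump_mean_nonneg by auto
          have eq: "\<bar>?I m t - r * ?I 1 t\<bar> = \<bar>bump_mean m t - r * bump_mean 1 t\<bar> * (?p / t)"
          proof -
            have "?I m t - r * ?I 1 t = (bump_mean m t - r * bump_mean 1 t) * (?p / t)"
              using t by (simp add: field_simps)
            then show ?thesis using t p by (simp add: abs_mult)
          qed
          show ?thesis
          proof (cases "t \<le> \<delta>")
            case True
            have "\<bar>bump_mean m t - r * bump_mean 1 t\<bar> * (?p / t) \<le> (e / 2 * bump_mean 1 t) * (?p / t)"
              using near[OF t True] p t by (intro mult_right_mono) auto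
            moreover have "0 \<le> laplace \<delta> ^ (n - 1) * (?B m t + r * ?B 1 t)"
              using t b r laplace_nonneg by (intro mult_nonneg_nonneg add_nonneg_nonneg) auto
            ultimately show ?thesis unfolding eq using t by (simp add: mult_ac)
          next
            case False
            have "\<bar>bump_mean m t - r * bump_mean 1 t\<bar> * (?p / t) \<le> (bump_mean m t + r * bump_mean 1 t) * (laplace \<delta> ^ (n - 1) / t)"
            proof (intro mult_mono divide_right_mono laplace_power_le)
              show "\<bar>bump_mean m t - r * bump_mean 1 t\<bar> \<le> bump_mean m t + r * bump_mean 1 t"
                using b r by (simp add: abs_le_iff)
            qed (use t False \<delta> b r p in auto)
            moreover have "0 \<le> e / 2 * ?I 1 t" using t b e p by auto
            moreover have "(bump_mean m t + r * bump_mean 1 t) * (laplace \<delta> ^ (n - 1) / t) = laplace \<delta> ^ (n - 1) * (?B m t + r * ?B 1 t)"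
              using t by (simp add: field_simps)
            ultimately show ?thesis unfolding eq by linarith
          qed
        qed simp
      qed
      also have "\<dots> = e / 2 * (1 / real n) + laplace \<delta> ^ (n - 1) * K"
        using has_bochner_integral_integral_eq[OF W] by (simp add: K_def)
      finally have "real n * \<bar>?E n - r * (1 / real n)\<bar> \<le> real n * (e / 2 * (1 / real n) + laplace \<delta> ^ (n - 1) * K)"
        by (intro mult_left_mono) auto
      also have "real n * \<bar>?E n - r * (1 / real n)\<bar> = \<bar>real n * (?E n - r * (1 / real n))\<bar>"
        by (simp add: abs_mult)
      also have "real n * (?E n - r * (1 / real n)) = real n * (?E n) - r"
        using n by (simp add: field_simps)
      also have "real n * (e / 2 * (1 / real n) + laplace \<delta> ^ (n - 1) * K) = e / 2 + K * (real n * laplace \<delta> ^ (n - 1))"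
        using n by (simp add: field_simps)
      finally show ?thesis .
    qed
    have "(\<lambda>n. K * (real n powr 1 * laplace \<delta> ^ (n - 1))) \<longlonglongrightarrow> K * 0"
      using laplace_nonneg laplace_less_1[OF \<delta>] by (intro tendsto_mult_left tendsto_mult_geometric) auto
    then have "\<forall>\<^sub>F n in sequentially. K * (real n powr 1 * laplace \<delta> ^ (n - 1)) < e / 2"
      using e by (intro order_tendstoD) auto
    with eventually_ge_at_top[of 1]
    have "\<forall>\<^sub>F n in sequentially. norm (real n * (?E n) - r) < e"
      by eventually_elim (use bound in \<open>force simp: powr_one\<close>)
    then show "\<exists>N. \<forall>n\<ge>N. norm (real n * (?E n) - r) < e"
      by (simp add: eventually_sequentially)
  qed
  then have "(\<lambda>n. real n * (?E n) / fact (m - 1)) \<longlonglongrightarrow> r / fact (m - 1)"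
    by (intro tendsto_divide tendsto_const) auto
  then show ?thesis by (simp add: r_def)
qed

end

section \<open>Finite variance\<close>

context entry_law
begin

lemma centered_moment_expand:
  assumes n: "n \<ge> 1"
  shows "centered_moment n m = (\<Sum>k\<le>m. real (m choose k) * even_moment n k * (- (1 / real n)) ^ (m - k))"
proof -
  have "(\<Prod>j=1..n. (share n x j - 1 / real n) ^ (if j = 1 then m else 0)) = (share n x 1 + - (1 / real n)) ^ m" for x
  proof -
    have "(\<Prod>j=1..n. (share n x j - 1 / real n) ^ (if j = 1 then m else 0))
        = (\<Prod>j=1..n. if j = 1 then (share n x j - 1 / real n) ^ m else 1)"
      by (intro prod.cong) auto
    then show ?thesis using n by (simp add: prod.delta)
  qed
  then have "centered_moment n m = (\<integral>x. (share n x 1 + - (1 / real n)) ^ m \<partial>row_law n)"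
    by (simp add: centered_moment_def row_moment_def share_moment_def)
  also have "\<dots> = (\<integral>x. (\<Sum>k\<le>m. real (m choose k) * share n x 1 ^ k * (- (1 / real n)) ^ (m - k)) \<partial>row_law n)"
    by (simp only: binomial_ring)
  also have "\<dots> = (\<Sum>k\<le>m. \<integral>x. real (m choose k) * share n x 1 ^ k * (- (1 / real n)) ^ (m - k) \<partial>row_law n)"
  proof (intro Bochner_Integration.integral_sum integrable_mult_left integrable_mult_right)
    fix k
    have "\<bar>share n x 1 ^ k\<bar> \<le> 1" for x
      using share_bounds[of 1 n x] n by (auto simp: power_le_one)
    then show "integrable (row_law n) (\<lambda>x. share n x 1 ^ k)"
      using n by (intro integrable_row_bounded[where B=1] borel_measurable_power measurable_share) auto
  qed
  also have "\<dots> = (\<Sum>k\<le>m. real (m choose k) * even_moment n k * (- (1 / real n)) ^ (m - k))"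
    by (simp only: even_moment_eq[OF n] integral_mult_left_zero integral_mult_right_zero)
  finally show ?thesis .
qed

lemma even_moment_0: "n \<ge> 1 \<Longrightarrow> even_moment n 0 = 1"
proof -
  interpret R: prob_space "row_law n" by (rule prob_space_row)
  show "n \<ge> 1 \<Longrightarrow> even_moment n 0 = 1" using R.prob_space by (simp add: even_moment_eq)
qed

text \<open>
  In the binomial expansion of \<open>(Y\<^sup>2 - 1/n)^m\<close> the two lowest terms are exact multiples of \<open>n^(-m)\<close>, and
  every other term except the top one has order \<open>q\<close> times a negative power of \<open>n\<close>.
\<close>

lemma centered_moment_limit:
  assumes q: "(\<lambda>n. (1 / (real n)\<^sup>2) / q n) \<longlonglongrightarrow> 0"
    and E: "\<And>k. k \<ge> 2 \<Longrightarrow> (\<lambda>n. even_moment n k / q n) \<longlonglongrightarrow> \<kappa> k"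
    and m: "m \<ge> 2"
  shows "(\<lambda>n. centered_moment n m / q n) \<longlonglongrightarrow> \<kappa> m"
proof -
  let ?t = "\<lambda>k n. real (m choose k) * even_moment n k * (- (1 / real n)) ^ (m - k) / q n"
  have inv: "(\<lambda>n. (- (1 / real n)) ^ j) \<longlonglongrightarrow> 0" if "j > 0" for j
  proof -
    have "(\<lambda>n. - (1 / real n)) \<longlonglongrightarrow> 0" by real_asymp
    from tendsto_power[OF this, of j] show ?thesis by (simp only: zero_power[OF that])
  qed
  have low: "(\<lambda>n. C * (- (1 / real n)) ^ m / q n) \<longlonglongrightarrow> 0" for C
  proof -
    obtain j where j: "m = 2 + j" using m le_Suc_ex by blast
    have "(\<lambda>n. (- (1 / real n)) ^ j * ((1 / (real n)\<^sup>2) / q n)) \<longlonglongrightarrow> 0"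
    proof (rule Lim_null_comparison[OF _ tendsto_rabs_zero[OF q]], rule always_eventually, rule allI)
      fix n :: nat
      have "\<bar>1 / real n\<bar> \<le> 1" by (cases n) auto
      then have "\<bar>(- (1 / real n)) ^ j\<bar> \<le> 1"
        by (simp add: power_abs power_le_one)
      then show "norm ((- (1 / real n)) ^ j * ((1 / (real n)\<^sup>2) / q n)) \<le> \<bar>(1 / (real n)\<^sup>2) / q n\<bar>"
        unfolding real_norm_def abs_mult by (intro mult_left_le_one_le) auto
    qed
    then have "(\<lambda>n. C * (((- (1 / real n)) ^ j) * ((1 / (real n)\<^sup>2) / q n))) \<longlonglongrightarrow> C * 0"
      by (rule tendsto_mult_left)
    then show ?thesis
      by (simp add: j power_add power2_eq_square mult_ac)
  qed
  have "(\<lambda>n. \<Sum>k\<le>m. ?t k n) \<longlonglongrightarrow> (\<Sum>k\<le>m. if k = m then \<kappa> m else 0)"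
  proof (rule tendsto_sum)
    fix k assume "k \<in> {..m}"
    then consider "k = 0" | "k = 1" | "2 \<le> k" "k < m" | "k = m" using m by fastforce
    then show "?t k \<longlonglongrightarrow> (if k = m then \<kappa> m else 0)"
    proof cases
      case 1
      have "(\<lambda>n. 1 * (- (1 / real n)) ^ m / q n) \<longlonglongrightarrow> 0" by (rule low)
      then have "?t k \<longlonglongrightarrow> 0"
      proof (rule Lim_transform_eventually)
        show "\<forall>\<^sub>F n in sequentially. 1 * (- (1 / real n)) ^ m / q n = ?t k n"
          using eventually_ge_at_top[of 1] by eventually_elim (use 1 in \<open>simp add: even_moment_0\<close>)
      qed
      then show ?thesis using 1 m by simp
    next
      case 2
      have "(\<lambda>n. - real m * (- (1 / real n)) ^ m / q n) \<longlonglongrightarrow> 0" by (rule low)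
      then have "?t k \<longlonglongrightarrow> 0"
      proof (rule Lim_transform_eventually)
        show "\<forall>\<^sub>F n in sequentially. - real m * (- (1 / real n)) ^ m / q n = ?t k n"
          using eventually_ge_at_top[of 1]
        proof eventually_elim
          case (elim n)
          obtain j where j: "m = Suc j" using m by (cases m) auto
          have "?t k n = real m * (1 / real n) * (- (1 / real n)) ^ j / q n"
            using even_moment_1[OF elim] 2 by (simp add: j)
          also have "\<dots> = - real m * ((- (1 / real n)) * (- (1 / real n)) ^ j) / q n"
            by simp
          finally show ?case unfolding j power_Suc by simp
        qed
      qed
      then show ?thesis using 2 m by simp
    next
      case 3
      have "(\<lambda>n. real (m choose k) * (even_moment n k / q n) * (- (1 / real n)) ^ (m - k)) \<longlonglongrightarrow> real (m choose k) * \<kappa> k * 0"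
        using 3 by (intro tendsto_mult tendsto_const E inv) auto
      then show ?thesis using 3 by simp
    next
      case 4
      then show ?thesis using E[OF m] by simp
    qed
  qed
  also have "(\<Sum>k\<le>m. if k = m then \<kappa> m else 0) = \<kappa> m" by simp
  finally show ?thesis
  proof (rule Lim_transform_eventually)
    show "\<forall>\<^sub>F n in sequentially. (\<Sum>k\<le>m. ?t k n) = centered_moment n m / q n"
      using eventually_ge_at_top[of 1]
      by eventually_elim (simp add: centered_moment_expand sum_divide_distrib)
  qed
qed

end

locale unit_variance_entry_law = regular_entry_law +
  assumes square_integrable: "integrable \<mu> (\<lambda>x. x\<^sup>2)"
    and unit_variance: "(\<integral>x. x\<^sup>2 \<partial>\<mu>) = 1"
    and a_gt_1: "1 < a"
begin

lemma laplace_derivative_at_0: "((\<lambda>x. (1 - laplace (1 / x)) * x) \<longlongrightarrow> 1) at_top"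
proof -
  let ?s = "\<lambda>x y. (1 - exp (- (y\<^sup>2 / x))) * x"
  have "((\<lambda>x. \<integral>y. ?s x y \<partial>\<mu>) \<longlongrightarrow> (\<integral>y. y\<^sup>2 \<partial>\<mu>)) at_top"
  proof (rule integral_dominated_convergence_at_top[where w="\<lambda>y. y\<^sup>2"])
    show "\<forall>\<^sub>F x in at_top. AE y in \<mu>. norm (?s x y) \<le> y\<^sup>2"
      using eventually_gt_at_top[of 0]
    proof eventually_elim
      case (elim x)
      show ?case
      proof (rule AE_I2)
        fix y :: real
        have "1 - exp (- (y\<^sup>2 / x)) \<le> y\<^sup>2 / x"
          using exp_ge_add_one_self[of "- (y\<^sup>2 / x)"] by simp
        then have "?s x y \<le> y\<^sup>2"
          using elim by (simp add: field_simps)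
        moreover have "0 \<le> ?s x y" using elim by simp
        ultimately show "norm (?s x y) \<le> y\<^sup>2" by simp
      qed
    qed
    show "AE y in \<mu>. ((\<lambda>x. ?s x y) \<longlongrightarrow> y\<^sup>2) at_top"
    proof (rule AE_I2)
      fix y :: real
      have lim: "((\<lambda>x::real. (1 - exp (- (c / x))) * x) \<longlongrightarrow> c) at_top" if "c > 0" for c
        using that by real_asymp
      show "((\<lambda>x. ?s x y) \<longlongrightarrow> y\<^sup>2) at_top"
        using lim[of "y\<^sup>2"] by (cases "y = 0") auto
    qed
  qed (use square_integrable in measurable)
  also have "(\<integral>y. y\<^sup>2 \<partial>\<mu>) = 1" by (rule unit_variance)
  finally show ?thesis
  proof (rule Lim_transform_eventually)
    show "\<forall>\<^sub>F x in at_top. (\<integral>y. ?s x y \<partial>\<mu>) = (1 - laplace (1 / x)) * x"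
      using eventually_gt_at_top[of 0]
    proof eventually_elim
      case (elim x)
      have "(\<integral>y. ?s x y \<partial>\<mu>) = (\<integral>y. 1 - exp (- (1 / x * y\<^sup>2)) \<partial>\<mu>) * x"
        by simp
      also have "(\<integral>y. 1 - exp (- (1 / x * y\<^sup>2)) \<partial>\<mu>) = 1 - laplace (1 / x)"
        unfolding laplace_def using elim integrable_exp[of "1 / x"] prob_space by simp
      finally show ?case .
    qed
  qed
qed

text \<open>
  Jensen's inequality for the exponential function.
\<close>

lemma laplace_lower: "t \<ge> 0 \<Longrightarrow> exp (- t) \<le> laplace t"
proof -
  assume t: "t \<ge> 0"
  have "exp (- t) = (\<integral>x. exp (- t) * (1 + t - t * x\<^sup>2) \<partial>\<mu>)"
    using square_integrable unit_variance prob_space by simp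
  also have "\<dots> \<le> laplace t"
    unfolding laplace_def
  proof (intro integral_mono integrable_exp t)
    show "integrable \<mu> (\<lambda>x. exp (- t) * (1 + t - t * x\<^sup>2))"
      using square_integrable by simp
    fix x :: real
    have "exp (- t) * (1 + (t - t * x\<^sup>2)) \<le> exp (- t) * exp (t - t * x\<^sup>2)"
      by (intro mult_left_mono exp_ge_add_one_self) auto
    then show "exp (- t) * (1 + t - t * x\<^sup>2) \<le> exp (- (t * x\<^sup>2))"
      by (simp add: exp_add[symmetric] algebra_simps)
  qed
  finally show ?thesis .
qed

lemma laplace_upper: "laplace t \<le> exp (- (1 - laplace t))"
  using exp_ge_add_one_self[of "- (1 - laplace t)"] by simp

text \<open>
  The power lies between \<open>exp (- v (n-1)/n)\<close>, by Jensen's inequality, and \<open>exp (- (n-1) (1 - \<phi>(v/n)))\<close>, where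
  the derivative of the Laplace transform \<open>\<phi>\<close> at zero is minus one.
\<close>

lemma laplace_power_limit:
  assumes v: "v > 0"
  shows "(\<lambda>n. laplace (v / real n) ^ (n - 1)) \<longlonglongrightarrow> exp (- v)"
proof (rule tendsto_sandwich)
  show "(\<lambda>n. exp (- (v * (real (n - 1) / real n)))) \<longlonglongrightarrow> exp (- v)"
    by real_asymp
  have "filterlim (\<lambda>n. real n / v) at_top sequentially"
    using v by real_asymp
  then have l1: "(\<lambda>n. (1 - laplace (1 / (real n / v))) * (real n / v)) \<longlonglongrightarrow> 1"
    by (rule filterlim_compose[OF laplace_derivative_at_0])
  have r1: "(\<lambda>n. real (n - 1) / real n) \<longlonglongrightarrow> 1"
    by real_asymp
  have "(\<lambda>n. (1 - laplace (1 / (real n / v))) * (real n / v) * (v * (real (n - 1) / real n))) \<longlonglongrightarrow> 1 * (v * 1)"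
    by (intro tendsto_mult tendsto_const l1 r1)
  then have "(\<lambda>n. exp (- ((1 - laplace (1 / (real n / v))) * (real n / v) * (v * (real (n - 1) / real n))))) \<longlonglongrightarrow> exp (- (1 * (v * 1)))"
    by (intro tendsto_exp tendsto_minus)
  then show "(\<lambda>n. exp (- ((1 - laplace (1 / (real n / v))) * (real n / v) * (v * (real (n - 1) / real n))))) \<longlonglongrightarrow> exp (- v)"
    by simp
  show "\<forall>\<^sub>F n in sequentially. exp (- (v * (real (n - 1) / real n))) \<le> laplace (v / real n) ^ (n - 1)"
  proof (rule always_eventually, rule allI)
    fix n
    have "exp (- (v * (real (n - 1) / real n))) = exp (- (v / real n)) ^ (n - 1)"
      by (simp add: exp_of_nat_mult[symmetric] field_simps)
    also have "\<dots> \<le> laplace (v / real n) ^ (n - 1)"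
      using v by (intro power_mono laplace_lower) auto
    finally show "exp (- (v * (real (n - 1) / real n))) \<le> laplace (v / real n) ^ (n - 1)" .
  qed
  show "\<forall>\<^sub>F n in sequentially. laplace (v / real n) ^ (n - 1) \<le> exp (- ((1 - laplace (1 / (real n / v))) * (real n / v) * (v * (real (n - 1) / real n))))"
    using eventually_ge_at_top[of 1]
  proof eventually_elim
    case (elim n)
    have "laplace (v / real n) ^ (n - 1) \<le> exp (- (1 - laplace (v / real n))) ^ (n - 1)"
      by (intro power_mono laplace_upper laplace_nonneg)
    also have "\<dots> = exp (real (n - 1) * (- (1 - laplace (v / real n))))"
      by (rule exp_of_nat_mult[symmetric])
    also have "real (n - 1) * (- (1 - laplace (v / real n))) = - ((1 - laplace (1 / (real n / v))) * (real n / v) * (v * (real (n - 1) / real n)))"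
      using elim v by (simp add: divide_simps) (simp add: algebra_simps)
    finally show ?case .
  qed
qed

text \<open>
  The Laplace formula is split at \<open>\<delta>\<close>.  The part above \<open>\<delta>\<close> is exponentially small and hence negligible
  against the tail.  In the part below, substitute \<open>t = v/n\<close>: the mean of the bump divided by the
  tail converges to \<open>a \<Gamma>(m-a) v^a\<close> and the power of the Laplace transform \<open>\<phi>\<close> to \<open>exp (- v)\<close>, while
  \<open>\<phi>(t) \<le> exp (- t/2)\<close> for \<open>t \<le> \<delta>\<close> provides the domination.
\<close>

lemma even_moment_light:
  assumes m: "a < real m"
  shows "(\<lambda>n. even_moment n m / tail (real n)) \<longlonglongrightarrow> a * Gamma a * Gamma (real m - a) / fact (m - 1)"
proof -
  let ?b = "\<lambda>t. indicator {0<..} t * (bump_mean m t / t)"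
  let ?l = "\<lambda>n v. laplace (v / real n) ^ (n - 1)"
  let ?m = "\<lambda>n v. bump_mean m (v / real n)"
  let ?G = "a * Gamma a * Gamma (real m - a)"
  have m1: "m \<ge> 1" using m a_pos by (cases m) auto
  define \<epsilon> where "\<epsilon> = min a (real m - a) / 2"
  have \<epsilon>: "0 < \<epsilon>" "\<epsilon> < a" "a + \<epsilon> < real m"
    using a_pos m by (auto simp: \<epsilon>_def min_def field_simps)
  obtain D x0 where D: "D > 0" "x0 \<ge> 1" "\<And>x. x \<ge> x0 \<Longrightarrow> 0 < tail x"
    "\<And>x v. x \<ge> x0 \<Longrightarrow> v > 0 \<Longrightarrow> bump_mean m (v / x) \<le> D * tail x * (v powr (a + \<epsilon>) + v powr (a - \<epsilon>))"
    using bump_mean_upper[OF \<epsilon>(1,2) m1 \<epsilon>(3)] by metis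
  have "\<forall>\<^sub>F x in at_top. (1 - laplace (1 / x)) * x > 1 / 2"
    by (rule order_tendstoD(1)[OF laplace_derivative_at_0]) simp
  with eventually_ge_at_top[of 1] have "\<forall>\<^sub>F x in at_top. 1 \<le> x \<and> (1 - laplace (1 / x)) * x > 1 / 2"
    by eventually_elim auto
  then obtain x1 where x1: "\<And>x. x \<ge> x1 \<Longrightarrow> 1 \<le> x \<and> (1 - laplace (1 / x)) * x > 1 / 2"
    unfolding eventually_at_top_linorder by metis
  define \<delta> where "\<delta> = 1 / x1"
  have x1p: "x1 \<ge> 1" using x1[of x1] by simp
  then have \<delta>: "\<delta> > 0" by (simp add: \<delta>_def)
  have small: "laplace t \<le> exp (- (t / 2))" if "0 < t" "t \<le> \<delta>" for t
  proof -
    have "x1 \<le> 1 / t" using that x1p by (simp add: \<delta>_def field_simps)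
    then have "t / 2 \<le> 1 - laplace t" using x1[of "1 / t"] that by (simp add: field_simps)
    then show ?thesis using laplace_upper[of t] by (meson exp_le_cancel_iff neg_le_iff_le order_trans)
  qed
  let ?I = "\<lambda>n t. indicator {0<..} t * (bump_mean m t / t * laplace t ^ (n - 1))"
  define A where "A n = (\<integral>t. indicator {..\<delta>} t * ?I n t \<partial>lborel)" for n
  define B where "B n = (\<integral>t. indicator {\<delta><..} t * ?I n t \<partial>lborel)" for n
  have Iint: "integrable lborel (?I n)" if "n \<ge> 1" for n
    using integral_laplace_power[OF that m1] by (rule integrable.intros)
  have Inn: "0 \<le> ?I n t" for n t
    using bump_mean_nonneg laplace_nonneg by (auto simp: indicator_def)
  have split: "fact (m - 1) * even_moment n m = A n + B n" if n: "n \<ge> 1" for n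
  proof -
    have "fact (m - 1) * even_moment n m = (\<integral>t. ?I n t \<partial>lborel)"
      using has_bochner_integral_integral_eq[OF integral_laplace_power[OF n m1]] by simp
    also have "\<dots> = (\<integral>t. indicator {..\<delta>} t * ?I n t + indicator {\<delta><..} t * ?I n t \<partial>lborel)"
      by (intro Bochner_Integration.integral_cong refl) (auto simp: indicator_def)
    also have "\<dots> = A n + B n"
      unfolding A_def B_def
      by (intro Bochner_Integration.integral_add integrable_real_mult_indicator[where f="?I n", simplified mult.commute] ) (use Iint[OF n] in \<open>auto\<close>)
    finally show ?thesis .
  qed
  obtain c x2 where c: "c > 0" "x2 \<ge> 1" "\<And>x. x \<ge> x2 \<Longrightarrow> c * x powr (- a - \<epsilon>) \<le> tail x"
    using tail_lower[OF \<epsilon>(1,2)] by metis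
  have Blim: "(\<lambda>n. B n / tail (real n)) \<longlonglongrightarrow> 0"
  proof (rule tendsto_sandwich[OF _ _ tendsto_const])
    have Bnn: "0 \<le> B n" for n
      unfolding B_def by (rule Bochner_Integration.integral_nonneg, rule mult_nonneg_nonneg, simp, rule Inn)
    show "\<forall>\<^sub>F n in sequentially. 0 \<le> B n / tail (real n)"
      using Bnn tail_bounds by (intro always_eventually allI divide_nonneg_nonneg) auto
    show "(\<lambda>n. fact (m - 1) / c * (real n powr (a + \<epsilon>) * laplace \<delta> ^ (n - 1))) \<longlonglongrightarrow> 0"
      using laplace_nonneg laplace_less_1[OF \<delta>] by (intro tendsto_mult_right_zero tendsto_mult_geometric) auto
    have nx: "\<forall>\<^sub>F n in sequentially. real n \<ge> x2" by real_asymp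
    show "\<forall>\<^sub>F n in sequentially. B n / tail (real n) \<le> fact (m - 1) / c * (real n powr (a + \<epsilon>) * laplace \<delta> ^ (n - 1))"
      using nx eventually_ge_at_top[of 1]
    proof eventually_elim
      case (elim n)
      have "B n \<le> (\<integral>t. laplace \<delta> ^ (n - 1) * ?b t \<partial>lborel)"
        unfolding B_def
      proof (rule integral_mono_AE')
        show "integrable lborel (\<lambda>t. laplace \<delta> ^ (n - 1) * ?b t)"
          using integral_bump_mean[OF m1] by (intro integrable_mult_right) (rule integrable.intros)
        show "AE t in lborel. indicator {\<delta><..} t * ?I n t \<le> laplace \<delta> ^ (n - 1) * ?b t"
        proof (rule AE_I2)
          fix t :: real
          show "indicator {\<delta><..} t * ?I n t \<le> laplace \<delta> ^ (n - 1) * ?b t"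
          proof (cases "t > \<delta>")
            case True
            then have "bump_mean m t / t * laplace t ^ (n - 1) \<le> bump_mean m t / t * laplace \<delta> ^ (n - 1)"
              using \<delta> bump_mean_nonneg by (intro mult_left_mono laplace_power_le) auto
            then show ?thesis using True \<delta> by (simp add: mult.commute)
          next
            case False
            then show ?thesis using laplace_nonneg bump_mean_nonneg by (auto simp: indicator_def)
          qed
        qed
        show "AE t in lborel. 0 \<le> laplace \<delta> ^ (n - 1) * ?b t"
          using laplace_nonneg bump_mean_nonneg by (intro AE_I2) (auto simp: indicator_def)
      qed
      also have "\<dots> = laplace \<delta> ^ (n - 1) * fact (m - 1)"
        by (simp only: integral_mult_right_zero has_bochner_integral_integral_eq[OF integral_bump_mean[OF m1]])
      finally have Bn: "B n \<le> laplace \<delta> ^ (n - 1) * fact (m - 1)" .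
      have np: "real n powr (- a - \<epsilon>) > 0" using elim by simp
      have "B n / tail (real n) \<le> laplace \<delta> ^ (n - 1) * fact (m - 1) / (c * real n powr (- a - \<epsilon>))"
        using Bn Bnn[of n] c np elim by (intro frac_le) auto
      also have "\<dots> = fact (m - 1) / c * (real n powr (a + \<epsilon>) * laplace \<delta> ^ (n - 1))"
        using np c by (simp add: powr_minus powr_diff powr_add field_simps)
      finally show ?case .
    qed
  qed
  have Alim: "(\<lambda>n. A n / tail (real n)) \<longlonglongrightarrow> ?G"
  proof -
    let ?s = "\<lambda>n v. indicator {0<..\<delta> * real n} v * (?m n v / v * ?l n v) / tail (real n)"
    let ?f = "\<lambda>v. a * Gamma (real m - a) * (indicator {0<..} v * (v powr (a - 1) * exp (- v)))"
    let ?J = "\<lambda>s u. indicator {0<..} u * (u powr (s - 1) * exp (- u))"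
    let ?w = "\<lambda>v. D * (4 powr (a + \<epsilon> - 1) * ?J (a + \<epsilon>) (0 + 1 / 4 * v) + 4 powr (a - \<epsilon> - 1) * ?J (a - \<epsilon>) (0 + 1 / 4 * v))"
    have Aeq: "A n = (\<integral>v. indicator {0<..\<delta> * real n} v * (?m n v / v * ?l n v) \<partial>lborel)" if n: "n \<ge> 1" for n
    proof -
      have "A n = \<bar>1 / real n\<bar> *\<^sub>R (\<integral>v. indicator {..\<delta>} (0 + 1 / real n * v) * ?I n (0 + 1 / real n * v) \<partial>lborel)"
        unfolding A_def by (rule lborel_integral_real_affine) (use n in auto)
      also have "\<dots> = (\<integral>v. 1 / real n * (indicator {..\<delta>} (0 + 1 / real n * v) * ?I n (0 + 1 / real n * v)) \<partial>lborel)"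
        by (subst integral_mult_right_zero) simp
      also have "\<dots> = (\<integral>v. indicator {0<..\<delta> * real n} v * (?m n v / v * ?l n v) \<partial>lborel)"
        using n by (intro Bochner_Integration.integral_cong refl) (auto simp: indicator_def field_simps)
      finally show ?thesis .
    qed
    have w: "integrable lborel ?w"
      using \<epsilon> a_pos
      by (intro integrable_mult_right Bochner_Integration.integrable_add
          lborel_integrable_real_affine[where f="?J _"] integrable.intros[OF has_bochner_integral_Gamma]) auto
    \<comment> \<open>the domination holds only from some index on, so the sequence is shifted; \<open>n \<ge> 2\<close> gives \<open>(n-1)/(2n) \<ge> 1/4\<close>\<close>
    obtain N0 where N0: "N0 \<ge> 2" "real N0 \<ge> x0"
      by (metis max.cobounded1 max.cobounded2 of_nat_max order_trans real_arch_simple)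
    have "(\<lambda>n. \<integral>v. ?s (n + N0) v \<partial>lborel) \<longlonglongrightarrow> (\<integral>v. ?f v \<partial>lborel)"
    proof (rule integral_dominated_convergence[where w="?w"])
      show "AE v in lborel. (\<lambda>n. ?s (n + N0) v) \<longlonglongrightarrow> ?f v"
      proof (rule AE_I2)
        fix v :: real
        have "(\<lambda>n. ?s n v) \<longlonglongrightarrow> ?f v"
        proof (cases "v > 0")
          case v: True
          have "filterlim real at_top sequentially" by (rule filterlim_real_sequentially)
          then have "(\<lambda>n. ?m n v / tail (real n)) \<longlonglongrightarrow> v powr a * (a * Gamma (real m - a))"
            by (rule filterlim_compose[OF bump_mean_limit[OF m1 m v]])
          then have "(\<lambda>n. (?m n v / tail (real n)) / v * ?l n v) \<longlonglongrightarrow> v powr a * (a * Gamma (real m - a)) / v * exp (- v)"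
            using v by (intro tendsto_mult tendsto_divide tendsto_const laplace_power_limit) auto
          also have "v powr a * (a * Gamma (real m - a)) / v * exp (- v) = ?f v"
            using v by (simp add: powr_diff)
          finally show ?thesis
          proof (rule Lim_transform_eventually)
            have "\<forall>\<^sub>F n in sequentially. v \<le> \<delta> * real n" using \<delta> by real_asymp
            then show "\<forall>\<^sub>F n in sequentially. ?m n v / tail (real n) / v * ?l n v = ?s n v"
              by eventually_elim (use v in simp)
          qed
        qed simp
        then show "(\<lambda>n. ?s (n + N0) v) \<longlonglongrightarrow> ?f v"
          by (rule LIMSEQ_ignore_initial_segment)
      qed
      fix n' :: nat
      define n where "n = n' + N0"
      have n: "n \<ge> 2" "real n \<ge> x0" using N0 by (auto simp: n_def)
      show "AE v in lborel. norm (?s (n' + N0) v) \<le> ?w v"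
        unfolding n_def[symmetric]
      proof (rule AE_I2)
        fix v :: real
        show "norm (?s n v) \<le> ?w v"
        proof (cases "0 < v \<and> v \<le> \<delta> * real n")
          case True
          have tn: "tail (real n) > 0" using D n by auto
          have vn: "0 < v / real n" "v / real n \<le> \<delta>" using True n by (auto simp: field_simps)
          have "?l n v \<le> exp (- (v / real n / 2)) ^ (n - 1)"
            using small[OF vn] laplace_nonneg by (intro power_mono) auto
          also have "\<dots> = exp (- (v * (real (n - 1) / (2 * real n))))"
            by (simp add: exp_of_nat_mult[symmetric] field_simps)
          also have "\<dots> \<le> exp (- (v * (1 / 4)))"
            using True n by (simp only: exp_le_cancel_iff neg_le_iff_le, intro mult_left_mono) (auto simp: field_simps of_nat_diff)
          finally have L: "?l n v \<le> exp (- (v * (1 / 4)))" .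
          have "?m n v / tail (real n) \<le> D * (v powr (a + \<epsilon>) + v powr (a - \<epsilon>))"
            using D(4)[of "real n" v] n True tn by (simp add: field_simps)
          then have "?m n v / tail (real n) / v * ?l n v \<le> D * (v powr (a + \<epsilon>) + v powr (a - \<epsilon>)) / v * exp (- (v * (1 / 4)))"
            using L True D laplace_nonneg by (intro mult_mono divide_right_mono) auto
          also have "\<dots> = ?w v"
          proof -
            have pw: "v powr s / v = 4 powr (s - 1) * (0 + 1 / 4 * v) powr (s - 1)" for s
              using True by (subst powr_mult[symmetric]) (auto simp: powr_diff)
            have "D * (v powr (a + \<epsilon>) + v powr (a - \<epsilon>)) / v = D * (v powr (a + \<epsilon>) / v + v powr (a - \<epsilon>) / v)"
              by (simp only: add_divide_distrib[symmetric] times_divide_eq_right)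
            then show ?thesis
              unfolding pw using True by (simp add: algebra_simps)
          qed
          finally have "?s n v \<le> ?w v" using True by (simp add: mult.commute[of v])
          moreover have "0 \<le> ?s n v"
            using True tn bump_mean_nonneg[of "v / real n"] laplace_nonneg by simp
          ultimately show ?thesis by simp
        next
          case False
          have "0 \<le> ?w v" using D by (intro mult_nonneg_nonneg add_nonneg_nonneg) auto
          then show ?thesis using False by (auto simp: indicator_def)
        qed
      qed
    qed (use w in \<open>auto\<close>)
    then have "(\<lambda>n. \<integral>v. ?s n v \<partial>lborel) \<longlonglongrightarrow> (\<integral>v. ?f v \<partial>lborel)"
      by (rule LIMSEQ_offset)
    also have "(\<integral>v. ?f v \<partial>lborel) = ?G"
      using has_bochner_integral_integral_eq[OF has_bochner_integral_Gamma[OF a_pos]] by simp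
    finally show ?thesis
    proof (rule Lim_transform_eventually)
      show "\<forall>\<^sub>F n in sequentially. (\<integral>v. ?s n v \<partial>lborel) = A n / tail (real n)"
        using eventually_ge_at_top[of 1] by eventually_elim (simp only: Aeq integral_divide_zero)
    qed
  qed
  have "(\<lambda>n. (A n / tail (real n) + B n / tail (real n)) / fact (m - 1)) \<longlonglongrightarrow> (?G + 0) / fact (m - 1)"
    by (intro tendsto_intros Alim Blim) auto
  then have "(\<lambda>n. (A n / tail (real n) + B n / tail (real n)) / fact (m - 1)) \<longlonglongrightarrow> ?G / fact (m - 1)"
    by simp
  then show ?thesis
  proof (rule Lim_transform_eventually)
    show "\<forall>\<^sub>F n in sequentially. (A n / tail (real n) + B n / tail (real n)) / fact (m - 1) = even_moment n m / tail (real n)"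
      using eventually_ge_at_top[of 1]
    proof eventually_elim
      case (elim n)
      have "A n / tail (real n) + B n / tail (real n) = fact (m - 1) * even_moment n m / tail (real n)"
        using split[OF elim] by (simp add: add_divide_distrib)
      then show ?case by simp
    qed
  qed
qed

end

section \<open>Sums over maps into slots\<close>

text \<open>
  A slot \<open>(j, i, t)\<close> with \<open>i < j\<close> stands for the unordered pair of rows \<open>{i, j}\<close> in column \<open>t\<close>.
\<close>

definition slots :: "nat \<Rightarrow> nat \<Rightarrow> (nat \<times> nat \<times> nat) set" where
  "slots p n = (SIGMA j:{1..p}. {1..<j} \<times> {1..n})"

definition slot_rows :: "nat \<times> nat \<times> nat \<Rightarrow> nat set" where
  "slot_rows g = {fst g, fst (snd g)}"

definition slot_col :: "nat \<times> nat \<times> nat \<Rightarrow> nat" where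
  "slot_col g = snd (snd g)"

definition rows_of :: "(nat \<times> nat \<times> nat) set \<Rightarrow> nat set" where
  "rows_of P = (\<Union>g\<in>P. slot_rows g)"

definition incidences :: "(nat \<times> nat \<times> nat) set \<Rightarrow> (nat \<times> nat) set" where
  "incidences P = (\<Union>g\<in>P. slot_rows g \<times> {slot_col g})"

definition row_disjoint :: "(nat \<times> nat \<times> nat) set \<Rightarrow> bool" where
  "row_disjoint P \<longleftrightarrow> (\<forall>g\<in>P. \<forall>g'\<in>P. g \<noteq> g' \<longrightarrow> slot_rows g \<inter> slot_rows g' = {})"

lemma finite_slots [simp]: "finite (slots p n)"
  by (auto simp: slots_def)

lemma card_slots: "2 * real (card (slots p n)) = (real p * real p - real p) * real n"
proof -
  have "card (slots p n) = (\<Sum>j=1..p. (j - 1) * n)"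
    unfolding slots_def by (subst card_SigmaI) auto
  also have "2 * real \<dots> = (real p * real p - real p) * real n"
    by (induction p) (auto simp: algebra_simps)
  finally show ?thesis .
qed

lemma card_slot_rows: "g \<in> slots p n \<Longrightarrow> card (slot_rows g) = 2"
  by (auto simp: slots_def slot_rows_def card_insert_if)

lemma slot_rows_subset: "g \<in> slots p n \<Longrightarrow> slot_rows g \<subseteq> {1..p}"
  by (auto simp: slots_def slot_rows_def)

lemma slot_col_in: "g \<in> slots p n \<Longrightarrow> slot_col g \<in> {1..n}"
  by (auto simp: slots_def slot_col_def)

lemma slot_eqI:
  assumes "g \<in> slots p n" "g' \<in> slots p n" "slot_rows g = slot_rows g'" "slot_col g = slot_col g'"
  shows "g = g'"
  using assms by (auto simp: slots_def slot_rows_def slot_col_def doubleton_eq_iff)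

lemma finite_slot_rows [simp]: "finite (slot_rows g)"
  by (simp add: slot_rows_def)

lemma rows_of_eq: "rows_of P = fst ` incidences P"
  by (force simp: rows_of_def incidences_def)

lemma finite_incidences [simp]: "finite P \<Longrightarrow> finite (incidences P)"
  by (auto simp: incidences_def)

lemma finite_rows_of [simp]: "finite P \<Longrightarrow> finite (rows_of P)"
  by (auto simp: rows_of_def)

lemma card_incidences_cols:
  assumes "finite P"
  shows "card (incidences P) = (\<Sum>t\<in>slot_col ` P. card {i. (i, t) \<in> incidences P})"
proof -
  have "incidences P = (\<lambda>(t, i). (i, t)) ` (SIGMA t:slot_col ` P. {i. (i, t) \<in> incidences P})"
    by (force simp: incidences_def)
  moreover have "inj_on (\<lambda>(t, i). (i, t)) A" for A :: "(nat \<times> nat) set"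
    by (auto simp: inj_on_def)
  ultimately have "card (incidences P) = card (SIGMA t:slot_col ` P. {i. (i, t) \<in> incidences P})"
    by (metis card_image)
  also have "\<dots> = (\<Sum>t\<in>slot_col ` P. card {i. (i, t) \<in> incidences P})"
  proof (rule card_SigmaI)
    have "finite {i. (i, t) \<in> incidences P}" for t
      by (rule finite_subset[of _ "rows_of P"]) (use assms in \<open>force simp: rows_of_eq\<close>)+
    then show "\<forall>t\<in>slot_col ` P. finite {i. (i, t) \<in> incidences P}" by blast
  qed (use assms in auto)
  finally show ?thesis .
qed

lemma card_incidences_rows:
  assumes "finite P"
  shows "card (incidences P) = (\<Sum>i\<in>rows_of P. card {t. (i, t) \<in> incidences P})"
proof -
  have "incidences P = (SIGMA i:rows_of P. {t. (i, t) \<in> incidences P})"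
    by (force simp: rows_of_eq)
  also have "card \<dots> = (\<Sum>i\<in>rows_of P. card {t. (i, t) \<in> incidences P})"
  proof (rule card_SigmaI)
    have "finite {t. (i, t) \<in> incidences P}" for i
      by (rule finite_subset[of _ "slot_col ` P"]) (use assms in \<open>auto simp: incidences_def\<close>)
    then show "\<forall>i\<in>rows_of P. finite {t. (i, t) \<in> incidences P}" by blast
  qed (use assms in auto)
  finally show ?thesis .
qed

lemma slot_rows_subset_col:
  "g \<in> P \<Longrightarrow> slot_rows g \<subseteq> {i. (i, slot_col g) \<in> incidences P}"
  by (auto simp: incidences_def)

lemma finite_col_incidences: "finite P \<Longrightarrow> finite {i. (i, t) \<in> incidences P}"
  by (rule finite_subset[of _ "rows_of P"]) (force simp: rows_of_eq)+

lemma card_rows_le_incidences: "finite P \<Longrightarrow> card (rows_of P) \<le> card (incidences P)"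
  unfolding rows_of_eq by (rule card_image_le) simp

lemma two_le_col_incidences:
  assumes "finite P" "P \<subseteq> slots p n" "t \<in> slot_col ` P"
  shows "2 \<le> card {i. (i, t) \<in> incidences P}"
proof -
  obtain g where g: "g \<in> P" "t = slot_col g" using assms by auto
  have "card (slot_rows g) \<le> card {i. (i, t) \<in> incidences P}"
    using slot_rows_subset_col[OF g(1)] g assms by (intro card_mono finite_col_incidences) auto
  then show ?thesis using card_slot_rows[of g p n] g assms by auto
qed

lemma two_cols_le_incidences:
  assumes "finite P" "P \<subseteq> slots p n"
  shows "2 * card (slot_col ` P) \<le> card (incidences P)"
proof -
  have "(\<Sum>t\<in>slot_col ` P. 2) \<le> (\<Sum>t\<in>slot_col ` P. card {i. (i, t) \<in> incidences P})"
    using two_le_col_incidences[OF assms] by (intro sum_mono) auto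
  then show ?thesis by (simp add: card_incidences_cols[OF assms(1)])
qed

text \<open>
  By the first inequality every row lies in one column only, by the second every column meets exactly two rows
  and so contains a single slot.  Two slots sharing a row would share the column as well, and hence be
  equal.
\<close>

lemma incidences_tight_imp_row_disjoint:
  assumes P: "finite P" "P \<subseteq> slots p n"
    and V: "card (incidences P) \<le> card (rows_of P)" and b: "card (incidences P) \<le> 2 * card (slot_col ` P)"
  shows "row_disjoint P"
  unfolding row_disjoint_def
proof (intro ballI impI, rule ccontr)
  fix g g' assume g: "g \<in> P" "g' \<in> P" "g \<noteq> g'" and "slot_rows g \<inter> slot_rows g' \<noteq> {}"
  then obtain i where i: "i \<in> slot_rows g" "i \<in> slot_rows g'" by auto
  have "card (fst ` incidences P) = card (incidences P)"
    using V card_rows_le_incidences[OF P(1)] by (simp add: rows_of_eq)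
  then have inj: "inj_on fst (incidences P)" by (intro eq_card_imp_inj_on) (use P in auto)
  have I: "(i, slot_col g) \<in> incidences P" "(i, slot_col g') \<in> incidences P"
    using g i by (auto simp: incidences_def)
  have t: "slot_col g = slot_col g'" using inj_onD[OF inj _ I] by simp
  let ?t = "slot_col g"
  have "\<not> 2 < card {i. (i, ?t) \<in> incidences P}"
  proof
    assume "2 < card {i. (i, ?t) \<in> incidences P}"
    then have "(\<Sum>t\<in>slot_col ` P. 2) < (\<Sum>t\<in>slot_col ` P. card {i. (i, t) \<in> incidences P})"
      using two_le_col_incidences[OF P] g P by (intro sum_strict_mono_ex1) auto
    then show False using b by (simp add: card_incidences_cols[OF P(1)])
  qed
  then have c: "card {i. (i, ?t) \<in> incidences P} \<le> 2" by simp
  have "slot_rows g = {i. (i, ?t) \<in> incidences P}"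
    using c slot_rows_subset_col[OF g(1)] card_slot_rows[of g p n] g P by (intro card_seteq finite_col_incidences) auto
  moreover have "slot_rows g' = {i. (i, ?t) \<in> incidences P}"
    using c slot_rows_subset_col[OF g(2)] card_slot_rows[of g' p n] g P t by (intro card_seteq finite_col_incidences) auto
  ultimately show False using slot_eqI[of g p n g'] g P t by auto
qed

lemma card_rows_le: "finite P \<Longrightarrow> P \<subseteq> slots p n \<Longrightarrow> card (rows_of P) \<le> 2 * card P"
proof -
  assume P: "finite P" "P \<subseteq> slots p n"
  have "card (rows_of P) \<le> (\<Sum>g\<in>P. card (slot_rows g))"
    unfolding rows_of_def using P by (intro card_UN_le)
  also have "\<dots> = (\<Sum>g\<in>P. 2)" using P card_slot_rows by (intro sum.cong) auto
  finally show ?thesis by simp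
qed

lemma not_row_disjoint_card_rows:
  assumes P: "finite P" "P \<subseteq> slots p n" and "\<not> row_disjoint P"
  shows "card (rows_of P) < 2 * card P"
proof -
  obtain g g' where g: "g \<in> P" "g' \<in> P" "g \<noteq> g'" "slot_rows g \<inter> slot_rows g' \<noteq> {}"
    using assms unfolding row_disjoint_def by blast
  have "rows_of P = rows_of (P - {g, g'}) \<union> (slot_rows g \<union> slot_rows g')"
    using g by (auto simp: rows_of_def)
  then have "card (rows_of P) \<le> card (rows_of (P - {g, g'})) + card (slot_rows g \<union> slot_rows g')"
    by (metis card_Un_le)
  also have "card (rows_of (P - {g, g'})) \<le> 2 * card (P - {g, g'})"
    using P by (intro card_rows_le) auto
  also have "card (P - {g, g'}) = card P - 2"
    using g P by (subst card_Diff_subset) auto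
  also have "card (slot_rows g \<union> slot_rows g') < 4"
  proof -
    have "card (slot_rows g) = 2" "card (slot_rows g') = 2"
      using g P card_slot_rows by blast+
    then have "card (slot_rows g \<union> slot_rows g') + card (slot_rows g \<inter> slot_rows g') = 4"
      using card_Un_Int[of "slot_rows g" "slot_rows g'"] by simp
    moreover have "card (slot_rows g \<inter> slot_rows g') > 0" using g by (simp add: card_gt_0_iff)
    ultimately show ?thesis by linarith
  qed
  finally have "card (rows_of P) < 2 * (card P - 2) + 4" by simp
  moreover have "card P \<ge> 2"
    using card_mono[of P "{g, g'}"] g P by auto
  ultimately show ?thesis by simp
qed

text \<open>
  The exponent of the centred share of row \<open>i\<close> and column \<open>t\<close> in the term of the map \<open>f\<close>.
\<close>

definition incidence_count :: "nat \<Rightarrow> (nat \<Rightarrow> nat \<times> nat \<times> nat) \<Rightarrow> nat \<Rightarrow> nat \<Rightarrow> nat" where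
  "incidence_count s f i t = card {k\<in>{1..s}. i \<in> slot_rows (f k) \<and> slot_col (f k) = t}"

text \<open>
  What the combinatorial argument needs from the mixed moments \<open>e \<beta>\<close> of a row: the value is one for no
  column and \<open>z m\<close> for a single column with exponent \<open>m\<close>, and a row with \<open>r\<close> columns contributes at
  most \<open>(K / p) n^(-(2r-1)/2)\<close>.
\<close>

locale slot_weights =
  fixes p n s :: nat and e :: "(nat \<Rightarrow> nat) \<Rightarrow> real" and z :: "nat \<Rightarrow> real" and K :: real
  assumes p_pos: "p \<ge> 1" and n_pos: "n \<ge> 1" and K_ge: "K \<ge> 1"
    and e_zero: "e (\<lambda>_. 0) = 1"
    and e_single: "\<And>t m. t \<in> {1..n} \<Longrightarrow> e (\<lambda>u. if u = t then m else 0) = z m"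
    and e_bound: "\<And>S \<beta>. S \<subseteq> {1..n} \<Longrightarrow> S \<noteq> {} \<Longrightarrow> card S \<le> s \<Longrightarrow> (\<And>t. t \<in> S \<Longrightarrow> \<beta> t \<ge> 1) \<Longrightarrow>
      (\<And>t. t \<notin> S \<Longrightarrow> \<beta> t = 0) \<Longrightarrow> \<bar>e \<beta>\<bar> \<le> K / real p * (1 / sqrt (real n)) ^ (2 * card S - 1)"
begin

abbreviation \<theta> :: real where "\<theta> \<equiv> 1 / sqrt (real n)"

abbreviation maps :: "(nat \<Rightarrow> nat \<times> nat \<times> nat) set" where
  "maps \<equiv> {1..s} \<rightarrow>\<^sub>E slots p n"

definition weight :: "(nat \<Rightarrow> nat \<times> nat \<times> nat) \<Rightarrow> real" where
  "weight f = (\<Prod>i=1..p. e (incidence_count s f i))"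

text \<open>
  The weight that a map would have if different slots were independent.
\<close>

definition pair_weight :: "(nat \<Rightarrow> nat \<times> nat \<times> nat) \<Rightarrow> real" where
  "pair_weight f = (\<Prod>g\<in>slots p n. (z (card {k\<in>{1..s}. f k = g}))\<^sup>2)"

lemma theta: "0 < \<theta>" "\<theta> \<le> 1" "\<theta>\<^sup>2 = 1 / real n"
  using n_pos by (auto simp: power_divide)

lemma z_0: "z 0 = 1"
  using e_single[of 1 0] e_zero n_pos by simp

lemma z_bound: "s \<ge> 1 \<Longrightarrow> m \<ge> 1 \<Longrightarrow> \<bar>z m\<bar> \<le> K / real p * \<theta>"
  using e_bound[of "{1}" "\<lambda>u. if u = 1 then m else 0"] e_single[of 1 m] n_pos by simp

lemma image_maps: "f \<in> maps \<Longrightarrow> f ` {1..s} \<subseteq> slots p n"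
  by auto

lemma incidence_count_pos_iff:
  "incidence_count s f i t \<ge> 1 \<longleftrightarrow> (i, t) \<in> incidences (f ` {1..s})"
proof -
  have "incidence_count s f i t \<ge> 1 \<longleftrightarrow> {k\<in>{1..s}. i \<in> slot_rows (f k) \<and> slot_col (f k) = t} \<noteq> {}"
    by (simp add: incidence_count_def Suc_le_eq card_gt_0_iff)
  then show ?thesis by (auto simp: incidences_def)
qed

lemma incidence_count_outside: "i \<notin> rows_of (f ` {1..s}) \<Longrightarrow> incidence_count s f i = (\<lambda>_. 0)"
  by (auto simp: incidence_count_def rows_of_def fun_eq_iff)

lemma weight_eq_rows:
  assumes "f \<in> maps"
  shows "weight f = (\<Prod>i\<in>rows_of (f ` {1..s}). e (incidence_count s f i))"
  unfolding weight_def
proof (rule prod.mono_neutral_right)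
  show "rows_of (f ` {1..s}) \<subseteq> {1..p}"
    using slot_rows_subset image_maps[OF assms] unfolding rows_of_def by blast
qed (auto simp: incidence_count_outside e_zero)

lemma pair_weight_eq_image:
  assumes "f \<in> maps"
  shows "pair_weight f = (\<Prod>g\<in>f ` {1..s}. (z (card {k\<in>{1..s}. f k = g}))\<^sup>2)"
  unfolding pair_weight_def
proof (rule prod.mono_neutral_right)
  show "\<forall>g\<in>slots p n - f ` {1..s}. (z (card {k\<in>{1..s}. f k = g}))\<^sup>2 = 1"
  proof
    fix g assume "g \<in> slots p n - f ` {1..s}"
    then have "{k\<in>{1..s}. f k = g} = {}" by auto
    then show "(z (card {k\<in>{1..s}. f k = g}))\<^sup>2 = 1" by (simp only: card.empty z_0 one_power2)
  qed
qed (use image_maps[OF assms] in auto)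

text \<open>
  Each row that occurs lies in exactly one slot, so its mixed moment is that of a single column, and
  every slot contributes one such factor for each of its two rows.
\<close>

lemma weight_row_disjoint:
  assumes f: "f \<in> maps" and d: "row_disjoint (f ` {1..s})"
  shows "weight f = pair_weight f"
proof -
  let ?P = "f ` {1..s}"
  have "weight f = (\<Prod>i\<in>(\<Union>g\<in>?P. slot_rows g). e (incidence_count s f i))"
    using weight_eq_rows[OF f] by (simp add: rows_of_def)
  also have "\<dots> = (\<Prod>g\<in>?P. \<Prod>i\<in>slot_rows g. e (incidence_count s f i))"
    by (rule prod.UNION_disjoint) (use d in \<open>auto simp: row_disjoint_def\<close>)
  also have "\<dots> = (\<Prod>g\<in>?P. (z (card {k\<in>{1..s}. f k = g}))\<^sup>2)"
  proof (rule prod.cong[OF refl])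
    fix g assume g: "g \<in> ?P"
    have gs: "g \<in> slots p n" using g image_maps[OF f] by auto
    have "e (incidence_count s f i) = z (card {k\<in>{1..s}. f k = g})" if i: "i \<in> slot_rows g" for i
    proof -
      have "i \<in> slot_rows (f k) \<longleftrightarrow> f k = g" if "k \<in> {1..s}" for k
        using d g i that unfolding row_disjoint_def by (metis disjoint_iff imageI)
      then have "{k\<in>{1..s}. i \<in> slot_rows (f k) \<and> slot_col (f k) = t} = (if t = slot_col g then {k\<in>{1..s}. f k = g} else {})" for t
        by auto
      then have "incidence_count s f i = (\<lambda>t. if t = slot_col g then card {k\<in>{1..s}. f k = g} else 0)"
        by (auto simp: incidence_count_def fun_eq_iff)
      then show ?thesis using e_single[OF slot_col_in[OF gs]] by simp
    qed
    then show "(\<Prod>i\<in>slot_rows g. e (incidence_count s f i)) = (z (card {k\<in>{1..s}. f k = g}))\<^sup>2"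
      using card_slot_rows[OF gs] by simp
  qed
  also have "\<dots> = pair_weight f" using pair_weight_eq_image[OF f] by simp
  finally show ?thesis .
qed

lemma card_image_maps: "card (f ` {1..s}) \<le> s"
  using card_image_le[of "{1..s}" f] by simp

text \<open>
  The reciprocal of the order of the number of maps with as many rows and columns as \<open>f\<close>.
\<close>

definition scale :: "(nat \<Rightarrow> nat \<times> nat \<times> nat) \<Rightarrow> real" where
  "scale f = (1 / real p) ^ card (rows_of (f ` {1..s})) * (1 / real n) ^ card (slot_col ` f ` {1..s})"

text \<open>
  The exponents \<open>2r - 1\<close> of the rows add up to \<open>2I - V\<close>, for \<open>V\<close> rows, \<open>b\<close> columns and \<open>I\<close> incidences.  This is at
  least \<open>2b\<close>, and at least \<open>2b + 1\<close> unless \<open>I = V = 2b\<close>; the excess is the factor \<open>\<theta>\<close> gained.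
\<close>

lemma weight_bound:
  assumes f: "f \<in> maps" and nd: "\<not> row_disjoint (f ` {1..s})"
  shows "\<bar>weight f\<bar> \<le> K ^ (2 * s) * scale f * \<theta>"
proof -
  let ?P = "f ` {1..s}" and ?r = "\<lambda>i. card {t. (i, t) \<in> incidences (f ` {1..s})}"
  have P: "finite ?P" "?P \<subseteq> slots p n" using image_maps[OF f] by auto
  have r1: "?r i \<ge> 1" if "i \<in> rows_of ?P" for i
  proof -
    have "finite {t. (i, t) \<in> incidences ?P}"
      by (rule finite_subset[of _ "slot_col ` ?P"]) (auto simp: incidences_def)
    moreover have "{t. (i, t) \<in> incidences ?P} \<noteq> {}" using that by (auto simp: rows_of_eq)
    ultimately show ?thesis by (simp add: Suc_le_eq card_gt_0_iff)
  qed
  have row: "\<bar>e (incidence_count s f i)\<bar> \<le> K / real p * \<theta> ^ (2 * ?r i - 1)" if i: "i \<in> rows_of ?P" for i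
  proof (rule e_bound)
    show "{t. (i, t) \<in> incidences ?P} \<subseteq> {1..n}"
      using slot_col_in P unfolding incidences_def by blast
    show "{t. (i, t) \<in> incidences ?P} \<noteq> {}" using i by (auto simp: rows_of_eq)
    have "card {t. (i, t) \<in> incidences ?P} \<le> card (slot_col ` ?P)"
      by (rule card_mono) (auto simp: incidences_def)
    also have "\<dots> \<le> card ?P" by (rule card_image_le) simp
    finally show "?r i \<le> s" using card_image_maps[of f] by simp
  qed (use incidence_count_pos_iff[of f i] in \<open>auto simp: Suc_le_eq\<close>)
  let ?V = "card (rows_of ?P)" and ?b = "card (slot_col ` ?P)" and ?I = "card (incidences ?P)"
  have "\<bar>weight f\<bar> \<le> (\<Prod>i\<in>rows_of ?P. K / real p * \<theta> ^ (2 * ?r i - 1))"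
    unfolding weight_eq_rows[OF f] abs_prod by (intro prod_mono) (use row in auto)
  also have "\<dots> = (K / real p) ^ ?V * \<theta> ^ (\<Sum>i\<in>rows_of ?P. 2 * ?r i - 1)"
    by (simp only: prod.distrib prod_constant power_sum)
  also have "(\<Sum>i\<in>rows_of ?P. 2 * ?r i - 1) = 2 * ?I - ?V"
    unfolding card_incidences_rows[OF P(1)] using r1
    by (subst sum_subtractf_nat) (auto simp: sum_distrib_left)
  also have "(K / real p) ^ ?V * \<theta> ^ (2 * ?I - ?V) \<le> (K ^ (2 * s) * (1 / real p) ^ ?V) * \<theta> ^ (2 * ?b + 1)"
  proof (intro mult_mono)
    have "?V \<le> 2 * s" using card_rows_le[OF P] card_image_maps[of f] by linarith
    then have "K ^ ?V \<le> K ^ (2 * s)" using K_ge by (intro power_increasing) auto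
    then have "K ^ ?V * (1 / real p) ^ ?V \<le> K ^ (2 * s) * (1 / real p) ^ ?V"
      by (intro mult_right_mono) auto
    then show "(K / real p) ^ ?V \<le> K ^ (2 * s) * (1 / real p) ^ ?V"
      by (simp add: power_divide)
    have "2 * ?b + 1 \<le> 2 * ?I - ?V"
      using card_rows_le_incidences[OF P(1)] two_cols_le_incidences[OF P]
        incidences_tight_imp_row_disjoint[OF P] nd by linarith
    then show "\<theta> ^ (2 * ?I - ?V) \<le> \<theta> ^ (2 * ?b + 1)"
      using theta by (intro power_decreasing) auto
  qed (use K_ge theta in auto)
  also have "\<theta> ^ (2 * ?b + 1) = (1 / real n) ^ ?b * \<theta>"
    using theta by (simp add: power_mult)
  finally show ?thesis by (simp add: scale_def mult_ac)
qed

text \<open>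
  A map hitting \<open>v\<close> distinct slots has factorised weight of order \<open>p^(-2v) n^(-v)\<close>, but if two of the slots share a row
  they cover at most \<open>2v - 1\<close> rows.
\<close>

lemma pair_weight_bound:
  assumes f: "f \<in> maps" and nd: "\<not> row_disjoint (f ` {1..s})"
  shows "\<bar>pair_weight f\<bar> \<le> K ^ (2 * s) * scale f * (1 / real p)"
proof -
  let ?P = "f ` {1..s}"
  let ?V = "card (rows_of ?P)" and ?b = "card (slot_col ` ?P)" and ?v = "card ?P"
  have P: "finite ?P" "?P \<subseteq> slots p n" using image_maps[OF f] by auto
  have s: "s \<ge> 1" using nd by (cases s) (auto simp: row_disjoint_def)
  have "\<bar>pair_weight f\<bar> \<le> (\<Prod>g\<in>?P. (K / real p * \<theta>)\<^sup>2)"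
    unfolding pair_weight_eq_image[OF f] abs_prod
  proof (intro prod_mono conjI abs_ge_zero)
    fix g assume "g \<in> ?P"
    then have "card {k\<in>{1..s}. f k = g} \<ge> 1" by (auto simp: Suc_le_eq card_gt_0_iff)
    then have "\<bar>z (card {k\<in>{1..s}. f k = g})\<bar> \<le> K / real p * \<theta>" by (rule z_bound[OF s])
    then have "\<bar>z (card {k\<in>{1..s}. f k = g})\<bar>\<^sup>2 \<le> (K / real p * \<theta>)\<^sup>2" by (intro power_mono) auto
    then show "\<bar>(z (card {k\<in>{1..s}. f k = g}))\<^sup>2\<bar> \<le> (K / real p * \<theta>)\<^sup>2" by simp
  qed
  also have "\<dots> = K ^ (2 * ?v) * ((1 / real p) ^ (2 * ?v) * (1 / real n) ^ ?v)"
    using theta(3) by (simp add: power_mult_distrib power_divide power_mult)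
  also have "\<dots> \<le> K ^ (2 * s) * ((1 / real p) ^ (?V + 1) * (1 / real n) ^ ?b)"
  proof -
    have "?V + 1 \<le> 2 * ?v" using not_row_disjoint_card_rows[OF P nd] by simp
    then have "(1 / real p) ^ (2 * ?v) \<le> (1 / real p) ^ (?V + 1)"
      using p_pos by (intro power_decreasing) auto
    moreover have "(1 / real n) ^ ?v \<le> (1 / real n) ^ ?b"
      using n_pos by (intro power_decreasing card_image_le) auto
    moreover have "K ^ (2 * ?v) \<le> K ^ (2 * s)"
      using K_ge card_image_maps[of f] by (intro power_increasing) auto
    ultimately show ?thesis
      using K_ge by (intro mult_mono) auto
  qed
  finally show ?thesis by (simp add: scale_def mult_ac)
qed

lemma sum_subsets_le:
  assumes A: "finite A" "A \<noteq> {}"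
  shows "(\<Sum>R\<in>{R\<in>Pow A. card R \<le> k}. (1 / real (card A)) ^ card R) \<le> real k + 1"
proof -
  let ?S = "{R\<in>Pow A. card R \<le> k}"
  have "(\<Sum>R\<in>?S. (1 / real (card A)) ^ card R) = (\<Sum>j\<in>{..k}. \<Sum>R\<in>{R\<in>?S. card R = j}. (1 / real (card A)) ^ card R)"
    by (rule sum.group[symmetric]) (use A in auto)
  also have "\<dots> \<le> (\<Sum>j\<in>{..k}. 1)"
  proof (rule sum_mono)
    fix j assume "j \<in> {..k}"
    then have eq: "{R\<in>?S. card R = j} = {R. R \<subseteq> A \<and> card R = j}" by auto
    have "(\<Sum>R\<in>{R\<in>?S. card R = j}. (1 / real (card A)) ^ card R) = real (card A choose j) * (1 / real (card A)) ^ j"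
      unfolding eq using A by (simp add: n_subsets)
    also have "\<dots> \<le> real (card A) ^ j * (1 / real (card A)) ^ j"
    proof (intro mult_right_mono)
      show "real (card A choose j) \<le> real (card A) ^ j"
        using binomial_le_pow[of j "card A"] by (cases "j \<le> card A") (auto simp: binomial_eq_0 simp flip: of_nat_power)
    qed auto
    also have "\<dots> = 1" using A by (simp add: power_mult_distrib[symmetric] card_eq_0_iff)
    finally show "(\<Sum>R\<in>{R\<in>?S. card R = j}. (1 / real (card A)) ^ card R) \<le> 1" .
  qed
  finally show ?thesis by simp
qed

text \<open>
  Group the maps by the sets of rows and columns that they use.  The number of maps in a group is
  bounded in terms of \<open>s\<close>, and there are at most \<open>p^V n^b\<close> groups with \<open>V\<close> rows and \<open>b\<close> columns.
\<close>

lemma sum_scale_le: "(\<Sum>f\<in>maps. scale f) \<le> real (2 * s * (2 * s) * s) ^ s * ((2 * real s + 1) * (real s + 1))"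
proof -
  let ?key = "\<lambda>f. (rows_of (f ` {1..s}), slot_col ` f ` {1..s})"
  let ?R = "{R\<in>Pow {1..p}. card R \<le> 2 * s}" and ?T = "{T\<in>Pow {1..n}. card T \<le> s}"
  let ?N = "real (2 * s * (2 * s) * s) ^ s"
  have fin: "finite maps" by (intro finite_PiE) auto
  have key: "?key ` maps \<subseteq> ?R \<times> ?T"
  proof
    fix x assume "x \<in> ?key ` maps"
    then obtain f where f: "f \<in> maps" "x = ?key f" by auto
    have P: "finite (f ` {1..s})" "f ` {1..s} \<subseteq> slots p n" using image_maps[OF f(1)] by auto
    have "rows_of (f ` {1..s}) \<subseteq> {1..p}" using slot_rows_subset P unfolding rows_of_def by blast
    moreover have "slot_col ` f ` {1..s} \<subseteq> {1..n}" using slot_col_in P by blast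
    moreover have "card (rows_of (f ` {1..s})) \<le> 2 * s" using card_rows_le[OF P] card_image_maps[of f] by linarith
    moreover have "card (slot_col ` f ` {1..s}) \<le> s"
      using card_image_le[of "f ` {1..s}" slot_col] card_image_maps[of f] by simp
    ultimately show "x \<in> ?R \<times> ?T" using f by auto
  qed
  have "(\<Sum>f\<in>maps. scale f) = (\<Sum>RT\<in>?R \<times> ?T. \<Sum>f\<in>{f\<in>maps. ?key f = RT}. scale f)"
    by (rule sum.group[symmetric]) (use key fin in auto)
  also have "\<dots> \<le> (\<Sum>RT\<in>?R \<times> ?T. ?N * ((1 / real p) ^ card (fst RT) * (1 / real n) ^ card (snd RT)))"
  proof (rule sum_mono)
    fix RT assume "RT \<in> ?R \<times> ?T"
    then obtain R T where RT: "RT = (R, T)" "R \<subseteq> {1..p}" "card R \<le> 2 * s" "T \<subseteq> {1..n}" "card T \<le> s" by auto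
    have fRT: "finite R" "finite T" using RT finite_subset by blast+
    have "{f\<in>maps. ?key f = RT} \<subseteq> {1..s} \<rightarrow>\<^sub>E R \<times> R \<times> T"
    proof
      fix f assume f: "f \<in> {f\<in>maps. ?key f = RT}"
      show "f \<in> {1..s} \<rightarrow>\<^sub>E R \<times> R \<times> T"
      proof (rule PiE_I)
        fix k assume k: "k \<in> {1..s}"
        have "fst (f k) \<in> R" "fst (snd (f k)) \<in> R" "snd (snd (f k)) \<in> T"
          using f k by (auto simp: RT rows_of_def slot_rows_def slot_col_def)
        then show "f k \<in> R \<times> R \<times> T" by (auto simp: mem_Times_iff)
      qed (use f in \<open>auto simp: PiE_def extensional_def\<close>)
    qed
    then have "card {f\<in>maps. ?key f = RT} \<le> card ({1..s} \<rightarrow>\<^sub>E R \<times> R \<times> T)"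
      using fRT by (intro card_mono finite_PiE) auto
    also have "\<dots> = (card R * (card R * card T)) ^ s"
      using fRT by (simp add: card_PiE card_cartesian_product)
    also have "\<dots> \<le> (2 * s * (2 * s) * s) ^ s"
    proof (intro power_mono)
      have "card R * (card R * card T) \<le> (2 * s) * ((2 * s) * s)"
        using RT by (intro mult_le_mono) auto
      then show "card R * (card R * card T) \<le> 2 * s * (2 * s) * s" by (simp only: mult.assoc)
    qed simp
    finally have card_le: "real (card {f\<in>maps. ?key f = RT}) \<le> ?N"
      by (simp only: of_nat_power[symmetric] of_nat_le_iff)
    have "(\<Sum>f\<in>{f\<in>maps. ?key f = RT}. scale f) = (\<Sum>f\<in>{f\<in>maps. ?key f = RT}. (1 / real p) ^ card R * (1 / real n) ^ card T)"
      by (intro sum.cong) (auto simp: scale_def RT)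
    also have "\<dots> = real (card {f\<in>maps. ?key f = RT}) * ((1 / real p) ^ card R * (1 / real n) ^ card T)"
      by simp
    also have "\<dots> \<le> ?N * ((1 / real p) ^ card R * (1 / real n) ^ card T)"
      by (intro mult_right_mono card_le) auto
    finally show "(\<Sum>f\<in>{f\<in>maps. ?key f = RT}. scale f) \<le> ?N * ((1 / real p) ^ card (fst RT) * (1 / real n) ^ card (snd RT))"
      by (simp add: RT)
  qed
  also have "\<dots> = ?N * (\<Sum>RT\<in>?R \<times> ?T. (1 / real p) ^ card (fst RT) * (1 / real n) ^ card (snd RT))"
    by (simp only: sum_distrib_left)
  also have "\<dots> = ?N * ((\<Sum>R\<in>?R. (1 / real p) ^ card R) * (\<Sum>T\<in>?T. (1 / real n) ^ card T))"
    by (simp only: sum_product sum.cartesian_product case_prod_unfold)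
  also have "\<dots> \<le> ?N * ((real (2 * s) + 1) * (real s + 1))"
    using sum_subsets_le[of "{1..p}" "2 * s"] sum_subsets_le[of "{1..n}" s] p_pos n_pos
    by (intro mult_left_mono mult_mono sum_nonneg) auto
  finally show ?thesis by simp
qed

lemma weight_sum_approx:
  "\<bar>(\<Sum>f\<in>maps. weight f) - (\<Sum>f\<in>maps. pair_weight f)\<bar>
    \<le> K ^ (2 * s) * (real (2 * s * (2 * s) * s) ^ s * ((2 * real s + 1) * (real s + 1))) * (\<theta> + 1 / real p)"
proof -
  have sc: "0 \<le> scale f" for f by (simp add: scale_def)
  have "\<bar>(\<Sum>f\<in>maps. weight f) - (\<Sum>f\<in>maps. pair_weight f)\<bar> \<le> (\<Sum>f\<in>maps. \<bar>weight f - pair_weight f\<bar>)"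
    by (simp add: sum_subtractf[symmetric] sum_abs)
  also have "\<dots> \<le> (\<Sum>f\<in>maps. K ^ (2 * s) * (\<theta> + 1 / real p) * scale f)"
  proof (rule sum_mono)
    fix f assume f: "f \<in> maps"
    show "\<bar>weight f - pair_weight f\<bar> \<le> K ^ (2 * s) * (\<theta> + 1 / real p) * scale f"
    proof (cases "row_disjoint (f ` {1..s})")
      case True
      then show ?thesis using weight_row_disjoint[OF f True] K_ge sc theta by simp
    next
      case False
      have "\<bar>weight f - pair_weight f\<bar> \<le> \<bar>weight f\<bar> + \<bar>pair_weight f\<bar>" by (rule abs_triangle_ineq4)
      also have "\<dots> \<le> K ^ (2 * s) * scale f * \<theta> + K ^ (2 * s) * scale f * (1 / real p)"
        by (intro add_mono weight_bound pair_weight_bound f False)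
      finally show ?thesis by (simp add: algebra_simps)
    qed
  qed
  also have "\<dots> = K ^ (2 * s) * (\<theta> + 1 / real p) * (\<Sum>f\<in>maps. scale f)"
    by (simp add: sum_distrib_left)
  also have "\<dots> \<le> K ^ (2 * s) * (\<theta> + 1 / real p) * (real (2 * s * (2 * s) * s) ^ s * ((2 * real s + 1) * (real s + 1)))"
    using sum_scale_le K_ge theta by (intro mult_left_mono) auto
  finally show ?thesis by (simp only: mult_ac)
qed

end

section \<open>Generating function of the factorised weights\<close>

lemma sum_Pow_card:
  fixes h :: "nat \<Rightarrow> real"
  assumes "finite D"
  shows "(\<Sum>U\<in>Pow D. h (card U)) = (\<Sum>k\<le>card D. real (card D choose k) * h k)"
proof -
  have "(\<Sum>U\<in>Pow D. h (card U)) = (\<Sum>k\<in>{..card D}. \<Sum>U\<in>{U\<in>Pow D. card U = k}. h (card U))"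
    by (rule sum.group[symmetric]) (use assms in \<open>auto intro: card_mono\<close>)
  also have "\<dots> = (\<Sum>k\<le>card D. real (card D choose k) * h k)"
  proof (rule sum.cong[OF refl])
    fix k
    have "(\<Sum>U\<in>{U\<in>Pow D. card U = k}. h (card U)) = (\<Sum>U\<in>{U. U \<subseteq> D \<and> card U = k}. h k)"
      by (intro sum.cong) auto
    then show "(\<Sum>U\<in>{U\<in>Pow D. card U = k}. h (card U)) = real (card D choose k) * h k"
      using assms by (simp add: n_subsets)
  qed
  finally show ?thesis .
qed

text \<open>
  The exponential formula: choosing the fibre over one more element multiplies exponential generating
  functions.
\<close>

lemma sum_fibre_weights:
  fixes a :: "nat \<Rightarrow> real"
  assumes "finite G" "finite D" and a0: "a 0 = 1"
  shows "(\<Sum>f\<in>D \<rightarrow>\<^sub>E G. \<Prod>g\<in>G. a (card {k\<in>D. f k = g}))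
    = fact (card D) * fps_nth (Abs_fps (\<lambda>m. a m / fact m) ^ card G) (card D)"
  using assms(1,2)
proof (induction G arbitrary: D rule: finite_induct)
  case empty
  show ?case
  proof (cases "D = {}")
    case False
    then have "D \<rightarrow>\<^sub>E ({} :: 'a set) = {}" by (auto simp: PiE_eq_empty_iff)
    then show ?thesis using False empty by (simp add: card_gt_0_iff)
  qed simp
next
  case (insert g G)
  let ?A = "Abs_fps (\<lambda>m. a m / fact m)"
  let ?W = "\<lambda>D G f. \<Prod>g\<in>G. a (card {k\<in>D. f k = g})"
  have fin: "finite (D \<rightarrow>\<^sub>E insert g G)" using insert by (intro finite_PiE) auto
  have "(\<Sum>f\<in>D \<rightarrow>\<^sub>E insert g G. ?W D (insert g G) f)
      = (\<Sum>U\<in>Pow D. \<Sum>f\<in>{f \<in> D \<rightarrow>\<^sub>E insert g G. {k\<in>D. f k = g} = U}. ?W D (insert g G) f)"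
    by (rule sum.group[symmetric]) (use insert fin in auto)
  also have "\<dots> = (\<Sum>U\<in>Pow D. a (card U) * (fact (card D - card U) * fps_nth (?A ^ card G) (card D - card U)))"
  proof (rule sum.cong[OF refl])
    fix U assume U: "U \<in> Pow D"
    have fU: "finite U" using U insert finite_subset by auto
    have "(\<Sum>f\<in>{f \<in> D \<rightarrow>\<^sub>E insert g G. {k\<in>D. f k = g} = U}. ?W D (insert g G) f)
        = (\<Sum>f\<in>(D - U) \<rightarrow>\<^sub>E G. a (card U) * ?W (D - U) G f)"
    proof (rule sum.reindex_bij_witness[where i="\<lambda>f'. \<lambda>k\<in>D. if k \<in> U then g else f' k" and j="\<lambda>f. restrict f (D - U)"])
      fix f assume f: "f \<in> {f \<in> D \<rightarrow>\<^sub>E insert g G. {k\<in>D. f k = g} = U}"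
      then have fg: "\<And>k. k \<in> D \<Longrightarrow> f k = g \<longleftrightarrow> k \<in> U" by auto
      show "(\<lambda>k\<in>D. if k \<in> U then g else restrict f (D - U) k) = f"
        using f fg by (auto simp: fun_eq_iff PiE_def extensional_def)
      show "restrict f (D - U) \<in> (D - U) \<rightarrow>\<^sub>E G"
        using f fg by (auto simp: PiE_def Pi_def)
      have "?W D (insert g G) f = a (card U) * ?W D G f"
        using insert f by simp
      also have "?W D G f = ?W (D - U) G (restrict f (D - U))"
      proof (rule prod.cong[OF refl])
        fix h assume h: "h \<in> G"
        then have "h \<noteq> g" using insert by auto
        then have "{k\<in>D. f k = h} = {k \<in> D - U. restrict f (D - U) k = h}" using fg by auto
        then show "a (card {k\<in>D. f k = h}) = a (card {k \<in> D - U. restrict f (D - U) k = h})" by simp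
      qed
      finally show "a (card U) * ?W (D - U) G (restrict f (D - U)) = ?W D (insert g G) f" by simp
    next
      fix f' assume f': "f' \<in> (D - U) \<rightarrow>\<^sub>E G"
      then have ng: "\<And>k. k \<in> D - U \<Longrightarrow> f' k \<in> G \<and> f' k \<noteq> g" using insert by (auto simp: PiE_def Pi_def)
      show "restrict (\<lambda>k\<in>D. if k \<in> U then g else f' k) (D - U) = f'"
        using f' by (auto simp: fun_eq_iff PiE_def extensional_def)
      show "(\<lambda>k\<in>D. if k \<in> U then g else f' k) \<in> {f \<in> D \<rightarrow>\<^sub>E insert g G. {k\<in>D. f k = g} = U}"
        using U ng by (auto simp: split: if_splits)
    qed
    also have "\<dots> = a (card U) * (\<Sum>f\<in>(D - U) \<rightarrow>\<^sub>E G. ?W (D - U) G f)"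
      by (simp only: sum_distrib_left)
    also have "\<dots> = a (card U) * (fact (card (D - U)) * fps_nth (?A ^ card G) (card (D - U)))"
      using insert.IH[of "D - U"] insert.prems by simp
    also have "card (D - U) = card D - card U"
      using U fU by (intro card_Diff_subset) auto
    finally show "(\<Sum>f\<in>{f \<in> D \<rightarrow>\<^sub>E insert g G. {k\<in>D. f k = g} = U}. ?W D (insert g G) f)
        = a (card U) * (fact (card D - card U) * fps_nth (?A ^ card G) (card D - card U))" .
  qed
  also have "\<dots> = (\<Sum>k\<le>card D. real (card D choose k) * (a k * (fact (card D - k) * fps_nth (?A ^ card G) (card D - k))))"
    using insert.prems by (rule sum_Pow_card)
  also have "\<dots> = (\<Sum>k\<le>card D. fact (card D) * ((a k / fact k) * fps_nth (?A ^ card G) (card D - k)))"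
  proof (rule sum.cong[OF refl])
    fix k assume "k \<in> {..card D}"
    then have "real (card D choose k) = fact (card D) / (fact k * fact (card D - k))"
      by (simp add: binomial_fact)
    then show "real (card D choose k) * (a k * (fact (card D - k) * fps_nth (?A ^ card G) (card D - k)))
       = fact (card D) * ((a k / fact k) * fps_nth (?A ^ card G) (card D - k))"
      by simp
  qed
  also have "\<dots> = fact (card D) * fps_nth (?A * ?A ^ card G) (card D)"
    by (simp add: fps_mult_nth sum_distrib_left atMost_atLeast0)
  finally show ?case using insert by simp
qed

lemma fps_power_nth_tuples_ge2:
  fixes B :: "real fps"
  assumes B: "fps_nth B 0 = 0" "fps_nth B 1 = 0"
  shows "fps_nth (B ^ v) s = (\<Sum>m\<in>tuples_ge2 v s. \<Prod>l=1..v. fps_nth B (m l))"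
proof (induction v arbitrary: s)
  case 0
  show ?case
  proof (cases "s = 0")
    case True
    have "tuples_ge2 0 0 = {\<lambda>_. undefined}" by (auto simp: tuples_ge2_def)
    then show ?thesis using True by simp
  next
    case False
    then have "tuples_ge2 0 s = {}" by (auto simp: tuples_ge2_def)
    then show ?thesis using False by simp
  qed
next
  case (Suc v)
  have low: "fps_nth B i = 0" if "i < 2" for i using that B by (cases i) auto
  have "fps_nth (B ^ Suc v) s = (\<Sum>i=0..s. fps_nth (B ^ v) i * fps_nth B (s - i))"
    by (simp add: power_Suc2 fps_mult_nth del: power_Suc)
  also have "\<dots> = (\<Sum>i\<in>{i. i + 2 \<le> s}. fps_nth (B ^ v) i * fps_nth B (s - i))"
    by (rule sum.mono_neutral_right) (use low in auto)
  also have "\<dots> = (\<Sum>i\<in>{i. i + 2 \<le> s}. \<Sum>m\<in>tuples_ge2 v i. (\<Prod>l=1..v. fps_nth B (m l)) * fps_nth B (s - i))"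
    by (simp only: Suc.IH sum_distrib_right)
  also have "\<dots> = (\<Sum>(i, m)\<in>(SIGMA i:{i. i + 2 \<le> s}. tuples_ge2 v i). (\<Prod>l=1..v. fps_nth B (m l)) * fps_nth B (s - i))"
  proof (rule sum.Sigma)
    show "finite {i. i + 2 \<le> s}" by (rule finite_subset[of _ "{..s}"]) auto
  qed (simp add: finite_tuples_ge2)
  also have "\<dots> = (\<Sum>m\<in>tuples_ge2 (Suc v) s. \<Prod>l=1..Suc v. fps_nth B (m l))"
  proof (rule sum.reindex_bij_witness[where j="\<lambda>(i, m). m(Suc v := s - i)" and i="\<lambda>m. (s - m (Suc v), restrict m {1..v})"])
    fix x assume x: "x \<in> (SIGMA i:{i. i + 2 \<le> s}. tuples_ge2 v i)"
    obtain i m where im: "x = (i, m)" by (cases x)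
    from x im have i: "i + 2 \<le> s" and m: "m \<in> {1..v} \<rightarrow>\<^sub>E {2..}" "(\<Sum>l=1..v. m l) = i"
      by (auto simp: tuples_ge2_def)
    have "restrict (m(Suc v := s - i)) {1..v} = m"
      using m(1) by (auto simp: fun_eq_iff PiE_def extensional_def)
    then show "(\<lambda>m. (s - m (Suc v), restrict m {1..v})) ((\<lambda>(i, m). m(Suc v := s - i)) x) = x"
      using i by (simp add: im)
    show "(\<lambda>(i, m). m(Suc v := s - i)) x \<in> tuples_ge2 (Suc v) s"
      using i m by (auto simp: im tuples_ge2_def PiE_def extensional_def Pi_def)
    show "(\<Prod>l=1..Suc v. fps_nth B ((\<lambda>(i, m). m(Suc v := s - i)) x l)) = (\<lambda>(i, m). (\<Prod>l=1..v. fps_nth B (m l)) * fps_nth B (s - i)) x"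
      by (simp add: im)
  next
    fix m assume m: "m \<in> tuples_ge2 (Suc v) s"
    then have m1: "m \<in> {1..Suc v} \<rightarrow>\<^sub>E {2..}" "(\<Sum>l=1..v. m l) + m (Suc v) = s" by (auto simp: tuples_ge2_def)
    then have m2: "m (Suc v) \<ge> 2" "m (Suc v) \<le> s" by (auto simp: PiE_def Pi_def)
    show "(\<lambda>(i, m). m(Suc v := s - i)) (s - m (Suc v), restrict m {1..v}) = m"
      using m1 m2 by (auto simp: fun_eq_iff PiE_def extensional_def)
    show "(s - m (Suc v), restrict m {1..v}) \<in> (SIGMA i:{i. i + 2 \<le> s}. tuples_ge2 v i)"
      using m1 m2 by (auto simp: tuples_ge2_def PiE_def Pi_def)
  qed
  finally show ?case .
qed

lemma tuples_ge2_empty: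
  assumes "s < 2 * v"
  shows "tuples_ge2 v s = {}"
proof -
  have False if m: "m \<in> tuples_ge2 v s" for m
  proof -
    have "(\<Sum>l=1..v. 2) \<le> (\<Sum>l=1..v. m l)"
      using m by (intro sum_mono) (auto simp: tuples_ge2_def PiE_def Pi_def)
    then show False using m assms by (simp add: tuples_ge2_def)
  qed
  then show ?thesis by blast
qed

text \<open>
  Split off the constant term one.  What remains starts in degree two, so at most \<open>s div 2\<close> factors of it
  can contribute to degree \<open>s\<close>.
\<close>

lemma fps_power_nth_choose:
  fixes a :: "nat \<Rightarrow> real"
  assumes a: "a 0 = 1" "a 1 = 0" and s: "s \<ge> 1"
  shows "fps_nth (Abs_fps a ^ N) s = (\<Sum>v=1..s div 2. real (N choose v) * (\<Sum>m\<in>tuples_ge2 v s. \<Prod>l=1..v. a (m l)))"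
proof -
  define B where "B = Abs_fps a - 1"
  have B: "fps_nth B 0 = 0" "fps_nth B 1 = 0" using a by (auto simp: B_def)
  have Ba: "fps_nth B k = a k" if "k \<ge> 2" for k using that by (simp add: B_def)
  have coeff: "fps_nth (B ^ v) s = (\<Sum>m\<in>tuples_ge2 v s. \<Prod>l=1..v. a (m l))" for v
    unfolding fps_power_nth_tuples_ge2[OF B]
  proof (intro sum.cong prod.cong refl)
    fix m l assume "m \<in> tuples_ge2 v s" "l \<in> {1..v}"
    then have "m l \<ge> 2" by (auto simp: tuples_ge2_def PiE_def Pi_def)
    then show "fps_nth B (m l) = a (m l)" by (rule Ba)
  qed
  let ?t = "\<lambda>v. real (N choose v) * (\<Sum>m\<in>tuples_ge2 v s. \<Prod>l=1..v. a (m l))"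
  have "Abs_fps a = B + 1" by (simp add: B_def)
  then have "fps_nth (Abs_fps a ^ N) s = fps_nth (\<Sum>v\<le>N. of_nat (N choose v) * B ^ v * 1 ^ (N - v)) s"
    by (simp only: binomial_ring)
  also have "\<dots> = (\<Sum>v\<le>N. fps_nth (fps_const (real (N choose v)) * B ^ v) s)"
    by (simp add: fps_sum_nth fps_of_nat)
  also have "\<dots> = (\<Sum>v\<le>N. ?t v)"
    by (simp add: coeff)
  also have "\<dots> = (\<Sum>v\<in>{1..s div 2} \<inter> {..N}. ?t v)"
  proof (rule sum.mono_neutral_right)
    show "\<forall>v\<in>{..N} - {1..s div 2} \<inter> {..N}. ?t v = 0"
    proof
      fix v assume v: "v \<in> {..N} - {1..s div 2} \<inter> {..N}"
      have "tuples_ge2 v s = {}"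
      proof (cases "v = 0")
        case True
        then show ?thesis using s by (auto simp: tuples_ge2_def)
      next
        case False
        then show ?thesis using v by (intro tuples_ge2_empty) auto
      qed
      then show "?t v = 0" by simp
    qed
  qed auto
  also have "\<dots> = (\<Sum>v=1..s div 2. ?t v)"
    by (rule sum.mono_neutral_left) (auto simp: binomial_eq_0)
  finally show ?thesis .
qed

lemma choose_over_power_limit: "(\<lambda>n. real (n choose k) / real n ^ k) \<longlonglongrightarrow> 1 / fact k"
proof (induction k)
  case (Suc k)
  have "(\<lambda>n. (real n - real k) / real n) \<longlonglongrightarrow> 1"
    by real_asymp
  then have "(\<lambda>n. (real n - real k) / real n / real (Suc k)) \<longlonglongrightarrow> 1 / real (Suc k)"
    by (intro tendsto_divide tendsto_const) auto
  from tendsto_mult[OF Suc this]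
  have "(\<lambda>n. real (n choose k) / real n ^ k * ((real n - real k) / real n / real (Suc k))) \<longlonglongrightarrow> 1 / fact (Suc k)"
    by (simp add: mult.commute)
  then show ?case
  proof (rule Lim_transform_eventually)
    show "\<forall>\<^sub>F n in sequentially. real (n choose k) / real n ^ k * ((real n - real k) / real n / real (Suc k)) = real (n choose Suc k) / real n ^ Suc k"
    proof (rule always_eventually, rule allI)
      fix n
      have "real n * real (n choose k) = real k * real (n choose k) + real (Suc k) * real (n choose Suc k)"
        using gbinomial_mult_1[of "real n" k] by (simp only: binomial_gbinomial)
      then have "real (Suc k) * real (n choose Suc k) = real (n choose k) * (real n - real k)"
        by (simp add: algebra_simps)
      then have eq: "real (n choose Suc k) = real (n choose k) * (real n - real k) / real (Suc k)"
        by (simp add: field_simps del: of_nat_Suc)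
      then show "real (n choose k) / real n ^ k * ((real n - real k) / real n / real (Suc k)) = real (n choose Suc k) / real n ^ Suc k"
        unfolding eq by (simp add: mult_ac del: of_nat_Suc)
    qed
  qed
qed simp

text \<open>
  Each of the \<open>v\<close> factors absorbs one factor \<open>N\<close> of \<open>N choose v \<sim> N^v / v!\<close>.
\<close>

lemma fibre_weight_limit:
  fixes a :: "nat \<Rightarrow> nat \<Rightarrow> real" and N :: "nat \<Rightarrow> nat"
  assumes N: "filterlim N at_top sequentially"
    and a: "\<forall>\<^sub>F n in sequentially. a n 0 = 1" "\<forall>\<^sub>F n in sequentially. a n 1 = 0"
    and lim: "\<And>m. m \<ge> 2 \<Longrightarrow> (\<lambda>n. real (N n) * a n m) \<longlonglongrightarrow> w m" and s: "s \<ge> 1"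
  shows "(\<lambda>n. fps_nth (Abs_fps (\<lambda>m. a n m / fact m) ^ N n) s)
    \<longlonglongrightarrow> (\<Sum>v=1..s div 2. 1 / fact v * (\<Sum>m\<in>tuples_ge2 v s. \<Prod>l=1..v. w (m l) / fact (m l)))"
proof -
  have "(\<lambda>n. \<Sum>v=1..s div 2. real (N n choose v) / real (N n) ^ v * (\<Sum>m\<in>tuples_ge2 v s. \<Prod>l=1..v. real (N n) * a n (m l) / fact (m l)))
    \<longlonglongrightarrow> (\<Sum>v=1..s div 2. 1 / fact v * (\<Sum>m\<in>tuples_ge2 v s. \<Prod>l=1..v. w (m l) / fact (m l)))"
  proof -
    have c: "(\<lambda>n. real (N n choose v) / real (N n) ^ v) \<longlonglongrightarrow> 1 / fact v" for v
      by (rule filterlim_compose[OF choose_over_power_limit N])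
    have "(\<lambda>n. real (N n) * a n (m l) / fact (m l)) \<longlonglongrightarrow> w (m l) / fact (m l)"
      if "m \<in> tuples_ge2 v s" "l \<in> {1..v}" for m l v
    proof -
      have "2 \<le> m l" using that by (auto simp: tuples_ge2_def PiE_def Pi_def)
      then show ?thesis by (intro tendsto_divide lim tendsto_const) auto
    qed
    then show ?thesis
      by (intro tendsto_sum tendsto_mult[OF c] tendsto_prod)
  qed
  then show ?thesis
  proof (rule Lim_transform_eventually)
    have "\<forall>\<^sub>F n in sequentially. N n \<ge> 1" using N by (simp add: filterlim_at_top)
    with a show "\<forall>\<^sub>F n in sequentially. (\<Sum>v=1..s div 2. real (N n choose v) / real (N n) ^ v * (\<Sum>m\<in>tuples_ge2 v s. \<Prod>l=1..v. real (N n) * a n (m l) / fact (m l)))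
        = fps_nth (Abs_fps (\<lambda>m. a n m / fact m) ^ N n) s"
    proof eventually_elim
      case (elim n)
      have "fps_nth (Abs_fps (\<lambda>m. a n m / fact m) ^ N n) s
          = (\<Sum>v=1..s div 2. real (N n choose v) * (\<Sum>m\<in>tuples_ge2 v s. \<Prod>l=1..v. a n (m l) / fact (m l)))"
        by (rule fps_power_nth_choose) (use elim s in auto)
      also have "\<dots> = (\<Sum>v=1..s div 2. real (N n choose v) / real (N n) ^ v * (\<Sum>m\<in>tuples_ge2 v s. \<Prod>l=1..v. real (N n) * a n (m l) / fact (m l)))"
      proof (rule sum.cong[OF refl])
        fix v
        have "(\<Prod>l=1..v. real (N n) * a n (m l) / fact (m l)) = real (N n) ^ v * (\<Prod>l=1..v. a n (m l) / fact (m l))" for m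
        proof -
          have "(\<Prod>l=1..v. real (N n) * a n (m l) / fact (m l)) = (\<Prod>l=1..v. real (N n) * (a n (m l) / fact (m l)))"
            by simp
          also have "\<dots> = real (N n) ^ v * (\<Prod>l=1..v. a n (m l) / fact (m l))"
            by (simp only: prod.distrib prod_constant card_atLeastAtMost) simp
          finally show ?thesis .
        qed
        then show "real (N n choose v) * (\<Sum>m\<in>tuples_ge2 v s. \<Prod>l=1..v. a n (m l) / fact (m l))
            = real (N n choose v) / real (N n) ^ v * (\<Sum>m\<in>tuples_ge2 v s. \<Prod>l=1..v. real (N n) * a n (m l) / fact (m l))"
          using elim by (simp add: sum_distrib_left[symmetric])
      qed
      finally show ?case by simp
    qed
  qed
qed

lemma M_lim_eq:
  "M_lim c \<alpha> s = 2 ^ s * (fact s * (\<Sum>v=1..s div 2. 1 / fact v *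
     (\<Sum>m\<in>tuples_ge2 v s. \<Prod>l=1..v. (c\<^sup>2 / 2 * (c_coeff (m l) \<alpha>)\<^sup>2) / fact (m l))))"
proof -
  have "c ^ (2 * v) * (2 ^ (s - v) / fact v) * (\<Sum>m\<in>tuples_ge2 v s. fact s / (\<Prod>l=1..v. fact (m l)) * (\<Prod>l=1..v. (c_coeff (m l) \<alpha>)\<^sup>2))
      = 2 ^ s * (fact s * (1 / fact v * (\<Sum>m\<in>tuples_ge2 v s. \<Prod>l=1..v. (c\<^sup>2 / 2 * (c_coeff (m l) \<alpha>)\<^sup>2) / fact (m l))))"
    if v: "v \<in> {1..s div 2}" for v
  proof -
    have "(\<Prod>l=1..v. (c\<^sup>2 / 2 * (c_coeff (m l) \<alpha>)\<^sup>2) / fact (m l)) = c ^ (2 * v) / 2 ^ v * ((\<Prod>l=1..v. (c_coeff (m l) \<alpha>)\<^sup>2) / (\<Prod>l=1..v. fact (m l)))" for m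
      by (simp add: prod_dividef prod.distrib power_mult power_divide)
    moreover have "(2::real) ^ (s - v) = 2 ^ s / 2 ^ v" using v by (intro power_diff) auto
    ultimately show ?thesis
      by (simp add: sum_distrib_left mult_ac)
  qed
  then have "M_lim c \<alpha> s = (\<Sum>v=1..s div 2. 2 ^ s * (fact s * (1 / fact v *
      (\<Sum>m\<in>tuples_ge2 v s. \<Prod>l=1..v. (c\<^sup>2 / 2 * (c_coeff (m l) \<alpha>)\<^sup>2) / fact (m l)))))"
    unfolding M_lim_def by (rule sum.cong[OF refl])
  then show ?thesis
    by (simp only: sum_distrib_left)
qed

section \<open>Expansion of the moments of the statistic\<close>

definition row_monomial :: "nat \<Rightarrow> (nat \<Rightarrow> nat) \<Rightarrow> (nat \<Rightarrow> real) \<Rightarrow> real" where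
  "row_monomial n \<beta> x = (\<Prod>t=1..n. (share n x t - 1 / real n) ^ \<beta> t)"

lemma row_monomial_cong:
  assumes "\<And>t. t \<in> {1..n} \<Longrightarrow> x t = y t"
  shows "row_monomial n \<beta> x = row_monomial n \<beta> y"
proof -
  have "(\<Sum>k=1..n. (x k)\<^sup>2) = (\<Sum>k=1..n. (y k)\<^sup>2)" using assms by (intro sum.cong) auto
  then show ?thesis using assms by (auto simp: row_monomial_def share_def intro!: prod.cong)
qed

lemma abs_row_monomial_le: "n \<ge> 1 \<Longrightarrow> \<bar>row_monomial n \<beta> x\<bar> \<le> 1"
proof -
  assume n: "n \<ge> 1"
  have "\<bar>row_monomial n \<beta> x\<bar> \<le> (\<Prod>t=1..n. 1)"
    unfolding row_monomial_def abs_prod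
  proof (intro prod_mono conjI abs_ge_zero)
    fix t assume t: "t \<in> {1..n}"
    have "0 \<le> 1 / real n" "1 / real n \<le> 1" using n by auto
    then have "\<bar>share n x t - 1 / real n\<bar> \<le> 1"
      using share_bounds[OF t, of x] unfolding abs_le_iff by linarith
    then show "\<bar>(share n x t - 1 / real n) ^ \<beta> t\<bar> \<le> 1" by (simp add: power_abs power_le_one)
  qed
  then show ?thesis by simp
qed

lemma measurable_row_monomial:
  assumes "\<And>t. t \<in> {1..n} \<Longrightarrow> (\<lambda>\<omega>. f \<omega> t) \<in> borel_measurable M"
  shows "(\<lambda>\<omega>. row_monomial n \<beta> (f \<omega>)) \<in> borel_measurable M"
  unfolding row_monomial_def share_def
  using assms by (intro borel_measurable_prod borel_measurable_power borel_measurable_diff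
      borel_measurable_divide borel_measurable_sum borel_measurable_const) auto

lemma Y_square: "(Y n x i j)\<^sup>2 = share n (x i) j"
  by (simp add: Y_def share_def power_divide sum_nonneg)

text \<open>
  The two orders of a pair of distinct rows give the same term.
\<close>

lemma T1_eq_slots:
  "T1 p n x = 2 * (\<Sum>g\<in>slots p n. \<Prod>i\<in>slot_rows g. share n (x i) (slot_col g) - 1 / real n)"
proof -
  let ?z = "\<lambda>i t. share n (x i) t - 1 / real n"
  let ?w = "\<lambda>i j. \<Sum>t=1..n. ?z i t * ?z j t"
  let ?L = "SIGMA j:{1..p}. {1..<j}"
  have "T1 p n x = (\<Sum>(i1, i2)\<in>{(i1, i2). i1 \<in> {1..p} \<and> i2 \<in> {1..p} \<and> i1 \<noteq> i2}. ?w i1 i2)"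
    by (simp add: T1_def Y_square)
  also have "{(i1, i2). i1 \<in> {1..p} \<and> i2 \<in> {1..p} \<and> i1 \<noteq> i2} = ?L \<union> prod.swap ` ?L"
    by force
  also have "(\<Sum>(i1, i2)\<in>?L \<union> prod.swap ` ?L. ?w i1 i2) = (\<Sum>(i1, i2)\<in>?L. ?w i1 i2) + (\<Sum>(i1, i2)\<in>prod.swap ` ?L. ?w i1 i2)"
    by (rule sum.union_disjoint) auto
  also have "(\<Sum>(i1, i2)\<in>prod.swap ` ?L. ?w i1 i2) = (\<Sum>(i1, i2)\<in>?L. ?w i2 i1)"
    by (subst sum.reindex) (auto simp: case_prod_unfold)
  also have "\<dots> = (\<Sum>(i1, i2)\<in>?L. ?w i1 i2)"
    by (simp add: mult.commute)
  also have "(\<Sum>(i1, i2)\<in>?L. ?w i1 i2) = (\<Sum>g\<in>slots p n. ?z (fst g) (slot_col g) * ?z (fst (snd g)) (slot_col g))"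
  proof -
    have "(\<Sum>(i1, i2)\<in>?L. ?w i1 i2) = (\<Sum>j\<in>{1..p}. \<Sum>i\<in>{1..<j}. ?w j i)"
      by (rule sum.Sigma[symmetric]) auto
    also have "\<dots> = (\<Sum>j\<in>{1..p}. \<Sum>(i, t)\<in>{1..<j} \<times> {1..n}. ?z j t * ?z i t)"
      by (simp only: sum.cartesian_product)
    also have "\<dots> = (\<Sum>(j, it)\<in>slots p n. case it of (i, t) \<Rightarrow> ?z j t * ?z i t)"
      unfolding slots_def by (rule sum.Sigma) auto
    finally show ?thesis by (simp add: case_prod_unfold slot_col_def)
  qed
  also have "\<dots> = (\<Sum>g\<in>slots p n. \<Prod>i\<in>slot_rows g. ?z i (slot_col g))"
  proof (rule sum.cong[OF refl])
    fix g assume g: "g \<in> slots p n"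
    then have "fst g \<noteq> fst (snd g)" by (auto simp: slots_def)
    then show "?z (fst g) (slot_col g) * ?z (fst (snd g)) (slot_col g) = (\<Prod>i\<in>slot_rows g. ?z i (slot_col g))"
      by (simp add: slot_rows_def)
  qed
  finally show ?thesis by simp
qed

text \<open>
  Multiply out the power and collect the factors belonging to the same row and column.
\<close>

lemma T1_power_eq:
  "T1 p n x ^ s = 2 ^ s * (\<Sum>f\<in>{1..s} \<rightarrow>\<^sub>E slots p n. \<Prod>i=1..p. row_monomial n (incidence_count s f i) (x i))"
proof -
  let ?c = "\<lambda>f k i t. if i \<in> slot_rows (f k) \<and> slot_col (f k) = t then 1 else 0"
  let ?z = "\<lambda>i t. share n (x i) t - 1 / real n"
  have "(\<Sum>g\<in>slots p n. \<Prod>i\<in>slot_rows g. ?z i (slot_col g)) ^ s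
      = (\<Prod>k\<in>{1..s}. \<Sum>g\<in>slots p n. \<Prod>i\<in>slot_rows g. ?z i (slot_col g))"
    by simp
  also have "\<dots> = (\<Sum>f\<in>{1..s} \<rightarrow>\<^sub>E slots p n. \<Prod>k\<in>{1..s}. \<Prod>i\<in>slot_rows (f k). ?z i (slot_col (f k)))"
    by (rule prod_sum_PiE) auto
  also have "\<dots> = (\<Sum>f\<in>{1..s} \<rightarrow>\<^sub>E slots p n. \<Prod>i=1..p. row_monomial n (incidence_count s f i) (x i))"
  proof (rule sum.cong[OF refl])
    fix f assume f: "f \<in> {1..s} \<rightarrow>\<^sub>E slots p n"
    have "(\<Prod>k\<in>{1..s}. \<Prod>i\<in>slot_rows (f k). ?z i (slot_col (f k)))
        = (\<Prod>k\<in>{1..s}. \<Prod>i\<in>{1..p}. \<Prod>t\<in>{1..n}. ?z i t ^ ?c f k i t)"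
    proof (rule prod.cong[OF refl])
      fix k assume k: "k \<in> {1..s}"
      then have fk: "f k \<in> slots p n" using f by auto
      have inner: "(\<Prod>t\<in>{1..n}. ?z i t ^ ?c f k i t)
          = (if i \<in> slot_rows (f k) then ?z i (slot_col (f k)) else 1)" for i
      proof (cases "i \<in> slot_rows (f k)")
        case True
        have "(\<Prod>t\<in>{1..n}. ?z i t ^ ?c f k i t)
            = (\<Prod>t\<in>{1..n}. if t = slot_col (f k) then ?z i t else 1)"
          using True by (intro prod.cong) auto
        then show ?thesis using True slot_col_in[OF fk] by (simp add: prod.delta)
      qed simp
      have "(\<Prod>i\<in>slot_rows (f k). ?z i (slot_col (f k))) = (\<Prod>i\<in>{1..p}. if i \<in> slot_rows (f k) then ?z i (slot_col (f k)) else 1)"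
        using slot_rows_subset[OF fk] by (intro prod.mono_neutral_cong_left) auto
      then show "(\<Prod>i\<in>slot_rows (f k). ?z i (slot_col (f k)))
          = (\<Prod>i\<in>{1..p}. \<Prod>t\<in>{1..n}. ?z i t ^ ?c f k i t)"
        by (simp only: inner)
    qed
    also have "\<dots> = (\<Prod>i\<in>{1..p}. \<Prod>k\<in>{1..s}. \<Prod>t\<in>{1..n}. ?z i t ^ ?c f k i t)"
      by (rule prod.swap)
    also have "\<dots> = (\<Prod>i\<in>{1..p}. \<Prod>t\<in>{1..n}. \<Prod>k\<in>{1..s}. ?z i t ^ ?c f k i t)"
      by (intro prod.cong refl prod.swap)
    also have "\<dots> = (\<Prod>i=1..p. row_monomial n (incidence_count s f i) (x i))"
    proof -
      have "(\<Prod>k\<in>{1..s}. ?z i t ^ ?c f k i t) = ?z i t ^ incidence_count s f i t" for i t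
      proof -
        have "(\<Sum>k\<in>{1..s}. if i \<in> slot_rows (f k) \<and> slot_col (f k) = t then 1 else 0) = incidence_count s f i t"
          unfolding incidence_count_def by (simp add: sum.If_cases Int_def)
        then show ?thesis by (simp only: power_sum[symmetric])
      qed
      then show ?thesis by (simp only: row_monomial_def)
    qed
    finally show "(\<Prod>k\<in>{1..s}. \<Prod>i\<in>slot_rows (f k). ?z i (slot_col (f k))) = (\<Prod>i=1..p. row_monomial n (incidence_count s f i) (x i))" .
  qed
  finally show ?thesis by (simp only: T1_eq_slots power_mult_distrib)
qed

context entry_law
begin

lemma row_moment_eq: "row_moment n \<beta> = (\<integral>x. row_monomial n \<beta> x \<partial>row_law n)"
  by (simp add: row_moment_def share_moment_def row_monomial_def)

text \<open>
  The rows are independent, and each of them has the product law.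
\<close>

lemma expectation_row_monomials:
  fixes X :: "nat \<Rightarrow> nat \<Rightarrow> 'c \<Rightarrow> real"
  assumes M: "prob_space M" and n: "n \<ge> 1"
    and ind: "prob_space.indep_vars M (\<lambda>_. borel) (\<lambda>(i, j). X i j) ({1..p} \<times> {1..n})"
    and law: "\<And>i j. i \<in> {1..p} \<Longrightarrow> j \<in> {1..n} \<Longrightarrow> distr M borel (X i j) = \<mu>"
  shows "(\<integral>\<omega>. (\<Prod>i=1..p. row_monomial n (\<beta> i) (\<lambda>j. X i j \<omega>)) \<partial>M) = (\<Prod>i=1..p. row_moment n (\<beta> i))"
    and "integrable M (\<lambda>\<omega>. \<Prod>i=1..p. row_monomial n (\<beta> i) (\<lambda>j. X i j \<omega>))"
proof -
  let ?m = "\<lambda>i \<omega>. row_monomial n (\<beta> i) (\<lambda>t. X i t \<omega>)"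
  interpret M: prob_space M by (rule M)
  let ?K = "\<lambda>i::nat. {i} \<times> {1..n}"
  let ?XX = "\<lambda>(i, j). X i j"
  have rv: "X i j \<in> borel_measurable M" if "i \<in> {1..p}" "j \<in> {1..n}" for i j
    using ind that unfolding M.indep_vars_def by auto
  have ind_rows: "M.indep_vars (\<lambda>i. PiM (?K i) (\<lambda>_. borel)) (\<lambda>i \<omega>. restrict (\<lambda>k. ?XX k \<omega>) (?K i)) {1..p}"
    by (rule M.indep_vars_restrict[OF ind]) (auto simp: disjoint_family_on_def)
  have "M.indep_vars (\<lambda>_. borel) (\<lambda>i \<omega>. row_monomial n (\<beta> i) (\<lambda>t. restrict (\<lambda>k. ?XX k \<omega>) (?K i) (i, t))) {1..p}"
    by (rule M.indep_vars_compose2[OF ind_rows, where Y="\<lambda>i y. row_monomial n (\<beta> i) (\<lambda>t. y (i, t))"])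
       (auto intro!: measurable_row_monomial measurable_component_singleton)
  moreover have rm: "row_monomial n (\<beta> i) (\<lambda>t. restrict (\<lambda>k. ?XX k \<omega>) (?K i) (i, t)) = ?m i \<omega>" for i \<omega>
    by (rule row_monomial_cong) auto
  ultimately have ind2: "M.indep_vars (\<lambda>_. borel) (\<lambda>i \<omega>. ?m i \<omega>) {1..p}"
    by simp
  have int: "integrable M (\<lambda>\<omega>. ?m i \<omega>)" if "i \<in> {1..p}" for i
    using abs_row_monomial_le[OF n] rv that
    by (intro M.integrable_const_bound[where B=1] measurable_row_monomial) auto
  have row: "(\<integral>\<omega>. ?m i \<omega> \<partial>M) = row_moment n (\<beta> i)" if i: "i \<in> {1..p}" for i
  proof -
    let ?h = "\<lambda>y. row_monomial n (\<beta> i) (\<lambda>t. y (i, t))"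
    have sub: "M.indep_vars (\<lambda>_. borel) ?XX (?K i)"
      by (rule M.indep_vars_subset[OF ind]) (use i in auto)
    have "distr M (PiM (?K i) (\<lambda>_. borel)) (\<lambda>\<omega>. \<lambda>k\<in>?K i. ?XX k \<omega>) = PiM (?K i) (\<lambda>k. distr M borel (?XX k))"
    proof (rule iffD1[OF M.indep_vars_iff_distr_eq_PiM' sub])
      show "?K i \<noteq> {}" using n by auto
      fix k assume "k \<in> ?K i"
      then show "?XX k \<in> borel_measurable M" using rv i by auto
    qed
    also have "\<dots> = PiM (?K i) (\<lambda>_. \<mu>)"
      using law i by (intro PiM_cong) auto
    finally have d: "distr M (PiM (?K i) (\<lambda>_. borel)) (\<lambda>\<omega>. \<lambda>k\<in>?K i. ?XX k \<omega>) = PiM (?K i) (\<lambda>_. \<mu>)" .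
    have h: "?h \<in> borel_measurable (PiM (?K i) (\<lambda>_. borel))"
      by (intro measurable_row_monomial measurable_component_singleton) auto
    have "(\<integral>\<omega>. ?m i \<omega> \<partial>M) = (\<integral>\<omega>. ?h (\<lambda>k\<in>?K i. ?XX k \<omega>) \<partial>M)"
      by (simp only: rm)
    also have "\<dots> = (\<integral>y. ?h y \<partial>distr M (PiM (?K i) (\<lambda>_. borel)) (\<lambda>\<omega>. \<lambda>k\<in>?K i. ?XX k \<omega>))"
      by (rule integral_distr[OF _ h, symmetric], rule measurable_restrict) (use rv i in auto)
    also have "\<dots> = (\<integral>y. ?h y \<partial>PiM (?K i) (\<lambda>_. \<mu>))" by (simp only: d)
    also have "\<dots> = (\<integral>y. row_monomial n (\<beta> i) (\<lambda>t\<in>{1..n}. y (i, t)) \<partial>PiM (?K i) (\<lambda>_. \<mu>))"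
      by (intro Bochner_Integration.integral_cong refl row_monomial_cong) auto
    also have "\<dots> = (\<integral>x. row_monomial n (\<beta> i) x \<partial>distr (PiM (?K i) (\<lambda>_. \<mu>)) (row_law n) (\<lambda>y. \<lambda>t\<in>{1..n}. y (i, t)))"
    proof (rule integral_distr[symmetric])
      show "(\<lambda>y. \<lambda>t\<in>{1..n}. y (i, t)) \<in> measurable (PiM (?K i) (\<lambda>_. \<mu>)) (row_law n)"
        unfolding row_law_def by (rule measurable_restrict, rule measurable_component_singleton) auto
      show "row_monomial n (\<beta> i) \<in> borel_measurable (row_law n)"
        by (rule measurable_row_monomial) (rule measurable_component_row)
    qed
    also have "distr (PiM (?K i) (\<lambda>_. \<mu>)) (row_law n) (\<lambda>y. \<lambda>t\<in>{1..n}. y (i, t)) = row_law n"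
      unfolding row_law_def
      by (rule distr_PiM_reindex[where f="Pair i" and M="\<lambda>_. \<mu>"]) (auto simp: inj_on_def prob_space_axioms)
    finally show ?thesis by (simp add: row_moment_eq)
  qed
  show "integrable M (\<lambda>\<omega>. \<Prod>i=1..p. ?m i \<omega>)"
    by (rule M.indep_vars_integrable[OF _ ind2 int]) auto
  have "(\<integral>\<omega>. (\<Prod>i=1..p. ?m i \<omega>) \<partial>M) = (\<Prod>i=1..p. \<integral>\<omega>. ?m i \<omega> \<partial>M)"
    by (rule M.indep_vars_lebesgue_integral[OF _ ind2 int]) auto
  also have "\<dots> = (\<Prod>i=1..p. row_moment n (\<beta> i))"
    by (rule prod.cong[OF refl]) (rule row)
  finally show "(\<integral>\<omega>. (\<Prod>i=1..p. ?m i \<omega>) \<partial>M) = (\<Prod>i=1..p. row_moment n (\<beta> i))" .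
qed

lemma expectation_T1_power:
  fixes X :: "nat \<Rightarrow> nat \<Rightarrow> 'c \<Rightarrow> real"
  assumes M: "prob_space M" and n: "n \<ge> 1"
    and ind: "prob_space.indep_vars M (\<lambda>_. borel) (\<lambda>(i, j). X i j) ({1..p} \<times> {1..n})"
    and law: "\<And>i j. i \<in> {1..p} \<Longrightarrow> j \<in> {1..n} \<Longrightarrow> distr M borel (X i j) = \<mu>"
  shows "(\<integral>\<omega>. T1 p n (\<lambda>i j. X i j \<omega>) ^ s \<partial>M)
    = 2 ^ s * (\<Sum>f\<in>{1..s} \<rightarrow>\<^sub>E slots p n. \<Prod>i=1..p. row_moment n (incidence_count s f i))"
proof -
  have "(\<integral>\<omega>. T1 p n (\<lambda>i j. X i j \<omega>) ^ s \<partial>M)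
      = 2 ^ s * (\<integral>\<omega>. (\<Sum>f\<in>{1..s} \<rightarrow>\<^sub>E slots p n. \<Prod>i=1..p. row_monomial n (incidence_count s f i) (\<lambda>j. X i j \<omega>)) \<partial>M)"
    unfolding T1_power_eq by (rule integral_mult_right_zero)
  also have "(\<integral>\<omega>. (\<Sum>f\<in>{1..s} \<rightarrow>\<^sub>E slots p n. \<Prod>i=1..p. row_monomial n (incidence_count s f i) (\<lambda>j. X i j \<omega>)) \<partial>M)
      = (\<Sum>f\<in>{1..s} \<rightarrow>\<^sub>E slots p n. \<integral>\<omega>. (\<Prod>i=1..p. row_monomial n (incidence_count s f i) (\<lambda>j. X i j \<omega>)) \<partial>M)"
    by (rule Bochner_Integration.integral_sum) (rule expectation_row_monomials[OF M n ind law])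
  also have "\<dots> = (\<Sum>f\<in>{1..s} \<rightarrow>\<^sub>E slots p n. \<Prod>i=1..p. row_moment n (incidence_count s f i))"
    by (simp only: expectation_row_monomials[OF M n ind law])
  finally show ?thesis .
qed

end

section \<open>The limit\<close>

context entry_law
begin

text \<open>
  The bound on mixed moments with \<open>E Z\<^sup>2 \<le> B / (p sqrt n)\<close> inserted.
\<close>

lemma slot_weights_row_moment:
  assumes n: "n \<ge> 1" "2 * s \<le> n" and p: "p \<ge> 1" and B: "B \<ge> 0" "real p * sqrt (real n) * centered_moment n 2 \<le> B"
    and K: "1 \<le> K" "real s * 4 ^ s * B \<le> K"
  shows "slot_weights p n s (row_moment n) (centered_moment n) K"
proof
  show "row_moment n (\<lambda>_. 0) = 1" by (rule row_moment_zero) auto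
  show "row_moment n (\<lambda>u. if u = t then m else 0) = centered_moment n m" if "t \<in> {1..n}" for t m
    using row_moment_single[OF that, of "\<lambda>u. if u = t then m else 0"] by simp
  fix S \<beta> assume S: "S \<subseteq> {1..n}" "S \<noteq> {}" "card S \<le> s"
    and \<beta>: "\<And>t. t \<in> S \<Longrightarrow> 1 \<le> (\<beta> t :: nat)" "\<And>t. t \<notin> S \<Longrightarrow> \<beta> t = 0"
  let ?r = "card S" and ?\<theta> = "1 / sqrt (real n)"
  have "finite S" using S finite_subset by blast
  then have r: "?r \<ge> 1" using S by (simp add: Suc_le_eq card_gt_0_iff)
  have \<theta>: "?\<theta>\<^sup>2 = 1 / real n" "?\<theta> > 0" using n by (auto simp: power_divide)
  have v: "centered_moment n 2 \<le> B * (1 / real p * ?\<theta>)"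
    using B p n by (simp add: field_simps)
  have "\<bar>row_moment n \<beta>\<bar> \<le> real ?r * (4 / real n) ^ (?r - 1) * centered_moment n 2"
    using S n \<beta> by (intro row_moment_bound) auto
  also have "\<dots> \<le> real ?r * (4 / real n) ^ (?r - 1) * (B * (1 / real p * ?\<theta>))"
    using v by (intro mult_left_mono) auto
  also have "(4 / real n) ^ (?r - 1) = 4 ^ (?r - 1) * (?\<theta>\<^sup>2) ^ (?r - 1)"
    unfolding \<theta> by (simp add: power_divide)
  also have "real ?r * (4 ^ (?r - 1) * (?\<theta>\<^sup>2) ^ (?r - 1)) * (B * (1 / real p * ?\<theta>))
      = (real ?r * 4 ^ (?r - 1) * B) * (1 / real p * (?\<theta> ^ (2 * (?r - 1)) * ?\<theta>))"
    by (simp only: power_mult mult_ac)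
  also have "?\<theta> ^ (2 * (?r - 1)) * ?\<theta> = ?\<theta> ^ (2 * ?r - 1)"
  proof -
    have "2 * ?r - 1 = Suc (2 * (?r - 1))" using r by simp
    then show ?thesis by (simp only: power_Suc2)
  qed
  also have "(real ?r * 4 ^ (?r - 1) * B) * (1 / real p * ?\<theta> ^ (2 * ?r - 1)) \<le> K * (1 / real p * ?\<theta> ^ (2 * ?r - 1))"
  proof (rule mult_right_mono)
    have "real ?r * 4 ^ (?r - 1) * B \<le> real s * 4 ^ s * B"
      using S B by (intro mult_right_mono mult_mono power_increasing) auto
    then show "real ?r * 4 ^ (?r - 1) * B \<le> K" using K by simp
  qed (use \<theta> in auto)
  finally show "\<bar>row_moment n \<beta>\<bar> \<le> K / real p * ?\<theta> ^ (2 * ?r - 1)" by simp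
qed (use n p K in auto)

text \<open>
  The number of slots times \<open>q\<^sup>2\<close> tends to \<open>c\<^sup>2/2\<close>, so the number of slots times \<open>(E Z^m)\<^sup>2\<close> tends to
  \<open>c\<^sup>2/2\<close> times the square of the limiting coefficient.  The halves combine with the factor \<open>2^s\<close> to the \<open>2^(s-v)\<close> in the limit.  The bound \<open>q \<le> 1/n\<close> forces \<open>p\<close> to grow at least like
  \<open>sqrt n\<close>.
\<close>

lemma slot_sum_limit:
  fixes p :: "nat \<Rightarrow> nat" and q :: "nat \<Rightarrow> real"
  assumes pq: "(\<lambda>n. real (p n) * q n * sqrt (real n)) \<longlonglongrightarrow> c"
    and c: "c > 0" and q: "\<forall>\<^sub>F n in sequentially. 0 < q n \<and> q n \<le> 1 / real n"
    and cm: "\<And>m. m \<ge> 2 \<Longrightarrow> (\<lambda>n. centered_moment n m / q n) \<longlonglongrightarrow> c_coeff m \<alpha>" and s: "s \<ge> 1"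
  shows "(\<lambda>n. 2 ^ s * (\<Sum>f\<in>{1..s} \<rightarrow>\<^sub>E slots (p n) n. \<Prod>i=1..p n. row_moment n (incidence_count s f i)))
    \<longlonglongrightarrow> M_lim c \<alpha> s"
proof -
  let ?a = "\<lambda>n m. (centered_moment n m)\<^sup>2"
  let ?N = "\<lambda>n. card (slots (p n) n)"
  let ?W = "\<lambda>n. \<Sum>f\<in>{1..s} \<rightarrow>\<^sub>E slots (p n) n. \<Prod>i=1..p n. row_moment n (incidence_count s f i)"
  let ?V = "\<lambda>n. fact s * fps_nth (Abs_fps (\<lambda>m. ?a n m / fact m) ^ ?N n) s"
  have "filterlim (\<lambda>n. c / 2 * sqrt (real n)) at_top sequentially" using c by real_asymp
  then have "filterlim (\<lambda>n. real (p n)) at_top sequentially"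
  proof (rule filterlim_at_top_mono)
    have "\<forall>\<^sub>F n in sequentially. c / 2 < real (p n) * q n * sqrt (real n)"
      by (rule order_tendstoD(1)[OF pq]) (use c in simp)
    with q eventually_gt_at_top[of 0] show "\<forall>\<^sub>F n in sequentially. c / 2 * sqrt (real n) \<le> real (p n)"
    proof eventually_elim
      case (elim n)
      have "real (p n) * q n * sqrt (real n) \<le> real (p n) * (1 / real n) * sqrt (real n)"
        using elim by (intro mult_right_mono mult_left_mono) auto
      then have "c / 2 \<le> real (p n) * (1 / real n) * sqrt (real n)" using elim by linarith
      then have "c / 2 * sqrt (real n) \<le> real (p n) * (1 / real n) * sqrt (real n) * sqrt (real n)"
        by (intro mult_right_mono) auto
      also have "\<dots> = real (p n)" using elim by (simp only: mult.assoc real_sqrt_mult_self) simp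
      finally show ?case .
    qed
  qed
  then have p: "filterlim p at_top sequentially"
    by (simp add: filterlim_sequentially_iff_filterlim_real)
  have p1: "\<forall>\<^sub>F n in sequentially. p n \<ge> 2" using p by (simp add: filterlim_at_top)
  have ip: "(\<lambda>n. 1 / real (p n)) \<longlonglongrightarrow> 0"
    using filterlim_compose[OF filterlim_real_sequentially p]
    by (intro tendsto_divide_0[OF tendsto_const] filterlim_at_top_imp_at_infinity)
  have Nq: "(\<lambda>n. real (?N n) * (q n)\<^sup>2) \<longlonglongrightarrow> c\<^sup>2 / 2"
  proof -
    have "(\<lambda>n. (real (p n) * q n * sqrt (real n))\<^sup>2 * (1 - 1 / real (p n)) / 2) \<longlonglongrightarrow> c\<^sup>2 * (1 - 0) / 2"
      by (intro tendsto_intros pq ip) auto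
    then have "(\<lambda>n. (real (p n) * q n * sqrt (real n))\<^sup>2 * (1 - 1 / real (p n)) / 2) \<longlonglongrightarrow> c\<^sup>2 / 2" by simp
    then show ?thesis
    proof (rule Lim_transform_eventually)
      show "\<forall>\<^sub>F n in sequentially. (real (p n) * q n * sqrt (real n))\<^sup>2 * (1 - 1 / real (p n)) / 2 = real (?N n) * (q n)\<^sup>2"
        using p1
      proof eventually_elim
        case (elim n)
        have "(real (p n) * q n * sqrt (real n))\<^sup>2 * (1 - 1 / real (p n)) / 2
            = ((real (p n) * real (p n) - real (p n)) * real n) * (q n)\<^sup>2 / 2"
          using elim by (simp add: power_mult_distrib power2_eq_square field_simps)
        also have "\<dots> = real (?N n) * (q n)\<^sup>2"
          by (simp only: card_slots[symmetric])
        finally show ?case .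
      qed
    qed
  qed
  have Ninf: "filterlim ?N at_top sequentially"
  proof (rule filterlim_at_top_mono[OF filterlim_ident[of sequentially]])
    show "\<forall>\<^sub>F n in sequentially. n \<le> ?N n"
      using p1
    proof eventually_elim
      case (elim n)
      have "real (p n) * 2 \<le> real (p n) * real (p n)" using elim by (intro mult_left_mono) auto
      then have "2 \<le> real (p n) * real (p n) - real (p n)" using elim by linarith
      then have "2 * real n \<le> (real (p n) * real (p n) - real (p n)) * real n" by (intro mult_right_mono) auto
      then have "2 * real n \<le> 2 * real (?N n)" by (simp only: card_slots)
      then show ?case by simp
    qed
  qed
  have Vlim: "?V \<longlonglongrightarrow> fact s * (\<Sum>v=1..s div 2. 1 / fact v *
     (\<Sum>m\<in>tuples_ge2 v s. \<Prod>l=1..v. (c\<^sup>2 / 2 * (c_coeff (m l) \<alpha>)\<^sup>2) / fact (m l)))"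
  proof (intro tendsto_mult_left fibre_weight_limit Ninf s)
    show "\<forall>\<^sub>F n in sequentially. (centered_moment n 0)\<^sup>2 = 1" by (simp add: centered_moment_0)
    show "\<forall>\<^sub>F n in sequentially. (centered_moment n 1)\<^sup>2 = 0"
      using eventually_ge_at_top[of 1] by eventually_elim (simp only: centered_moment_1, simp)
    fix m :: nat assume m: "m \<ge> 2"
    have "(\<lambda>n. real (?N n) * (q n)\<^sup>2 * (centered_moment n m / q n)\<^sup>2) \<longlonglongrightarrow> c\<^sup>2 / 2 * (c_coeff m \<alpha>)\<^sup>2"
      by (intro tendsto_mult Nq tendsto_power cm m)
    then show "(\<lambda>n. real (?N n) * (centered_moment n m)\<^sup>2) \<longlonglongrightarrow> c\<^sup>2 / 2 * (c_coeff m \<alpha>)\<^sup>2"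
    proof (rule Lim_transform_eventually)
      show "\<forall>\<^sub>F n in sequentially. real (?N n) * (q n)\<^sup>2 * (centered_moment n m / q n)\<^sup>2 = real (?N n) * (centered_moment n m)\<^sup>2"
        using q by eventually_elim (simp add: power_divide)
    qed
  qed
  \<comment> \<open>a number above the limit of \<open>p sqrt n E Z\<^sup>2\<close>\<close>
  define B where "B = \<bar>c * c_coeff 2 \<alpha>\<bar> + 1"
  have "(\<lambda>n. real (p n) * q n * sqrt (real n) * (centered_moment n 2 / q n)) \<longlonglongrightarrow> c * c_coeff 2 \<alpha>"
    by (intro tendsto_mult pq cm) auto
  then have "\<forall>\<^sub>F n in sequentially. real (p n) * q n * sqrt (real n) * (centered_moment n 2 / q n) < B"
    by (rule order_tendstoD) (simp add: B_def abs_less_iff[symmetric] less_eq_real_def)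
  with q have Bev: "\<forall>\<^sub>F n in sequentially. real (p n) * sqrt (real n) * centered_moment n 2 \<le> B"
    by eventually_elim (auto simp: field_simps)
  define K where "K = max 1 (real s * 4 ^ s * B)"
  define C where "C = K ^ (2 * s) * (real (2 * s * (2 * s) * s) ^ s * ((2 * real s + 1) * (real s + 1)))"
  have diff: "(\<lambda>n. ?W n - ?V n) \<longlonglongrightarrow> 0"
  proof (rule Lim_null_comparison)
    have sq: "(\<lambda>n. 1 / sqrt (real n)) \<longlonglongrightarrow> 0" by real_asymp
    have "(\<lambda>n. C * (1 / sqrt (real n) + 1 / real (p n))) \<longlonglongrightarrow> C * (0 + 0)"
      by (intro tendsto_mult_left tendsto_add sq ip)
    then show "(\<lambda>n. C * (1 / sqrt (real n) + 1 / real (p n))) \<longlonglongrightarrow> 0" by simp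
    show "\<forall>\<^sub>F n in sequentially. norm (?W n - ?V n) \<le> C * (1 / sqrt (real n) + 1 / real (p n))"
      using Bev p1 eventually_ge_at_top[of "2 * s"] eventually_ge_at_top[of 1]
    proof eventually_elim
      case (elim n)
      interpret slot_weights "p n" n s "row_moment n" "centered_moment n" K
        by (rule slot_weights_row_moment[of n s "p n" B]) (use elim in \<open>auto simp: K_def B_def\<close>)
      have W: "?W n = (\<Sum>f\<in>maps. weight f)"
        by (simp add: weight_def)
      have "(\<Sum>f\<in>maps. pair_weight f) = fact (card {1..s}) * fps_nth (Abs_fps (\<lambda>m. ?a n m / fact m) ^ ?N n) (card {1..s})"
        unfolding pair_weight_def by (rule sum_fibre_weights) (auto simp: centered_moment_0)
      then have V: "?V n = (\<Sum>f\<in>maps. pair_weight f)" by simp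
      show ?case
        unfolding W V real_norm_def C_def by (rule weight_sum_approx)
    qed
  qed
  have "(\<lambda>n. 2 ^ s * ((?W n - ?V n) + ?V n)) \<longlonglongrightarrow> 2 ^ s * (0 + fact s * (\<Sum>v=1..s div 2. 1 / fact v *
     (\<Sum>m\<in>tuples_ge2 v s. \<Prod>l=1..v. (c\<^sup>2 / 2 * (c_coeff (m l) \<alpha>)\<^sup>2) / fact (m l))))"
    by (intro tendsto_mult_left tendsto_add diff Vlim)
  then show ?thesis by (simp add: M_lim_eq)
qed

end

lemma (in regular_entry_law) centered_moment_limit_heavy:
  assumes "a < 1" "m \<ge> 2"
  shows "(\<lambda>n. centered_moment n m / (1 / real n)) \<longlonglongrightarrow> c_coeff m (2 * a)"
proof (rule centered_moment_limit[OF _ _ assms(2)])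
  show "(\<lambda>n. 1 / (real n)\<^sup>2 / (1 / real n)) \<longlonglongrightarrow> 0" by real_asymp
  fix k :: nat assume k: "k \<ge> 2"
  have "(\<lambda>n. real n * even_moment n k) \<longlonglongrightarrow> Gamma (real k - a) / (Gamma (1 - a) * fact (k - 1))"
    using assms k by (intro even_moment_heavy) auto
  moreover have "Gamma (real k) = fact (k - 1)"
    using Gamma_fact[of "k - 1", where 'a=real] k by (simp add: of_nat_diff)
  ultimately show "(\<lambda>n. even_moment n k / (1 / real n)) \<longlonglongrightarrow> c_coeff k (2 * a)"
    using assms by (simp add: c_coeff_def mult.commute)
qed

context unit_variance_entry_law
begin

lemma tail_le: "x > 0 \<Longrightarrow> tail x \<le> 1 / x"
proof -
  assume x: "x > 0"
  have "tail x \<le> measure \<mu> {y \<in> space \<mu>. x \<le> y\<^sup>2}"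
    unfolding tail_def by (intro finite_measure_mono) auto
  also have "\<dots> \<le> (\<integral>y. y\<^sup>2 \<partial>\<mu>) / x"
    by (rule integral_Markov_inequality_measure[where A="{}"]) (use x square_integrable in auto)
  finally show ?thesis by (simp add: unit_variance)
qed

text \<open>
  The terms of order \<open>1 / n\<^sup>2\<close> are negligible against the tail because \<open>a < 2\<close>.
\<close>

lemma centered_moment_limit_light:
  assumes "a < 2" "m \<ge> 2"
  shows "(\<lambda>n. centered_moment n m / tail (real n)) \<longlonglongrightarrow> c_coeff m (2 * a)"
proof (rule centered_moment_limit[OF _ _ assms(2)])
  define \<epsilon> where "\<epsilon> = min a (2 - a) / 2"
  have \<epsilon>: "0 < \<epsilon>" "\<epsilon> < a" "a + \<epsilon> < 2" using a_pos assms by (auto simp: \<epsilon>_def min_def field_simps)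
  obtain d x0 where d: "d > 0" "x0 \<ge> 1" "\<And>x. x \<ge> x0 \<Longrightarrow> d * x powr (- a - \<epsilon>) \<le> tail x"
    using tail_lower[OF \<epsilon>(1,2)] by metis
  have e2: "a + \<epsilon> - 2 < 0" using \<epsilon> by simp
  have "(\<lambda>n. real n powr (a + \<epsilon> - 2)) \<longlonglongrightarrow> 0"
    using e2 by real_asymp
  then have lim0: "(\<lambda>n. 1 / d * real n powr (a + \<epsilon> - 2)) \<longlonglongrightarrow> 0" by (rule tendsto_mult_right_zero)
  show "(\<lambda>n. 1 / (real n)\<^sup>2 / tail (real n)) \<longlonglongrightarrow> 0"
  proof (rule Lim_null_comparison[OF _ lim0])
    have "\<forall>\<^sub>F n in sequentially. real n \<ge> x0" by real_asymp
    then show "\<forall>\<^sub>F n in sequentially. norm (1 / (real n)\<^sup>2 / tail (real n)) \<le> 1 / d * real n powr (a + \<epsilon> - 2)"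
    proof eventually_elim
      case (elim n)
      have np: "real n > 0" using elim d by simp
      have dp: "0 < d * real n powr (- a - \<epsilon>)" using d np by simp
      have tp: "0 < tail (real n)" using dp d(3)[OF elim] by linarith
      have "1 / (real n)\<^sup>2 / tail (real n) \<le> 1 / (real n)\<^sup>2 / (d * real n powr (- a - \<epsilon>))"
        using dp tp d(3)[OF elim] by (intro divide_left_mono mult_pos_pos[OF tp dp]) auto
      also have "\<dots> = 1 / d * (real n powr (a + \<epsilon>) / real n powr 2)"
        using np by (simp add: powr_minus powr_diff powr_add field_simps)
      also have "\<dots> = 1 / d * real n powr (a + \<epsilon> - 2)" by (simp only: powr_diff)
      finally show ?case using tail_bounds by simp
    qed
  qed
  fix k :: nat assume k: "k \<ge> 2"
  have "(\<lambda>n. even_moment n k / tail (real n)) \<longlonglongrightarrow> a * Gamma a * Gamma (real k - a) / fact (k - 1)"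
    using assms k by (intro even_moment_light) auto
  moreover have "Gamma (real k) = fact (k - 1)"
    using Gamma_fact[of "k - 1", where 'a=real] k by (simp add: of_nat_diff)
  moreover have "Gamma (1 + a) = a * Gamma a"
    using Gamma_plus1[of a] a_pos by (auto simp: add.commute nonpos_Ints_def)
  ultimately show "(\<lambda>n. even_moment n k / tail (real n)) \<longlonglongrightarrow> c_coeff k (2 * a)"
    using a_gt_1 by (simp add: c_coeff_def)
qed

end

theorem theorem3p4:
  fixes N :: "'b measure" and X11 :: "'b \<Rightarrow> real"
    and M :: "nat \<Rightarrow> 'a measure" and X :: "nat \<Rightarrow> nat \<Rightarrow> nat \<Rightarrow> 'a \<Rightarrow> real"
    and p :: "nat \<Rightarrow> nat" and \<alpha> c\<delta> :: real and L :: "real \<Rightarrow> real" and s :: nat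
  assumes "prob_space N"
    and "X11 \<in> borel_measurable N"
    and "nondegenerate_rv N X11"
    and "symmetric_rv N X11"
    and "\<P>(\<omega> in N. X11 \<omega> = 0) = 0"
    and "\<And>n. prob_space (M n)"
    and "\<And>n. iid_copies (M n) (p n) n (X n) N X11"
    and "\<alpha> \<in> {0<..<3} - {2}"
    and "slowly_varying L"
    and "\<And>x. x > 0 \<Longrightarrow> \<P>(\<omega> in N. \<bar>X11 \<omega>\<bar> > x) = x powr (- \<alpha>) * L x"
    and "\<alpha> > 2 \<Longrightarrow> prob_space.expectation N (\<lambda>\<omega>. (X11 \<omega>)\<^sup>2) = 1"
    and "c\<delta> > 0"
    and "\<alpha> < 2 \<Longrightarrow> (\<lambda>n. real (p n)) \<sim>[at_top] (\<lambda>n. c\<delta> * real n powr (1 / 2))"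
    and "\<alpha> > 2 \<Longrightarrow> (\<lambda>n. real (p n)) \<sim>[at_top]
           (\<lambda>n. c\<delta> * (real n powr ((\<alpha> - 1) / 2) / L (real n powr (1 / 2))))"
    and "s \<ge> 1"
  shows "(\<lambda>n. prob_space.expectation (M n) (\<lambda>\<omega>. T1 (p n) n (\<lambda>i j. X n i j \<omega>) ^ s))
           \<longlonglongrightarrow> M_lim c\<delta> \<alpha> s"
proof -
  interpret N: prob_space N by (rule assms(1))
  note [measurable] = assms(2)
  define \<mu> where "\<mu> = distr N borel X11"
  interpret E: entry_law \<mu>
  proof -
    have "AE \<omega> in N. X11 \<omega> \<noteq> 0"
    proof (rule AE_I')
      show "{\<omega>\<in>space N. X11 \<omega> = 0} \<in> null_sets N"
        using assms(5) by (intro null_setsI) (auto simp: N.emeasure_eq_measure)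
    qed auto
    then have "AE x in \<mu>. x \<noteq> 0"
      unfolding \<mu>_def by (subst AE_distr_iff) auto
    then show "entry_law \<mu>"
      unfolding entry_law_def entry_law_axioms_def \<mu>_def by (simp add: N.prob_space_distr)
  qed
  define a where "a = \<alpha> / 2"
  have a: "0 < a" "a < 3 / 2" "\<alpha> = 2 * a" "a \<noteq> 1" using assms(8) by (auto simp: a_def)
  have Lpos: "\<forall>\<^sub>F x in at_top. 0 < L x"
    using assms(9) unfolding slowly_varying_def by (meson eventually_at_top_linorderI)
  have Llim: "((\<lambda>x. L (d * x) / L x) \<longlongrightarrow> 1) at_top" if "d > 0" for d
    using assms(9) that unfolding slowly_varying_def by blast
  have sqrt_top: "filterlim sqrt at_top at_top" by (rule sqrt_at_top)
  have tail: "E.tail x = x powr (- a) * L (sqrt x)" if x: "x > 0" for x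
  proof -
    have "E.tail x = N.prob {\<omega> \<in> space N. x < (X11 \<omega>)\<^sup>2}"
      unfolding E.tail_def unfolding \<mu>_def by (subst measure_distr) (auto intro!: arg_cong[where f="measure N"])
    also have "{\<omega> \<in> space N. x < (X11 \<omega>)\<^sup>2} = {\<omega> \<in> space N. \<bar>X11 \<omega>\<bar> > sqrt x}"
    proof -
      have "x < y\<^sup>2 \<longleftrightarrow> sqrt x < \<bar>y\<bar>" for y
        using x by (metis real_sqrt_abs real_sqrt_less_iff)
      then show ?thesis by simp
    qed
    also have "N.prob \<dots> = sqrt x powr (- \<alpha>) * L (sqrt x)"
      using assms(10)[of "sqrt x"] x by simp
    also have "sqrt x powr (- \<alpha>) = x powr (- a)"
      using x by (simp add: powr_half_sqrt[symmetric] powr_powr a)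
    finally show ?thesis .
  qed
  \<comment> \<open>squaring the entry halves the index\<close>
  interpret R: regular_entry_law \<mu> a
  proof
    show "0 < a" by (rule a)
    have "\<forall>\<^sub>F x in at_top. 0 < L (sqrt x)"
      by (rule eventually_compose_filterlim[OF Lpos sqrt_top])
    with eventually_gt_at_top[of 0] show "\<forall>\<^sub>F x in at_top. 0 < E.tail x"
      by eventually_elim (simp add: tail)
    fix d :: real assume d: "d > 0"
    have "((\<lambda>x. d powr (- a) * (L (sqrt d * sqrt x) / L (sqrt x))) \<longlongrightarrow> d powr (- a) * 1) at_top"
      by (intro tendsto_mult_left filterlim_compose[OF Llim sqrt_top]) (use d in simp)
    then have "((\<lambda>x. d powr (- a) * (L (sqrt d * sqrt x) / L (sqrt x))) \<longlongrightarrow> d powr (- a)) at_top" by simp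
    then show "((\<lambda>x. E.tail (d * x) / E.tail x) \<longlongrightarrow> d powr (- a)) at_top"
    proof (rule Lim_transform_eventually)
      show "\<forall>\<^sub>F x in at_top. d powr (- a) * (L (sqrt d * sqrt x) / L (sqrt x)) = E.tail (d * x) / E.tail x"
        using eventually_gt_at_top[of 0]
      proof eventually_elim
        case (elim x)
        then show ?case using d by (simp add: tail powr_mult real_sqrt_mult)
      qed
    qed
  qed
  have lim: "(\<lambda>n. 2 ^ s * (\<Sum>f\<in>{1..s} \<rightarrow>\<^sub>E slots (p n) n. \<Prod>i=1..p n. E.row_moment n (incidence_count s f i)))
    \<longlonglongrightarrow> M_lim c\<delta> \<alpha> s"
  proof (cases "a < 1")
    case True
    have "((\<lambda>n. real (p n) / (c\<delta> * real n powr (1 / 2))) \<longlonglongrightarrow> 1)"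
      using assms(13) True a assms(12) by (intro asymp_equivD_strong) (auto intro!: eventually_mono[OF eventually_gt_at_top[of 0]])
    from tendsto_mult_left[OF this, of c\<delta>] have "(\<lambda>n. c\<delta> * (real (p n) / (c\<delta> * real n powr (1 / 2)))) \<longlonglongrightarrow> c\<delta>" by simp
    then have pq: "(\<lambda>n. real (p n) * (1 / real n) * sqrt (real n)) \<longlonglongrightarrow> c\<delta>"
    proof (rule Lim_transform_eventually)
      show "\<forall>\<^sub>F n in sequentially. c\<delta> * (real (p n) / (c\<delta> * real n powr (1 / 2))) = real (p n) * (1 / real n) * sqrt (real n)"
        using eventually_gt_at_top[of 0]
      proof eventually_elim
        case (elim n)
        then show ?case using assms(12) real_div_sqrt[of "real n"] by (simp add: powr_half_sqrt field_simps)
      qed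
    qed
    show ?thesis
    proof (rule E.slot_sum_limit[OF pq assms(12) _ _ assms(15)])
      show "\<forall>\<^sub>F n in sequentially. 0 < 1 / real n \<and> 1 / real n \<le> 1 / real n"
        using eventually_gt_at_top[of 0] by eventually_elim simp
      show "(\<lambda>n. E.centered_moment n m / (1 / real n)) \<longlonglongrightarrow> c_coeff m \<alpha>" if "m \<ge> 2" for m
        using R.centered_moment_limit_heavy[OF True that] a by simp
    qed
  next
    case False
    then have a1: "a > 1" using a by simp
    then have \<alpha>2: "\<alpha> > 2" using a by simp
    have sq: "N.expectation (\<lambda>\<omega>. (X11 \<omega>)\<^sup>2) = 1" by (rule assms(11)[OF \<alpha>2])
    then have sqi: "integrable N (\<lambda>\<omega>. (X11 \<omega>)\<^sup>2)"
      using not_integrable_integral_eq by fastforce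
    interpret U: unit_variance_entry_law \<mu> a
    proof
      show "integrable \<mu> (\<lambda>x. x\<^sup>2)" unfolding \<mu>_def using sqi by (subst integrable_distr_eq) auto
      show "(\<integral>x. x\<^sup>2 \<partial>\<mu>) = 1" unfolding \<mu>_def using sq by (subst integral_distr) auto
    qed (rule a1)
    have Lsq: "\<forall>\<^sub>F n in sequentially. 0 < L (sqrt (real n))"
      by (rule eventually_compose_filterlim[OF Lpos filterlim_compose[OF sqrt_top filterlim_real_sequentially]])
    let ?g = "\<lambda>n. c\<delta> * (real n powr ((\<alpha> - 1) / 2) / L (real n powr (1 / 2)))"
    have "(\<lambda>n. real (p n) / ?g n) \<longlonglongrightarrow> 1"
    proof (rule asymp_equivD_strong[OF assms(14)[OF \<alpha>2]])
      show "\<forall>\<^sub>F n in sequentially. real (p n) \<noteq> 0 \<or> ?g n \<noteq> 0"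
        using Lsq eventually_gt_at_top[of 0]
        by eventually_elim (use assms(12) in \<open>simp add: powr_half_sqrt\<close>)
    qed
    from tendsto_mult_left[OF this, of c\<delta>] have "(\<lambda>n. c\<delta> * (real (p n) / ?g n)) \<longlonglongrightarrow> c\<delta>" by simp
    then have pq: "(\<lambda>n. real (p n) * E.tail (real n) * sqrt (real n)) \<longlonglongrightarrow> c\<delta>"
    proof (rule Lim_transform_eventually)
      show "\<forall>\<^sub>F n in sequentially. c\<delta> * (real (p n) / ?g n) = real (p n) * E.tail (real n) * sqrt (real n)"
        using Lsq eventually_gt_at_top[of 0]
      proof eventually_elim
        case (elim n)
        have e: "(\<alpha> - 1) / 2 = a - 1 / 2" by (simp add: a_def diff_divide_distrib)
        have "real n powr (a - 1 / 2) = real n powr a / sqrt (real n)"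
          by (simp add: powr_diff powr_half_sqrt)
        then show ?case unfolding e
          using elim assms(12) by (simp add: tail powr_half_sqrt powr_minus field_simps)
      qed
    qed
    show ?thesis
    proof (rule E.slot_sum_limit[OF pq assms(12) _ _ assms(15)])
      have "\<forall>\<^sub>F n in sequentially. 0 < E.tail (real n)"
        by (rule eventually_compose_filterlim[OF R.tail_pos filterlim_real_sequentially])
      with eventually_gt_at_top[of 0] show "\<forall>\<^sub>F n in sequentially. 0 < E.tail (real n) \<and> E.tail (real n) \<le> 1 / real n"
        by eventually_elim (simp add: U.tail_le)
      show "(\<lambda>n. E.centered_moment n m / E.tail (real n)) \<longlonglongrightarrow> c_coeff m \<alpha>" if "m \<ge> 2" for m
        using U.centered_moment_limit_light[OF _ that] a by simp
    qed
  qed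
  show ?thesis
    using lim
  proof (rule Lim_transform_eventually)
    show "\<forall>\<^sub>F n in sequentially. 2 ^ s * (\<Sum>f\<in>{1..s} \<rightarrow>\<^sub>E slots (p n) n. \<Prod>i=1..p n. E.row_moment n (incidence_count s f i))
        = prob_space.expectation (M n) (\<lambda>\<omega>. T1 (p n) n (\<lambda>i j. X n i j \<omega>) ^ s)"
      using eventually_ge_at_top[of 1]
    proof eventually_elim
      case (elim n)
      have "(\<integral>\<omega>. T1 (p n) n (\<lambda>i j. X n i j \<omega>) ^ s \<partial>M n)
          = 2 ^ s * (\<Sum>f\<in>{1..s} \<rightarrow>\<^sub>E slots (p n) n. \<Prod>i=1..p n. E.row_moment n (incidence_count s f i))"
        using assms(7)[of n] by (intro E.expectation_T1_power assms(6) elim) (auto simp: iid_copies_def \<mu>_def)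
      then show ?case by simp
    qed
  qed
qed

end
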